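(* Let $n\ge2$, let $B$ be the open unit ball of $\mathbb{R}^n$ centered at $0$, let $\psi\in C_0^\infty(\mathbb{R}^n)$ with $\operatorname{supp}\psi\subseteq B$ and $\int_{\mathbb{R}^n}\psi=1$, and let $\Omega\subset\mathbb{R}^n$ be a bounded open set star-shaped with respect to every point of $\overline B$. Let $F\in C_D(\Omega)$, extended by $0$ outside $\Omega$, and let $B_R$ be an open ball with $\overline\Omega\subset B_R$, with outward unit normal $\nu$ on $\partial B_R$. For $x\ne y$ let $N_i(x,y)=(x_i-y_i)\int_1^\infty\psi(y+\alpha(x-y))\alpha^{n-1}d\alpha$ and $v_i(x)=\int_\Omega F(y)N_i(x,y)\,dy$. Let $\eta\in C^\infty(\mathbb{R}^+)$ with $\eta\equiv0$ on $[0,1]$, $\eta(t)=1$ for $t\ge2$, $|\eta'|\le2$, and $v^\epsilon_i(x)=\int_\Omega F(y)N_i(x,y)\eta(|x-y|/\epsilon)\,dy$. For $x\in\Omega$ define $$u^i_j(x)=\int_{B_R}[F(y)-F(x)]\,\partial_{x_j}N_i(x,y)\,dy+F(x)\int_{B_R}(x_i-y_i)\int_1^\infty\partial_j\psi(y+\alpha(x-y))\alpha^{n-1}d\alpha\,dy-F(x)\int_{\partial B_R}N_i(x,y)\nu_j(y)\,d\sigma_y.$$ Then: (i) $u^i_j(x)$ is well defined for every $x\in\Omega$; (ii) $\partial_{x_j}v^\epsilon_i\to u^i_j$ uniformly on every open $\Omega'$ with $\overline{\Omega'}\subset\Omega$, as $\epsilon\to0$; (iii) $\partial_{x_j}v_i=u^i_j$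 on $\Omega$; (iv) $v=(v_1,\dots,v_n)\in C^1(\Omega)$.
   Context: For a function $F$ on $\Omega$, $\omega(F,\rho)=\sup_{x,y\in\Omega,\ |x-y|<\rho}|F(x)-F(y)|$; $C_D(\Omega)$ is the space of functions $F$ on $\Omega$ with $\omega(F,\rho)/\rho$ integrable near $0^+$ (uniformly Dini-continuous). $\Omega$ is star-shaped with respect to a point $p$ if $p\in\Omega$ and for every $y\in\Omega$ the segment joining $p$ and $y$ lies in $\Omega$. $\partial_j\psi$ is the partial derivative of $\psi$ in its $j$-th argument. *)

theory Defs
  imports "HOL-Analysis.Analysis"
begin

definition has_partial_deriv :: "'n::finite \<Rightarrow> (real^'n \<Rightarrow> real) \<Rightarrow> real \<Rightarrow> real^'n \<Rightarrow> bool" where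
  "has_partial_deriv j f D x \<longleftrightarrow> ((\<lambda>t. f (x + t *\<^sub>R axis j 1)) has_real_derivative D) (at 0)"

definition partial :: "'n::finite \<Rightarrow> (real^'n \<Rightarrow> real) \<Rightarrow> real^'n \<Rightarrow> real" where
  "partial j f x = deriv (\<lambda>t. f (x + t *\<^sub>R axis j 1)) 0"

fun iter_partial :: "'n::finite list \<Rightarrow> (real^'n \<Rightarrow> real) \<Rightarrow> real^'n \<Rightarrow> real" where
  "iter_partial [] f = f"
| "iter_partial (j # js) f = partial j (iter_partial js f)"

definition smooth_Rn :: "(real^'n::finite \<Rightarrow> real) \<Rightarrow> bool" where
  "smooth_Rn f \<longleftrightarrow> (\<forall>js. continuous_on UNIV (iter_partial js f) \<and>
      (\<forall>j x. \<exists>D. has_partial_deriv j (iter_partial js f) D x))"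

definition smooth_real_on :: "real set \<Rightarrow> (real \<Rightarrow> real) \<Rightarrow> bool" where
  "smooth_real_on S g \<longleftrightarrow> (\<forall>k. \<forall>x\<in>S. (deriv ^^ k) g field_differentiable (at x))"

definition modulus :: "('a::metric_space \<Rightarrow> real) \<Rightarrow> 'a set \<Rightarrow> real \<Rightarrow> real" where
  "modulus F \<Omega> \<rho> = Sup {\<bar>F x - F y\<bar> | x y. x \<in> \<Omega> \<and> y \<in> \<Omega> \<and> dist x y < \<rho>}"

definition dini_continuous :: "('a::metric_space \<Rightarrow> real) \<Rightarrow> 'a set \<Rightarrow> bool" where
  "dini_continuous F \<Omega> \<longleftrightarrow> (\<exists>\<delta>>0.
      (\<forall>\<rho>\<in>{0<..<\<delta>}. bdd_above {\<bar>F x - F y\<bar> | x y. x \<in> \<Omega> \<and> y \<in> \<Omega> \<and> dist x y < \<rho>}) \<and>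
      set_integrable lborel {0<..<\<delta>} (\<lambda>\<rho>. modulus F \<Omega> \<rho> / \<rho>))"

text \<open>Surface integral over the sphere of centre c and radius R (w.r.t. surface measure),
  expressed via polar coordinates: int_{dB_R} g dsigma = (n/R) int_{B_R} g(c + R (x-c)/|x-c|) dx.\<close>
definition sphere_integral :: "real^'n::finite \<Rightarrow> real \<Rightarrow> (real^'n \<Rightarrow> real) \<Rightarrow> real" where
  "sphere_integral c R g =
     real CARD('n) / R * (LINT x : ball c R | lborel. g (c + (R / norm (x - c)) *\<^sub>R (x - c)))"

definition sphere_integrable :: "real^'n::finite \<Rightarrow> real \<Rightarrow> (real^'n \<Rightarrow> real) \<Rightarrow> bool" where
  "sphere_integrable c R g \<longleftrightarrow>
     set_integrable lborel (ball c R) (\<lambda>x. g (c + (R / norm (x - c)) *\<^sub>R (x - c)))"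

definition kernN :: "(real^'n::finite \<Rightarrow> real) \<Rightarrow> 'n \<Rightarrow> real^'n \<Rightarrow> real^'n \<Rightarrow> real" where
  "kernN \<psi> i x y = (x$i - y$i) *
     (LINT \<alpha> : {1..} | lborel. \<psi> (y + \<alpha> *\<^sub>R (x - y)) * \<alpha> ^ (CARD('n) - 1))"

end

(* With x fixed, differentiating under the integral gives d_j v^eps(x) as the integral over B_R of
F(y) d_{x_j}[N_i(x,y) eta(|x-y|/eps)]. Split F(y) = (F(y) - F(x)) + F(x). In the F(x) term use
d_{x_j} N_i = -d_{y_j} N_i + K, where K is N_i with psi replaced by d_j psi, and apply the divergence
theorem on B_R to the y-derivative; for small eps the cut-off equals 1 on the sphere, so
d_j v^eps(x) - u(x) is an integral over |x-y| <= 2 eps only. As |N_i|, |K| <= C |x-y|^(1-n) and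
|d_j N_i| <= C |x-y|^(-n), it is bounded by the integral over |w| <= 2 eps of an integrable radial
function, by the Dini condition, uniformly in x. Hence d_j v^eps tends to u locally uniformly, and
v is C^1 because the d_j v^eps are continuous. *)

theory Submission
  imports Defs
begin

section \<open>Radial integrals and differentiation\<close>

text \<open>The kernel \<open>DN\<close> is of the critical order |x-y|^(-n), so \<open>v\<close>
  cannot be differentiated under the integral directly. The cut-off removes the diagonal at the
  price of a derivative of size 1/eps; this price is paid only where eps <= |x-y| <= 2 eps, so it is
  again of order |x-y|^(-n), uniformly in eps. Two mechanisms restore integrability: the factor F(y)
  - F(x), which gains |x-y| g(|x-y|) with g integrable on the line, and a cancellation: N_i depends
  on y directly and through x-y, and the contributions through x-y cancel in the sum of its x_j- and
  y_j-derivatives, leaving \<open>K\<close>. The first mechanism needs y in Omega, since F extended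
  by 0 may jump at the boundary; so 2 eps must stay below the distance of x to the complement, which
  is why the convergence is only locally uniform. The surface integral is given through a degree-0
  homogeneous extension to the ball. The divergence theorem is therefore obtained from translation
  invariance of Lebesgue measure, applied to a function times a Lipschitz cut-off of the ball, by
  letting a shell shrink.\<close>

lemma distr_norm_lborel:
  "distr (lborel :: 'a::euclidean_space measure) borel norm =
    density lborel (\<lambda>r. ennreal (real DIM('a) * unit_ball_vol (real DIM('a)) * r ^ (DIM('a) - 1) * indicator {0..} r))"
    (is "?M = density lborel ?d")
proof (rule measure_eqI_generator_eq[where E="range (\<lambda>a. {..a::real})" and \<Omega>=UNIV and A="\<lambda>i. {..real i}"])
  let ?n = "DIM('a)" and ?V = "unit_ball_vol (real DIM('a))"
  \<comment> \<open>Half-lines generate the Borel sets, and on them the image measure is the volume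
    of a ball; \<open>?d\<close> is the derivative of that volume in the radius.\<close>
  have eq: "emeasure ?M {..a} = ennreal (?V * a ^ ?n)" if "a \<ge> 0" for a
  proof -
    have "emeasure ?M {..a} = emeasure lborel (cball 0 a :: 'a set)"
      by (subst emeasure_distr) (auto intro!: arg_cong2[where f=emeasure])
    then show ?thesis using emeasure_cball[OF that] by simp
  qed
  show "emeasure ?M X = emeasure (density lborel ?d) X" if X: "X \<in> range (\<lambda>a. {..a::real})" for X
  proof -
    obtain a where a: "X = {..a}" using X by auto
    show ?thesis
    proof (cases "a \<ge> 0")
      case True
      have "emeasure (density lborel ?d) X = (\<integral>\<^sup>+r. ennreal (real ?n * ?V * r ^ (?n - 1)) * indicator {0..a} r \<partial>lborel)"
        unfolding a by (subst emeasure_density) (auto intro!: nn_integral_cong split: split_indicator)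
      also have "\<dots> = ennreal (?V * a ^ ?n - ?V * 0 ^ ?n)"
        using True by (intro nn_integral_FTC_Icc) (auto intro!: derivative_eq_intros)
      finally show ?thesis using eq[OF True] by (simp add: a power_0_left)
    next
      case False
      have "norm -` {..a} = ({} :: 'a set)"
        using False order_trans[OF norm_ge_zero] by auto
      then have "emeasure ?M X = emeasure lborel ({} :: 'a set)"
        unfolding a by (subst emeasure_distr) auto
      moreover have "emeasure (density lborel ?d) X = (\<integral>\<^sup>+r. ?d r * indicator {..a} r \<partial>lborel)"
        unfolding a by (subst emeasure_density) auto
      moreover have "\<dots> = (\<integral>\<^sup>+r. 0 \<partial>(lborel :: real measure))"
        by (intro nn_integral_cong) (use False in \<open>auto split: split_indicator\<close>)
      ultimately show ?thesis by simp
    qed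
  qed
  show "emeasure ?M {..real i} \<noteq> \<infinity>" for i using eq[of "real i"] by simp
  show "Int_stable (range (\<lambda>a. {..a::real}))"
    by (auto simp: Int_stable_def)
  show "(\<Union>i. {..real i}) = UNIV" by (auto simp: real_arch_simple)
qed (auto simp: borel_eq_atMost)

text \<open>The weight 1/r^(n-1) cancels against the density r^(n-1) of the norm. This turns a
  majorant on the line, as the Dini condition supplies it, into one on R^n.\<close>

lemma integrable_radial:
  fixes \<phi> :: "real \<Rightarrow> real"
  assumes "integrable lborel \<phi>"
  shows "integrable lborel (\<lambda>w::'a::euclidean_space. \<phi> (norm w) / norm w ^ (DIM('a) - 1))"
proof -
  let ?c = "real DIM('a) * unit_ball_vol (real DIM('a))"
  have [measurable]: "\<phi> \<in> borel_measurable borel" using assms by auto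
  have "integrable lborel (\<lambda>r. indicator {0..} r *\<^sub>R (?c * \<phi> r))"
    using assms by (intro integrable_mult_indicator) auto
  then have "integrable lborel (\<lambda>r. (?c * r ^ (DIM('a) - 1) * indicator {0..} r) *\<^sub>R (\<phi> r / r ^ (DIM('a) - 1)))"
    \<comment> \<open>At r = 0 the power may vanish and the cancellation fails; one point is
      null.\<close>
    by (rule integrable_discrete_difference[where X="{0}", THEN iffD1, rotated 4]) (auto split: split_indicator)
  then have "integrable (distr (lborel :: 'a measure) borel norm) (\<lambda>r. \<phi> r / r ^ (DIM('a) - 1))"
    unfolding distr_norm_lborel by (subst integrable_density) (auto split: split_indicator)
  then show ?thesis by (subst (asm) integrable_distr_eq) auto
qed

text \<open>Dominated convergence of difference quotients. Differentiability is asked only almost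
  everywhere, with a Lipschitz majorant instead of a bound on nearby derivatives, because one of the
  integrands has kinks along spheres.\<close>

lemma has_real_derivative_integral:
  fixes f :: "real \<Rightarrow> 'a \<Rightarrow> real"
  assumes d: "0 < d" and int: "\<And>t. \<bar>t\<bar> < d \<Longrightarrow> integrable M (f t)"
    and lip: "\<And>t y. \<bar>t\<bar> < d \<Longrightarrow> y \<in> space M \<Longrightarrow> \<bar>f t y - f 0 y\<bar> \<le> \<bar>t\<bar> * w y"
    and w: "integrable M w"
    and der: "AE y in M. ((\<lambda>t. f t y) has_real_derivative f' y) (at 0)"
    and [measurable]: "f' \<in> borel_measurable M"
  shows "((\<lambda>t. \<integral>y. f t y \<partial>M) has_real_derivative (\<integral>y. f' y \<partial>M)) (at 0)"
proof -
  have "((\<lambda>t. ((\<integral>y. f t y \<partial>M) - (\<integral>y. f 0 y \<partial>M)) / (t - 0)) \<longlongrightarrow> (\<integral>y. f' y \<partial>M)) (at 0 within ball 0 d)"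
    unfolding tendsto_at_iff_sequentially
  proof (intro allI impI)
    fix X :: "nat \<Rightarrow> real" assume X: "\<forall>i. X i \<in> ball 0 d - {0}" and lim: "X \<longlonglongrightarrow> 0"
    have Xd: "\<bar>X i\<bar> < d" "X i \<noteq> 0" for i using X by (auto simp: dist_norm)
    have m [measurable]: "f (X i) \<in> borel_measurable M" "f 0 \<in> borel_measurable M" for i
      using int[OF Xd(1)] int[of 0] d by auto
    have "(\<lambda>i. \<integral>y. (f (X i) y - f 0 y) / X i \<partial>M) \<longlonglongrightarrow> (\<integral>y. f' y \<partial>M)"
    proof (rule integral_dominated_convergence[where w=w])
      show "AE y in M. (\<lambda>i. (f (X i) y - f 0 y) / X i) \<longlonglongrightarrow> f' y"
        using der
      proof eventually_elim
        case (elim y)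
        then have "((\<lambda>t. (f t y - f 0 y) / (t - 0)) \<longlongrightarrow> f' y) (at 0)"
          by (simp add: has_field_derivative_iff)
        then show ?case
          using Xd(2) lim unfolding tendsto_at_iff_sequentially by (auto simp: o_def)
      qed
      show "AE y in M. norm ((f (X i) y - f 0 y) / X i) \<le> w y" for i
        using lip[OF Xd(1)[of i]] Xd(2)[of i] by (intro AE_I2) (simp add: field_simps)
    qed (use w in auto)
    also have "(\<lambda>i. \<integral>y. (f (X i) y - f 0 y) / X i \<partial>M) = (\<lambda>i. ((\<integral>y. f (X i) y \<partial>M) - (\<integral>y. f 0 y \<partial>M)) / X i)"
      using int[OF Xd(1)] int[of 0] d by (intro ext) (simp add: Bochner_Integration.integral_diff)
    finally show "((\<lambda>t. ((\<integral>y. f t y \<partial>M) - (\<integral>y. f 0 y \<partial>M)) / (t - 0)) \<circ> X) \<longlonglongrightarrow> (\<integral>y. f' y \<partial>M)"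
      by (simp add: o_def)
  qed
  then show ?thesis
    using d by (simp add: has_field_derivative_iff at_within_open[of 0 "ball 0 d"])
qed

lemma has_partial_deriv_shift:
  assumes "has_partial_deriv j f D (x + t *\<^sub>R axis j 1)"
  shows "((\<lambda>t. f (x + t *\<^sub>R axis j 1)) has_real_derivative D) (at t)"
proof -
  have "((\<lambda>s. f (x + t *\<^sub>R axis j 1 + s *\<^sub>R axis j 1)) has_real_derivative D) (at (t + - t))"
    using assms unfolding has_partial_deriv_def by simp
  then have "((\<lambda>s. f (x + t *\<^sub>R axis j 1 + (s + - t) *\<^sub>R axis j 1)) has_real_derivative D) (at t)"
    by (subst (asm) DERIV_shift)
  then show ?thesis by (simp add: algebra_simps)
qed

text \<open>The increment is telescoped along the coordinate axes; on each edge the mean value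
  theorem produces a partial derivative at a nearby point, which continuity compares with the one at
  \<open>x\<close>.\<close>

lemma has_derivative_partials:
  fixes f :: "real^'n::finite \<Rightarrow> real"
  assumes U: "open U" "x \<in> U"
    and p: "\<And>j y. y \<in> U \<Longrightarrow> has_partial_deriv j f (p j y) y"
    and cont: "\<And>j. continuous_on U (p j)"
  shows "(f has_derivative (\<lambda>h. \<Sum>j\<in>UNIV. p j x * h$j)) (at x)"
  unfolding has_derivative_at_alt
proof (intro conjI allI impI)
  show "bounded_linear (\<lambda>h. \<Sum>j\<in>UNIV. p j x * h$j)"
    by (intro bounded_linear_sum bounded_linear_const_mult bounded_linear_vec_nth)
  fix e :: real assume e: "e > 0"
  \<comment> \<open>Each of the n edges contributes an error of at most
    \<open>e' * norm h\<close>.\<close>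
  define e' where "e' = e / real CARD('n)"
  have e': "e' > 0" using e by (simp add: e'_def)
  have "\<exists>d>0. \<forall>y. norm (y - x) < d \<longrightarrow> y \<in> U \<and> \<bar>p j y - p j x\<bar> < e'" for j
  proof -
    obtain d1 where "d1 > 0" "ball x d1 \<subseteq> U" using U open_contains_ball by blast
    moreover obtain d2 where "d2 > 0" "\<forall>y\<in>U. dist y x < d2 \<longrightarrow> dist (p j y) (p j x) < e'"
      using cont[of j] U e' unfolding continuous_on_iff by blast
    ultimately show ?thesis
      by (intro exI[of _ "min d1 d2"]) (auto simp: dist_norm norm_minus_commute subset_iff)
  qed
  then obtain d where d: "\<And>j. d j > 0" "\<And>j y. norm (y - x) < d j \<Longrightarrow> y \<in> U \<and> \<bar>p j y - p j x\<bar> < e'"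
    by metis
  define \<delta> where "\<delta> = Min (range d)"
  have \<delta>: "\<delta> > 0" "\<And>j. \<delta> \<le> d j" unfolding \<delta>_def using d(1) by auto
  have near: "y \<in> U" "\<bar>p j y - p j x\<bar> < e'" if "norm (y - x) < \<delta>" for j y
    using d(2)[of y j] that \<delta>(2)[of j] by auto
  show "\<exists>d>0. \<forall>y. norm (y - x) < d \<longrightarrow> norm (f y - f x - (\<Sum>j\<in>UNIV. p j x * (y - x)$j)) \<le> e * norm (y - x)"
  proof (intro exI[of _ \<delta>] conjI allI impI \<delta>)
    fix y assume y: "norm (y - x) < \<delta>"
    define h where "h = y - x"
    \<comment> \<open>Truncation of \<open>h\<close> to the coordinates in \<open>S\<close>: adding
      one index to \<open>S\<close> moves along one axis.\<close>
    define hh where "hh S = (\<chi> j. if j \<in> S then h$j else 0)" for S :: "'n set"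
    have *: "\<bar>f (x + hh S) - f x - (\<Sum>j\<in>S. p j x * h$j)\<bar> \<le> real (card S) * e' * norm h" if "finite S" for S
      using that
    proof (induction S)
      case empty
      have "hh {} = 0" by (simp add: hh_def vec_eq_iff)
      then show ?case by simp
    next
      case (insert k S)
      have hk: "hh (insert k S) = hh S + (h$k) *\<^sub>R axis k 1"
        using insert by (auto simp: hh_def vec_eq_iff axis_def)
      \<comment> \<open>Coordinate \<open>k\<close> of \<open>hh S\<close> is 0, so every point of
        the edge is componentwise dominated by \<open>h\<close> and the edge does not leave the ball
        of radius \<open>\<delta>\<close>.\<close>
      have le: "norm (hh S + t *\<^sub>R axis k 1) \<le> norm h" if "\<bar>t\<bar> \<le> \<bar>h$k\<bar>" for t
        using that insert(2) by (intro norm_le_componentwise_cart) (auto simp: hh_def axis_def)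
      have "\<exists>z. \<bar>z\<bar> \<le> \<bar>h$k\<bar> \<and> f (x + hh (insert k S)) - f (x + hh S) = p k (x + hh S + z *\<^sub>R axis k 1) * h$k"
      proof -
        have der: "((\<lambda>t. f (x + hh S + t *\<^sub>R axis k 1)) has_real_derivative p k (x + hh S + t *\<^sub>R axis k 1)) (at t)"
          if t: "\<bar>t\<bar> \<le> \<bar>h$k\<bar>" for t
        proof (rule has_partial_deriv_shift, rule p)
          have "norm (x + hh S + t *\<^sub>R axis k 1 - x) < \<delta>" using le[OF t] y by (simp add: h_def algebra_simps)
          then show "x + hh S + t *\<^sub>R axis k 1 \<in> U" using near(1) by blast
        qed
        consider "h$k = 0" | "h$k > 0" | "h$k < 0" by linarith
        then show ?thesis
        proof cases
          case 1 then show ?thesis by (intro exI[of _ 0]) (simp add: hk)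
        next
          case 2
          then obtain z where "z > 0" "z < h$k" "f (x + hh S + (h$k) *\<^sub>R axis k 1) - f (x + hh S + 0 *\<^sub>R axis k 1)
             = (h$k - 0) * p k (x + hh S + z *\<^sub>R axis k 1)"
            using MVT2[of 0 "h$k" "\<lambda>t. f (x + hh S + t *\<^sub>R axis k 1)" "\<lambda>t. p k (x + hh S + t *\<^sub>R axis k 1)"] der
            by auto
          then show ?thesis by (intro exI[of _ z]) (simp add: hk add.assoc)
        next
          case 3
          then obtain z where "z > h$k" "z < 0" "f (x + hh S + 0 *\<^sub>R axis k 1) - f (x + hh S + (h$k) *\<^sub>R axis k 1)
             = (0 - h$k) * p k (x + hh S + z *\<^sub>R axis k 1)"
            using MVT2[of "h$k" 0 "\<lambda>t. f (x + hh S + t *\<^sub>R axis k 1)" "\<lambda>t. p k (x + hh S + t *\<^sub>R axis k 1)"] der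
            by auto
          then show ?thesis by (intro exI[of _ z]) (simp add: hk add.assoc mult.commute[of "h$k"])
        qed
      qed
      then obtain z where z: "\<bar>z\<bar> \<le> \<bar>h$k\<bar>"
        "f (x + hh (insert k S)) - f (x + hh S) = p k (x + hh S + z *\<^sub>R axis k 1) * h$k" by blast
      have "\<bar>p k (x + hh S + z *\<^sub>R axis k 1) - p k x\<bar> < e'"
        using le[OF z(1)] y by (intro near) (simp add: h_def algebra_simps)
      then have "\<bar>(p k (x + hh S + z *\<^sub>R axis k 1) - p k x) * h$k\<bar> \<le> e' * norm h"
        unfolding abs_mult using component_le_norm_cart[of h k] by (intro mult_mono) auto
      moreover have "f (x + hh (insert k S)) - f x - (\<Sum>j\<in>insert k S. p j x * h$j) =
          (f (x + hh S) - f x - (\<Sum>j\<in>S. p j x * h$j)) + (p k (x + hh S + z *\<^sub>R axis k 1) - p k x) * h$k"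
        using insert z(2) by (simp add: algebra_simps)
      ultimately have "\<bar>f (x + hh (insert k S)) - f x - (\<Sum>j\<in>insert k S. p j x * h$j)\<bar> \<le> real (card S) * e' * norm h + e' * norm h"
        using insert.IH by linarith
      then show ?case using insert by (simp add: algebra_simps)
    qed
    have "hh UNIV = h" by (simp add: hh_def vec_eq_iff)
    then show "norm (f y - f x - (\<Sum>j\<in>UNIV. p j x * (y - x)$j)) \<le> e * norm (y - x)"
      using *[of UNIV] by (simp add: h_def e'_def)
  qed
qed

section \<open>Lebesgue integrals under translation and dilation, and over thin shells\<close>

lemma ball_sets_borel [measurable]: "ball c r \<in> sets borel" "cball c r \<in> sets borel"
  by simp_all

lemma integrable_bounded_support:
  fixes f :: "'a::euclidean_space \<Rightarrow> real"
  assumes [measurable]: "f \<in> borel_measurable borel" and "bounded S"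
    and "\<And>y. y \<notin> S \<Longrightarrow> f y = 0" "\<And>y. y \<in> S \<Longrightarrow> \<bar>f y\<bar> \<le> B"
  shows "integrable lborel f"
proof -
  obtain r where "\<forall>y\<in>S. norm y \<le> r" using \<open>bounded S\<close> by (auto simp: bounded_iff)
  then have r: "S \<subseteq> cball 0 r" by auto
  show ?thesis
  proof (rule Bochner_Integration.integrable_bound)
    show "integrable lborel (\<lambda>y. \<bar>B\<bar> * indicator (cball 0 r) y :: real)"
      by (intro integrable_mult_right integrable_real_indicator emeasure_lborel_cball_finite) simp
    show "AE y in lborel. norm (f y) \<le> norm (\<bar>B\<bar> * indicator (cball 0 r) y :: real)"
    proof (rule AE_I2)
      fix y
      show "norm (f y) \<le> norm (\<bar>B\<bar> * indicator (cball 0 r) y :: real)"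
      proof (cases "y \<in> S")
        case True
        then have "y \<in> cball 0 r" using r by blast
        then show ?thesis using assms(4)[OF True] by simp
      next
        case False
        then show ?thesis using assms(3)[OF False] by simp
      qed
    qed
  qed simp
qed

lemma lborel_integral_translate:
  fixes f :: "'a::euclidean_space \<Rightarrow> real"
  assumes [measurable]: "f \<in> borel_measurable borel"
  shows "(\<integral>y. f (a + y) \<partial>lborel) = (\<integral>y. f y \<partial>lborel)"
  by (subst (2) lborel_distr_plus[symmetric, of a], subst integral_distr) auto

lemma lborel_integral_scale:
  fixes f :: "'a::euclidean_space \<Rightarrow> real"
  assumes [measurable]: "f \<in> borel_measurable borel" and "c > 0"
  shows "(\<integral>y. f y \<partial>lborel) = c ^ DIM('a) * (\<integral>y. f (c *\<^sub>R y) \<partial>lborel)"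
proof -
  have "(\<integral>y. f y \<partial>lborel) = (\<integral>y. f y \<partial>(density (distr lborel borel (\<lambda>x. 0 + c *\<^sub>R x)) (\<lambda>_. \<bar>c\<bar>^DIM('a))))"
    using lborel_affine[of c "0::'a"] \<open>c > 0\<close> by simp
  also have "\<dots> = c ^ DIM('a) * (\<integral>y. f (c *\<^sub>R y) \<partial>lborel)"
    using \<open>c > 0\<close> by (subst integral_density) (auto simp: integral_distr)
  finally show ?thesis .
qed

lemma AE_norm_neq: "AE y in lborel. norm (y :: 'a::euclidean_space) \<noteq> r"
proof -
  from negligible_sphere[of 0 r] have "sphere (0::'a) r \<in> null_sets lborel"
    by (auto simp: null_sets_completion_iff negligible_iff_null_sets negligible_convex_frontier)
  from AE_not_in[OF this] show ?thesis by simp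
qed

text \<open>Dilation by \<rho>/R multiplies the integral of a degree-0 homogeneous function over a
  ball by (\<rho>/R)^n, and a shell is a difference of two balls up to a null sphere. It links
  integrals over shells to \<open>sphere_integral\<close>, whose integrand is such an
  extension.\<close>

lemma integral_shell_homogeneous:
  fixes h :: "'a::euclidean_space \<Rightarrow> real"
  assumes [measurable]: "h \<in> borel_measurable borel" and h: "\<And>c y. c > 0 \<Longrightarrow> h (c *\<^sub>R y) = h y"
    and bdd: "\<And>y. \<bar>h y\<bar> \<le> B" and R: "0 < R" "R < \<rho>"
  shows "(\<integral>y. indicator {y. R < norm y \<and> norm y < \<rho>} y * h y \<partial>lborel) =
    ((\<rho> / R) ^ DIM('a) - 1) * (\<integral>y. indicator (ball 0 R) y * h y \<partial>lborel)"
proof -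
  have meas: "(\<lambda>y. indicator (ball 0 r) y * h y) \<in> borel_measurable borel" for r
    by (intro borel_measurable_times borel_measurable_indicator assms(1)) simp
  have int: "integrable lborel (\<lambda>y. indicator (ball 0 r) y * h y)" for r
  proof (rule integrable_bounded_support[of _ "ball 0 r" B])
    show "(\<lambda>y. indicator (ball 0 r) y * h y) \<in> borel_measurable borel" by (rule meas)
  qed (use bdd in simp_all)
  have "(\<integral>y. indicator (ball 0 \<rho>) y * h y \<partial>lborel) =
      (\<rho> / R) ^ DIM('a) * (\<integral>y. indicator (ball 0 \<rho>) ((\<rho> / R) *\<^sub>R y) * h ((\<rho> / R) *\<^sub>R y) \<partial>lborel)"
  proof (rule lborel_integral_scale)
    show "(\<lambda>y. indicator (ball 0 \<rho>) y * h y) \<in> borel_measurable borel" by (rule meas)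
  qed (use R in simp)
  also have "(\<lambda>y. indicator (ball 0 \<rho>) ((\<rho> / R) *\<^sub>R y) * h ((\<rho> / R) *\<^sub>R y)) = (\<lambda>y. indicator (ball 0 R) y * h y)"
    using R by (intro ext) (simp add: h indicator_def field_simps)
  finally have 1: "(\<integral>y. indicator (ball 0 \<rho>) y * h y \<partial>lborel) = (\<rho> / R) ^ DIM('a) * (\<integral>y. indicator (ball 0 R) y * h y \<partial>lborel)" .
  have "(\<integral>y. indicator {y. R < norm y \<and> norm y < \<rho>} y * h y \<partial>lborel) =
      (\<integral>y. indicator (ball 0 \<rho>) y * h y - indicator (ball 0 R) y * h y \<partial>lborel)"
  proof (rule integral_cong_AE)
    show "AE y in lborel. indicator {y. R < norm y \<and> norm y < \<rho>} y * h y =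
        indicator (ball 0 \<rho>) y * h y - indicator (ball 0 R) y * h y"
      using AE_norm_neq[of R] by eventually_elim (use R in \<open>auto split: split_indicator\<close>)
    show "(\<lambda>y. indicator (ball 0 \<rho>) y * h y - indicator (ball 0 R) y * h y) \<in> borel_measurable lborel"
      using meas by simp
  qed auto
  also have "\<dots> = ((\<rho> / R) ^ DIM('a) - 1) * (\<integral>y. indicator (ball 0 R) y * h y \<partial>lborel)"
    using int by (subst Bochner_Integration.integral_diff) (auto simp: 1 left_diff_distrib)
  finally show ?thesis .
qed

lemma has_partial_deriv_lipschitz:
  assumes "\<And>s. \<bar>s\<bar> \<le> \<bar>t\<bar> \<Longrightarrow> has_partial_deriv j G (G' (y + s *\<^sub>R axis j 1)) (y + s *\<^sub>R axis j 1)"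
    and "\<And>s. \<bar>s\<bar> \<le> \<bar>t\<bar> \<Longrightarrow> \<bar>G' (y + s *\<^sub>R axis j 1)\<bar> \<le> B"
  shows "\<bar>G (y + t *\<^sub>R axis j 1) - G y\<bar> \<le> \<bar>t\<bar> * B"
proof -
  have "norm (G (y + t *\<^sub>R axis j 1) - G (y + 0 *\<^sub>R axis j 1)) \<le> B * norm (t - 0)"
  proof (rule field_differentiable_bound[where S="{-\<bar>t\<bar>..\<bar>t\<bar>}"])
    show "((\<lambda>s. G (y + s *\<^sub>R axis j 1)) has_real_derivative G' (y + s *\<^sub>R axis j 1)) (at s within {-\<bar>t\<bar>..\<bar>t\<bar>})"
      if "s \<in> {-\<bar>t\<bar>..\<bar>t\<bar>}" for s
      by (rule has_field_derivative_at_within, rule has_partial_deriv_shift, rule assms(1)) (use that in auto)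
    show "norm (G' (y + s *\<^sub>R axis j 1)) \<le> B" if "s \<in> {-\<bar>t\<bar>..\<bar>t\<bar>}" for s
      using assms(2)[of s] that by auto
  qed auto
  then show ?thesis by (simp add: mult.commute)
qed

lemma has_real_derivative_norm_axis:
  fixes y :: "real^'n"
  assumes "y \<noteq> 0"
  shows "((\<lambda>t. norm (y + t *\<^sub>R (r *\<^sub>R axis j 1))) has_real_derivative r * y$j / norm y) (at 0)"
proof -
  have "((\<lambda>t. y + t *\<^sub>R (r *\<^sub>R axis j 1)) has_derivative (\<lambda>t. t *\<^sub>R (r *\<^sub>R axis j 1))) (at 0)"
    by (auto intro!: derivative_eq_intros)
  moreover have "(norm has_derivative (\<lambda>h. h \<bullet> sgn y)) (at (y + 0 *\<^sub>R (r *\<^sub>R axis j 1)))"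
    using has_derivative_norm[OF assms] by simp
  ultimately have "((\<lambda>t. norm (y + t *\<^sub>R (r *\<^sub>R axis j 1))) has_derivative
      (\<lambda>t. (t *\<^sub>R (r *\<^sub>R axis j 1)) \<bullet> sgn y)) (at 0)"
    by (rule has_derivative_compose)
  then show ?thesis
    unfolding has_field_derivative_def
    by (rule has_derivative_eq_rhs) (auto simp: inner_axis' fun_eq_iff sgn_div_norm divide_inverse_commute)
qed

section \<open>The divergence theorem on a ball\<close>

text \<open>On the shell the gradient is -1/\<delta> times the outward normal y/|y|, so integrating
  by parts against this profile gives exactly the shell average of G times a component of the
  normal.\<close>

definition cutoff :: "real \<Rightarrow> real \<Rightarrow> 'a::real_normed_vector \<Rightarrow> real" where
  "cutoff R \<delta> y = max 0 (min 1 ((R + \<delta> - norm y) / \<delta>))"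

lemma cutoff_lipschitz:
  assumes "\<delta> > 0" shows "\<bar>cutoff R \<delta> x - cutoff R \<delta> y\<bar> \<le> norm (x - y) / \<delta>"
proof -
  have *: "\<bar>max 0 (min 1 p) - max 0 (min 1 q)\<bar> \<le> \<bar>p - q\<bar>" for p q :: real by linarith
  have "\<bar>cutoff R \<delta> x - cutoff R \<delta> y\<bar> \<le> \<bar>(R + \<delta> - norm x) / \<delta> - (R + \<delta> - norm y) / \<delta>\<bar>"
    unfolding cutoff_def by (rule *)
  also have "\<dots> = \<bar>norm x - norm y\<bar> / \<delta>"
    using assms by (simp add: diff_divide_distrib[symmetric] abs_minus_commute)
  also have "\<dots> \<le> norm (x - y) / \<delta>"
    using assms norm_triangle_ineq3[of x y] by (simp add: divide_right_mono)
  finally show ?thesis .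
qed

lemma cutoff_bounds: "0 \<le> cutoff R \<delta> y" "cutoff R \<delta> y \<le> 1"
  by (auto simp: cutoff_def)

lemma cutoff_eq:
  assumes "\<delta> > 0"
  shows "norm y \<le> R \<Longrightarrow> cutoff R \<delta> y = 1" "norm y \<ge> R + \<delta> \<Longrightarrow> cutoff R \<delta> y = 0"
    "R \<le> norm y \<Longrightarrow> norm y \<le> R + \<delta> \<Longrightarrow> cutoff R \<delta> y = (R + \<delta> - norm y) / \<delta>"
  using assms by (auto simp: cutoff_def max_def min_def field_simps)

lemma cutoff_measurable [measurable]: "cutoff R \<delta> \<in> borel_measurable borel"
  unfolding cutoff_def[abs_def] by measurable

text \<open>The integral of \<open>G * cutoff R \<delta>\<close> is invariant under translation along the \<open>j\<close>-th axis, so its derivative vanishes.\<close>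

lemma integral_cutoff_parts:
  fixes G :: "real^'n \<Rightarrow> real"
  assumes R: "R > 0" and \<delta>: "0 < \<delta>" "\<delta> \<le> 1"
    and cG: "continuous_on UNIV G" and cG': "continuous_on UNIV G'"
    and der: "\<And>y. has_partial_deriv j G (G' y) y"
  shows "(\<integral>y. cutoff R \<delta> y * G' y \<partial>lborel) =
    (\<integral>y. indicator {y. R < norm y \<and> norm y < R + \<delta>} y * (G y * (y$j / norm y)) \<partial>lborel) / \<delta>"
proof -
  let ?e = "axis j 1 :: real^'n"
  let ?S = "{y::real^'n. R < norm y \<and> norm y < R + \<delta>}"
  have [measurable]: "G \<in> borel_measurable borel" "G' \<in> borel_measurable borel"
    using cG cG' by (auto intro: borel_measurable_continuous_onI)
  \<comment> \<open>For |t| < 1 and \<delta> \<le> 1 the translated integrand lives in the ball of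
    radius R + 2, and the translated points then stay within R + 3.\<close>
  have "bounded (G ` cball 0 (R + 3))" "bounded (G' ` cball 0 (R + 3))"
    by (auto intro!: compact_imp_bounded compact_continuous_image continuous_on_subset[OF cG] continuous_on_subset[OF cG'])
  then obtain B0 B1 where "\<forall>y\<in>cball 0 (R + 3). \<bar>G y\<bar> \<le> B0" "\<forall>y\<in>cball 0 (R + 3). \<bar>G' y\<bar> \<le> B1"
    by (auto simp: bounded_iff)
  then have B: "\<And>y. norm y \<le> R + 3 \<Longrightarrow> \<bar>G y\<bar> \<le> B0" "\<And>y. norm y \<le> R + 3 \<Longrightarrow> \<bar>G' y\<bar> \<le> B1"
    by auto
  have Bnn: "B0 \<ge> 0" "B1 \<ge> 0" using B[of 0] R by auto
  define f where "f t y = G (t *\<^sub>R ?e + y) * cutoff R \<delta> (t *\<^sub>R ?e + y)" for t y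
  define f' where "f' y = cutoff R \<delta> y * G' y - indicator ?S y * (G y * (y$j / norm y)) / \<delta>" for y
  have [measurable]: "f t \<in> borel_measurable borel" "f' \<in> borel_measurable borel" for t
    unfolding f_def[abs_def] f'_def[abs_def] by measurable
  have ne: "norm (t *\<^sub>R ?e + y) \<le> norm y + \<bar>t\<bar>" "norm y - \<bar>t\<bar> \<le> norm (t *\<^sub>R ?e + y)" for t y
    using norm_triangle_ineq[of "t *\<^sub>R ?e" y] norm_triangle_ineq4[of "t *\<^sub>R ?e + y" "t *\<^sub>R ?e"] by auto
  have comp: "\<bar>y$j / norm y\<bar> \<le> 1" for y :: "real^'n"
    using component_le_norm_cart[of y j] by (auto simp: divide_le_eq_1)
  have "((\<lambda>t. \<integral>y. f t y \<partial>lborel) has_real_derivative (\<integral>y. f' y \<partial>lborel)) (at 0)"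
  \<comment> \<open>In the majorant, \<open>B1\<close> controls the quotient of \<open>G\<close>,
    and \<open>B0 / \<delta>\<close> is the bound of \<open>G\<close> times the Lipschitz constant
    of the cut-off.\<close>
  proof (rule has_real_derivative_integral[where d=1 and w="\<lambda>y. indicator (cball 0 (R + 2)) y * (B1 + B0 / \<delta>)"])
    show "integrable lborel (f t)" if "\<bar>t\<bar> < 1" for t
    proof (rule integrable_bounded_support[of _ "cball 0 (R + 2)" "B0"])
      show "f t y = 0" if "y \<notin> cball 0 (R + 2)" for y
        using ne(2)[of y t] that \<open>\<bar>t\<bar> < 1\<close> \<delta> by (simp add: f_def cutoff_eq)
      show "\<bar>f t y\<bar> \<le> B0" if "y \<in> cball 0 (R + 2)" for y
      proof -
        have "\<bar>G (t *\<^sub>R ?e + y)\<bar> \<le> B0" using ne(1)[of t y] that \<open>\<bar>t\<bar> < 1\<close> by (intro B) auto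
        moreover have "\<bar>cutoff R \<delta> (t *\<^sub>R ?e + y)\<bar> \<le> 1" using cutoff_bounds[of R \<delta> "t *\<^sub>R ?e + y"] by simp
        ultimately have "\<bar>f t y\<bar> \<le> B0 * 1" unfolding f_def abs_mult using Bnn by (intro mult_mono) auto
        then show ?thesis by simp
      qed
    qed auto
    show "\<bar>f t y - f 0 y\<bar> \<le> \<bar>t\<bar> * (indicator (cball 0 (R + 2)) y * (B1 + B0 / \<delta>))" if t: "\<bar>t\<bar> < 1" for t y
    proof (cases "y \<in> cball 0 (R + 2)")
      case False
      then show ?thesis using ne(2)[of y t] t \<delta> by (simp add: f_def cutoff_eq)
    next
      case True
      have 1: "\<bar>G (y + t *\<^sub>R ?e) - G y\<bar> \<le> \<bar>t\<bar> * B1"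
      proof (rule has_partial_deriv_lipschitz[OF der])
        fix s assume "\<bar>s\<bar> \<le> \<bar>t\<bar>"
        then show "\<bar>G' (y + s *\<^sub>R ?e)\<bar> \<le> B1" using True ne(1)[of s y] t by (intro B) (auto simp: add.commute)
      qed
      have "\<bar>cutoff R \<delta> (t *\<^sub>R ?e + y) - cutoff R \<delta> y\<bar> \<le> norm (t *\<^sub>R ?e + y - y) / \<delta>"
        by (rule cutoff_lipschitz[OF \<delta>(1)])
      then have 2: "\<bar>cutoff R \<delta> (t *\<^sub>R ?e + y) - cutoff R \<delta> y\<bar> \<le> \<bar>t\<bar> / \<delta>" by simp
      have "f t y - f 0 y = (G (y + t *\<^sub>R ?e) - G y) * cutoff R \<delta> (t *\<^sub>R ?e + y) +
          G y * (cutoff R \<delta> (t *\<^sub>R ?e + y) - cutoff R \<delta> y)"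
        by (simp add: f_def algebra_simps)
      also have "\<bar>\<dots>\<bar> \<le> \<bar>G (y + t *\<^sub>R ?e) - G y\<bar> * \<bar>cutoff R \<delta> (t *\<^sub>R ?e + y)\<bar> +
          \<bar>G y\<bar> * \<bar>cutoff R \<delta> (t *\<^sub>R ?e + y) - cutoff R \<delta> y\<bar>"
        unfolding abs_mult[symmetric] by (rule abs_triangle_ineq)
      also have "\<dots> \<le> (\<bar>t\<bar> * B1) * 1 + B0 * (\<bar>t\<bar> / \<delta>)"
        using 1 2 True cutoff_bounds[of R \<delta> "t *\<^sub>R ?e + y"] Bnn
        by (intro add_mono mult_mono B) auto
      finally show ?thesis using True by (simp add: algebra_simps)
    qed
    show "integrable lborel (\<lambda>y::real^'n. indicator (cball 0 (R + 2)) y * (B1 + B0 / \<delta>))"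
      by (intro integrable_mult_left integrable_real_indicator emeasure_lborel_cball_finite) simp
    \<comment> \<open>The exceptional points are the origin, where the norm has no derivative, and
      the two spheres carrying the kinks of the cut-off.\<close>
    show "AE y in lborel. ((\<lambda>t. f t y) has_real_derivative f' y) (at 0)"
      using AE_norm_neq[of 0] AE_norm_neq[of R] AE_norm_neq[of "R + \<delta>"]
    proof eventually_elim
      case (elim y)
      have dG: "((\<lambda>t. G (t *\<^sub>R ?e + y)) has_real_derivative G' y) (at 0)"
        using der[of y] by (simp add: has_partial_deriv_def add.commute)
      have dn: "((\<lambda>t. norm (t *\<^sub>R ?e + y)) has_real_derivative y$j / norm y) (at 0)"
        using has_real_derivative_norm_axis[of y 1 j] elim(1) by (simp add: add.commute)
      consider "norm y < R" | "norm y > R + \<delta>" | "R < norm y" "norm y < R + \<delta>"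
        using elim by linarith
      then show ?case
      proof cases
        case 1
        have "((\<lambda>t. f t y) has_real_derivative G' y) (at 0)"
          by (rule has_field_derivative_transform_within_open[OF dG, of "{t. norm (t *\<^sub>R ?e + y) < R}"])
            (use 1 \<delta> in \<open>auto simp: f_def cutoff_eq intro!: open_Collect_less continuous_intros\<close>)
        then show ?thesis using 1 \<delta> by (simp add: f'_def cutoff_eq)
      next
        case 2
        have "((\<lambda>t. f t y) has_real_derivative 0) (at 0)"
          by (rule has_field_derivative_transform_within_open[OF DERIV_const, of "{t. R + \<delta> < norm (t *\<^sub>R ?e + y)}" _ 0])
            (use 2 \<delta> in \<open>auto simp: f_def cutoff_eq intro!: open_Collect_less continuous_intros\<close>)
        then show ?thesis using 2 \<delta> by (simp add: f'_def cutoff_eq)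
      next
        case 3
        have "((\<lambda>t. G (t *\<^sub>R ?e + y) * ((R + \<delta> - norm (t *\<^sub>R ?e + y)) / \<delta>)) has_real_derivative
            G' y * ((R + \<delta> - norm y) / \<delta>) + (- (y$j / norm y) / \<delta>) * G y) (at 0)"
          using DERIV_mult'[OF dG DERIV_cdivide[OF DERIV_diff[OF DERIV_const dn], of "R + \<delta>" \<delta>]] by (simp add: mult.commute add.commute)
        then have "((\<lambda>t. f t y) has_real_derivative
            G' y * ((R + \<delta> - norm y) / \<delta>) + (- (y$j / norm y) / \<delta>) * G y) (at 0)"
          by (rule has_field_derivative_transform_within_open[of _ _ _ "{t. R < norm (t *\<^sub>R ?e + y)} \<inter> {t. norm (t *\<^sub>R ?e + y) < R + \<delta>}"])
            (use 3 \<delta> in \<open>auto simp: f_def cutoff_eq intro!: open_Int open_Collect_less continuous_intros\<close>)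
        then show ?thesis using 3 \<delta> by (simp add: f'_def cutoff_eq mult.commute)
      qed
    qed
  qed auto
  moreover have "(\<lambda>t. \<integral>y. f t y \<partial>lborel) = (\<lambda>t. \<integral>y. G y * cutoff R \<delta> y \<partial>lborel)"
    unfolding f_def by (intro ext lborel_integral_translate) measurable
  ultimately have 0: "(\<integral>y. f' y \<partial>lborel) = 0"
    using DERIV_unique DERIV_const by metis
  have i1: "integrable lborel (\<lambda>y. cutoff R \<delta> y * G' y)"
  proof (rule integrable_bounded_support[of _ "cball 0 (R + 1)" "B1"])
    show "\<bar>cutoff R \<delta> y * G' y\<bar> \<le> B1" if "y \<in> cball 0 (R + 1)" for y
      using mult_mono[of "\<bar>cutoff R \<delta> y\<bar>" 1 "\<bar>G' y\<bar>" B1] that cutoff_bounds[of R \<delta> y] B(2)[of y] by (simp add: abs_mult)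
  qed (use \<delta> in \<open>auto simp: cutoff_eq\<close>)
  have i2: "integrable lborel (\<lambda>y. indicator ?S y * (G y * (y$j / norm y)) / \<delta>)"
  proof (intro integrable_divide integrable_bounded_support[of _ "cball 0 (R + 1)" "B0"])
    show "\<bar>indicator ?S y * (G y * (y$j / norm y))\<bar> \<le> B0" if "y \<in> cball 0 (R + 1)" for y
      using mult_mono[of "\<bar>G y\<bar>" B0 "\<bar>y$j / norm y\<bar>" 1] that comp[of y] B(1)[of y]
      by (auto simp: abs_mult indicator_def)
  qed (use \<delta> in auto)
  from 0 have "(\<integral>y. cutoff R \<delta> y * G' y \<partial>lborel) - (\<integral>y. indicator ?S y * (G y * (y$j / norm y)) / \<delta> \<partial>lborel) = 0"
    unfolding f'_def Bochner_Integration.integral_diff[OF i1 i2] .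
  then show ?thesis by (simp only: integral_divide_zero right_minus_eq)
qed

text \<open>Both sides are the limit of \<open>P m\<close>, the shell average of width
  \<open>\<delta> m\<close>. By parts it is the integral of \<open>G'\<close> against the cut-off,
  which tends to the integral over the ball. Directly, uniform continuity replaces \<open>G\<close>
  on the shell by its values on the sphere, after which the shell integral is explicit.\<close>

lemma divergence_ball_0:
  fixes G :: "real^'n \<Rightarrow> real"
  assumes R: "R > 0"
    and cG: "continuous_on UNIV G" and cG': "continuous_on UNIV G'"
    and der: "\<And>y. has_partial_deriv j G (G' y) y"
  shows "(LINT y : ball 0 R | lborel. G' y) = sphere_integral 0 R (\<lambda>y. G y * (y$j / R))"
proof -
  let ?n = "CARD('n)"
  define shell where "shell \<delta> = {y::real^'n. R < norm y \<and> norm y < R + \<delta>}" for \<delta>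
  define \<delta> where "\<delta> m = 1 / real (Suc m)" for m
  have \<delta>: "0 < \<delta> m" "\<delta> m \<le> 1" for m by (auto simp: \<delta>_def)
  have \<delta>0: "\<delta> \<longlonglongrightarrow> 0" unfolding \<delta>_def by (rule LIMSEQ_Suc[OF lim_1_over_n])
  \<comment> \<open>The degree-0 homogeneous extension of \<open>G\<close> times the normal
    component from the sphere, that is, the integrand in \<open>sphere_integral\<close>.\<close>
  define h where "h y = G ((R / norm y) *\<^sub>R y) * (y$j / norm y)" for y
  have [measurable]: "G \<in> borel_measurable borel" "G' \<in> borel_measurable borel"
    using cG cG' by (auto intro: borel_measurable_continuous_onI)
  have [measurable]: "h \<in> borel_measurable borel" unfolding h_def[abs_def] by measurable
  have [measurable]: "shell d \<in> sets borel" for d unfolding shell_def by measurable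
  have cpt: "compact (G ` cball 0 (R + 1))" "compact (G' ` cball 0 (R + 1))"
    by (auto intro!: compact_continuous_image continuous_on_subset[OF cG] continuous_on_subset[OF cG'])
  then obtain B0 B1 where "\<forall>y\<in>cball 0 (R + 1). \<bar>G y\<bar> \<le> B0" "\<forall>y\<in>cball 0 (R + 1). \<bar>G' y\<bar> \<le> B1"
    by (auto dest!: compact_imp_bounded simp: bounded_iff)
  then have B: "norm y \<le> R + 1 \<Longrightarrow> \<bar>G y\<bar> \<le> B0" "norm y \<le> R + 1 \<Longrightarrow> \<bar>G' y\<bar> \<le> B1" for y
    by auto
  have Bnn: "B0 \<ge> 0" "B1 \<ge> 0" using B[of 0] R by auto
  have comp: "\<bar>y$j / norm y\<bar> \<le> 1" for y :: "real^'n"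
    using component_le_norm_cart[of y j] by (auto simp: divide_le_eq_1)
  have hB: "\<bar>h y\<bar> \<le> B0" for y
  proof -
    have "\<bar>G ((R / norm y) *\<^sub>R y)\<bar> \<le> B0" using R by (intro B) (cases "y = 0"; simp)
    then show ?thesis using mult_mono[of "\<bar>G ((R / norm y) *\<^sub>R y)\<bar>" B0 "\<bar>y$j / norm y\<bar>" 1] comp[of y] Bnn
      by (simp add: h_def abs_mult)
  qed
  have h_scale: "h (c *\<^sub>R y) = h y" if "c > 0" for c y using that by (simp add: h_def)
  define I where "I = (\<integral>y. indicator (ball 0 R) y * h y \<partial>lborel)"
  define V :: real where "V = (\<integral>y. indicator (ball 0 R) y * 1 \<partial>(lborel :: (real^'n) measure))"
  \<comment> \<open>Shell integral over ball integral for a homogeneous function, per unit of width.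
    Its limit is the derivative of ((R + d)/R)^n at 0, the factor n/R in
    \<open>sphere_integral\<close>.\<close>
  define q where "q d = (((R + d) / R) ^ ?n - 1) / d" for d
  have q: "(\<lambda>m. q (\<delta> m)) \<longlonglongrightarrow> real ?n / R"
  proof -
    have "((\<lambda>d. ((R + d) / R) ^ ?n) has_real_derivative real ?n / R) (at 0)"
      using R by (auto intro!: derivative_eq_intros)
    then have "((\<lambda>d. q d) \<longlongrightarrow> real ?n / R) (at 0)"
      using R by (simp add: has_field_derivative_iff q_def)
    then show ?thesis
      by (rule filterlim_compose) (use \<delta>0 \<delta>(1) in \<open>auto simp: filterlim_at less_imp_neq[symmetric]\<close>)
  qed
  have V: "(\<integral>y. indicator (shell (\<delta> m)) y * 1 \<partial>lborel) = \<delta> m * q (\<delta> m) * V" for m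
    unfolding shell_def V_def q_def
    using integral_shell_homogeneous[of "\<lambda>_::real^'n. 1" 1 R "R + \<delta> m"] \<delta>[of m] R by simp
  have I: "(\<integral>y. indicator (shell (\<delta> m)) y * h y \<partial>lborel) = \<delta> m * q (\<delta> m) * I" for m
    unfolding shell_def I_def q_def
    using integral_shell_homogeneous[OF _ h_scale hB, of R "R + \<delta> m"] \<delta>[of m] R by simp
  define P where "P m = (\<integral>y. indicator (shell (\<delta> m)) y * (G y * (y$j / norm y)) \<partial>lborel) / \<delta> m" for m
  have "P \<longlonglongrightarrow> (LINT y : ball 0 R | lborel. G' y)"
  proof -
    have "P = (\<lambda>m. \<integral>y. cutoff R (\<delta> m) y * G' y \<partial>lborel)"
      unfolding P_def shell_def using integral_cutoff_parts[OF R \<delta> cG cG' der] by auto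
    moreover have m: "(\<lambda>y. cutoff R (\<delta> m) y * G' y) \<in> borel_measurable borel" for m by measurable
    have m': "(\<lambda>y. indicator (ball 0 R) y *\<^sub>R G' y) \<in> borel_measurable borel" by measurable
    have "(\<lambda>m. \<integral>y. cutoff R (\<delta> m) y * G' y \<partial>lborel) \<longlonglongrightarrow> (\<integral>y. indicator (ball 0 R) y *\<^sub>R G' y \<partial>lborel)"
    proof (rule integral_dominated_convergence[where w="\<lambda>y. indicator (cball 0 (R + 1)) y * B1"])
      show "integrable lborel (\<lambda>y::real^'n. indicator (cball 0 (R + 1)) y * B1)"
        by (intro integrable_mult_left integrable_real_indicator emeasure_lborel_cball_finite) simp
      show "AE y in lborel. (\<lambda>m. cutoff R (\<delta> m) y * G' y) \<longlonglongrightarrow> indicator (ball 0 R) y *\<^sub>R G' y"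
        using AE_norm_neq[of R]
      proof eventually_elim
        case (elim y)
        show ?case
        proof (cases "norm y < R")
          case True
          then show ?thesis using \<delta>(1) by (simp add: cutoff_eq)
        next
          case False
          with elim have "norm y - R > 0" by simp
          from order_tendstoD(2)[OF \<delta>0 this] have "\<forall>\<^sub>F m in sequentially. 0 = cutoff R (\<delta> m) y * G' y"
            by eventually_elim (use \<delta>(1) in \<open>simp add: cutoff_eq\<close>)
          from Lim_transform_eventually[OF tendsto_const this] show ?thesis using False by simp
        qed
      qed
      show "AE y in lborel. norm (cutoff R (\<delta> m) y * G' y) \<le> indicator (cball 0 (R + 1)) y * B1" for m
      proof (rule AE_I2)
        fix y :: "real^'n"
        show "norm (cutoff R (\<delta> m) y * G' y) \<le> indicator (cball 0 (R + 1)) y * B1"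
          using mult_mono[of "\<bar>cutoff R (\<delta> m) y\<bar>" 1 "\<bar>G' y\<bar>" B1] cutoff_bounds[of R "\<delta> m" y] B(2)[of y] \<delta>[of m]
          by (cases "norm y \<le> R + 1") (auto simp: abs_mult cutoff_eq)
      qed
    qed (use m m' in simp_all)
    ultimately show ?thesis by (simp add: set_lebesgue_integral_def)
  qed
  moreover have "P \<longlonglongrightarrow> real ?n / R * I"
  proof -
    have "(\<lambda>m. P m - q (\<delta> m) * I) \<longlonglongrightarrow> 0"
      unfolding tendsto_iff
    proof (intro allI impI)
      fix e :: real assume e: "e > 0"
      have "V \<ge> 0" unfolding V_def by simp
      \<comment> \<open>Eventually \<open>q (\<delta> m)\<close> is below its limit plus 1, so the
        first summand bounds \<open>q (\<delta> m) * V\<close>; the second makes the final estimate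
        strict, also for \<open>V = 0\<close>.\<close>
      define K where "K = (real ?n / R + 1) * V + 1"
      have K: "K > 0" using R \<open>V \<ge> 0\<close> by (simp add: K_def add_nonneg_pos)
      have "uniformly_continuous_on (cball 0 (R + 1)) G"
        by (intro compact_uniformly_continuous continuous_on_subset[OF cG]) auto
      then obtain d where d: "d > 0" "\<And>x y. norm x \<le> R + 1 \<Longrightarrow> norm y \<le> R + 1 \<Longrightarrow> dist x y < d \<Longrightarrow> dist (G x) (G y) < e / K"
        using e K unfolding uniformly_continuous_on_def by (metis divide_pos_pos mem_cball_0)
      from order_tendstoD(2)[OF \<delta>0 d(1)] order_tendstoD(2)[OF q less_add_one]
      show "\<forall>\<^sub>F m in sequentially. dist (P m - q (\<delta> m) * I) 0 < e"
      proof (eventually_elim, simp)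
        fix m assume m: "\<delta> m < d" "q (\<delta> m) < real ?n / R + 1"
        have int: "integrable lborel (\<lambda>y. indicator (shell (\<delta> m)) y * f y)"
          if [measurable]: "f \<in> borel_measurable borel" and "\<And>y. norm y \<le> R + 1 \<Longrightarrow> \<bar>f y\<bar> \<le> b" for f :: "real^'n \<Rightarrow> real" and b
        proof (rule integrable_bounded_support[of _ "cball 0 (R + 1)"])
          show "\<bar>indicator (shell (\<delta> m)) y * f y\<bar> \<le> \<bar>b\<bar>" if "y \<in> cball 0 (R + 1)" for y
            using that(1) \<open>\<And>y. norm y \<le> R + 1 \<Longrightarrow> \<bar>f y\<bar> \<le> b\<close>[of y] by (auto split: split_indicator)
        qed (use \<delta>[of m] that in \<open>auto simp: shell_def\<close>)
        have gB: "\<bar>G y * (y$j / norm y)\<bar> \<le> B0" if "norm y \<le> R + 1" for y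
          using mult_mono[of "\<bar>G y\<bar>" B0 "\<bar>y$j / norm y\<bar>" 1] comp[of y] Bnn B(1)[OF that] by (simp add: abs_mult)
        have ih: "integrable lborel (\<lambda>y. indicator (shell (\<delta> m)) y * h y)"
          using hB by (intro int) auto
        have ig: "integrable lborel (\<lambda>y. indicator (shell (\<delta> m)) y * (G y * (y$j / norm y)))"
          using gB by (intro int) auto
        have ie: "integrable lborel (\<lambda>y. indicator (shell (\<delta> m)) y * (e / K))"
          by (rule int[where b="\<bar>e / K\<bar>"]) auto
        have "(P m - q (\<delta> m) * I) * \<delta> m =
            (\<integral>y. indicator (shell (\<delta> m)) y * (G y * (y$j / norm y)) \<partial>lborel) - (\<integral>y. indicator (shell (\<delta> m)) y * h y \<partial>lborel)"
          using \<delta>(1)[of m] by (simp add: P_def I[of m] left_diff_distrib)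
        also have "\<dots> = (\<integral>y. indicator (shell (\<delta> m)) y * (G y * (y$j / norm y)) - indicator (shell (\<delta> m)) y * h y \<partial>lborel)"
          by (rule Bochner_Integration.integral_diff[OF ig ih, symmetric])
        also have "\<bar>\<dots>\<bar> \<le> (\<integral>y. indicator (shell (\<delta> m)) y * (e / K) \<partial>lborel)"
        proof (rule integral_abs_bound_integral)
          fix y :: "real^'n"
          show "\<bar>indicator (shell (\<delta> m)) y * (G y * (y$j / norm y)) - indicator (shell (\<delta> m)) y * h y\<bar>
              \<le> indicator (shell (\<delta> m)) y * (e / K)"
          proof (cases "y \<in> shell (\<delta> m)")
            case True
            then have y: "R < norm y" "norm y < R + \<delta> m" by (auto simp: shell_def)
            \<comment> \<open>A point of the shell is closer than \<open>\<delta> m\<close> to its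
              radial projection onto the sphere.\<close>
            have "y - (R / norm y) *\<^sub>R y = (1 - R / norm y) *\<^sub>R y" by (simp add: algebra_simps)
            moreover have "norm ((1 - R / norm y) *\<^sub>R y) = norm y - R"
            proof -
              have "norm y > 0" using y R by linarith
              then have "norm ((1 - R / norm y) *\<^sub>R y) = (1 - R / norm y) * norm y" using y by simp
              then show ?thesis using \<open>norm y > 0\<close> by (simp add: left_diff_distrib)
            qed
            ultimately have "dist y ((R / norm y) *\<^sub>R y) < d" using y m by (simp add: dist_norm)
            then have "\<bar>G y - G ((R / norm y) *\<^sub>R y)\<bar> < e / K"
              using d(2)[of y "(R / norm y) *\<^sub>R y"] y R \<delta>(2)[of m] by (auto simp: dist_real_def)
            then have "\<bar>G y - G ((R / norm y) *\<^sub>R y)\<bar> * \<bar>y$j / norm y\<bar> \<le> e / K * 1"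
              using comp[of y] by (intro mult_mono) auto
            moreover have "indicator (shell (\<delta> m)) y * (G y * (y$j / norm y)) - indicator (shell (\<delta> m)) y * h y
                = (G y - G ((R / norm y) *\<^sub>R y)) * (y$j / norm y)"
              using True by (simp add: h_def left_diff_distrib diff_divide_distrib)
            ultimately show ?thesis using True by (simp only: abs_mult) simp
          qed simp
        qed (rule Bochner_Integration.integrable_diff[OF ig ih] ie)+
        also have "\<dots> = \<delta> m * q (\<delta> m) * V * (e / K)" using V[of m] by simp
        also have "\<dots> \<le> \<delta> m * ((real ?n / R + 1) * V) * (e / K)"
          unfolding mult.assoc using \<open>V \<ge> 0\<close> m e K \<delta>(1)[of m] by (intro mult_left_mono mult_right_mono) auto
        also have "\<dots> < \<delta> m * K * (e / K)"
          using e K \<delta>(1)[of m] by (intro mult_strict_right_mono mult_strict_left_mono) (auto simp: K_def)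
        also have "\<dots> = e * \<delta> m" using K by simp
        finally show "\<bar>P m - q (\<delta> m) * I\<bar> < e" using \<delta>(1)[of m] by (simp add: abs_mult)
      qed
    qed
    from tendsto_add[OF this tendsto_mult_right[OF q, of I]] show ?thesis by simp
  qed
  ultimately have "(LINT y : ball 0 R | lborel. G' y) = real ?n / R * I" by (rule LIMSEQ_unique)
  also have "\<dots> = sphere_integral 0 R (\<lambda>y. G y * (y$j / R))"
    using R by (simp add: sphere_integral_def I_def h_def set_lebesgue_integral_def)
  finally show ?thesis .
qed

lemma divergence_ball:
  fixes G :: "real^'n \<Rightarrow> real"
  assumes R: "R > 0"
    and cG: "continuous_on UNIV G" and cG': "continuous_on UNIV G'"
    and der: "\<And>y. has_partial_deriv j G (G' y) y"
  shows "(LINT y : ball c R | lborel. G' y) = sphere_integral c R (\<lambda>y. G y * ((y - c)$j / R))"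
proof -
  have [measurable]: "G \<in> borel_measurable borel" "G' \<in> borel_measurable borel"
    using cG cG' by (auto intro: borel_measurable_continuous_onI)
  have ind: "indicator (ball c R) (c + y) = (indicator (ball 0 R) y :: real)" for y
    by (simp add: indicator_def dist_norm)
  have "(LINT y : ball c R | lborel. G' y) = (LINT y : ball 0 R | lborel. G' (c + y))"
    unfolding set_lebesgue_integral_def
    by (subst lborel_integral_translate[of _ c, symmetric]) (auto simp: ind)
  also have "\<dots> = sphere_integral 0 R (\<lambda>y. G (c + y) * (y$j / R))"
  proof (rule divergence_ball_0[OF R])
    show "continuous_on UNIV (\<lambda>y. G (c + y))" "continuous_on UNIV (\<lambda>y. G' (c + y))"
      by (auto intro!: continuous_on_compose2[OF cG] continuous_on_compose2[OF cG'] continuous_intros)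
    show "has_partial_deriv j (\<lambda>y. G (c + y)) (G' (c + y)) y" for y
      using der[of "c + y"] by (simp add: has_partial_deriv_def add.assoc)
  qed
  also have "\<dots> = sphere_integral c R (\<lambda>y. G y * ((y - c)$j / R))"
    unfolding sphere_integral_def set_lebesgue_integral_def
    by (subst (2) lborel_integral_translate[of _ c, symmetric]) (auto simp: ind)
  finally show ?thesis .
qed

section \<open>Integrals along rays\<close>

text \<open>The exponent is a parameter because differentiating in the direction \<open>w\<close>
  brings out one more factor \<alpha>.\<close>

definition ray_int :: "nat \<Rightarrow> ('a::euclidean_space \<Rightarrow> real) \<Rightarrow> 'a \<Rightarrow> 'a \<Rightarrow> real" where
  "ray_int k f z w = (LINT \<alpha> : {1..} | lborel. f (z + \<alpha> *\<^sub>R w) * \<alpha> ^ k)"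

text \<open>Past \<alpha> = L the point z + \<alpha> w has norm at least L m - M \<ge> 1 and has
  left the support. As \<open>L\<close> depends only on the bounds for \<open>z\<close> and
  \<open>w\<close>, the interval is fixed locally, and the theorems on parameter integrals over
  compact intervals apply.\<close>

lemma ray_int_finite:
  fixes f :: "'a::euclidean_space \<Rightarrow> real"
  assumes cf: "continuous_on UNIV f" and supp: "\<And>x. 1 \<le> norm x \<Longrightarrow> f x = 0"
    and zw: "norm z \<le> M" "m \<le> norm w" "0 < m" "1 + M \<le> L * m"
  shows "set_integrable lborel {1..} (\<lambda>\<alpha>. f (z + \<alpha> *\<^sub>R w) * \<alpha> ^ k)"
    and "ray_int k f z w = integral {1..L} (\<lambda>\<alpha>. f (z + \<alpha> *\<^sub>R w) * \<alpha> ^ k)"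
proof -
  have c: "continuous_on {1..L} (\<lambda>\<alpha>. f (z + \<alpha> *\<^sub>R w) * \<alpha> ^ k)"
    by (intro continuous_intros continuous_on_compose2[OF cf]) auto
  have i: "set_integrable lborel {1..L} (\<lambda>\<alpha>. f (z + \<alpha> *\<^sub>R w) * \<alpha> ^ k)"
    by (rule borel_integrable_atLeastAtMost'[OF c])
  have zero: "f (z + \<alpha> *\<^sub>R w) = 0" if "\<alpha> > L" "\<alpha> \<ge> 1" for \<alpha>
  proof (rule supp)
    have "L * m \<le> \<alpha> * norm w" using that zw by (intro mult_mono) auto
    then show "1 \<le> norm (z + \<alpha> *\<^sub>R w)"
      using norm_triangle_ineq4[of "z + \<alpha> *\<^sub>R w" z] that zw by simp
  qed
  have eq: "indicator {1..} \<alpha> *\<^sub>R (f (z + \<alpha> *\<^sub>R w) * \<alpha> ^ k) = indicator {1..L} \<alpha> *\<^sub>R (f (z + \<alpha> *\<^sub>R w) * \<alpha> ^ k)" for \<alpha>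
    using zero[of \<alpha>] by (auto simp: indicator_def)
  show "set_integrable lborel {1..} (\<lambda>\<alpha>. f (z + \<alpha> *\<^sub>R w) * \<alpha> ^ k)"
    using i unfolding set_integrable_def eq .
  have "ray_int k f z w = (LINT \<alpha> : {1..L} | lborel. f (z + \<alpha> *\<^sub>R w) * \<alpha> ^ k)"
    unfolding ray_int_def set_lebesgue_integral_def eq ..
  also have "\<dots> = integral {1..L} (\<lambda>\<alpha>. f (z + \<alpha> *\<^sub>R w) * \<alpha> ^ k)"
    by (rule set_borel_integral_eq_integral(2)[OF i])
  finally show "ray_int k f z w = integral {1..L} (\<lambda>\<alpha>. f (z + \<alpha> *\<^sub>R w) * \<alpha> ^ k)" .
qed

lemma set_integrable_ray_int:
  fixes f :: "'a::euclidean_space \<Rightarrow> real"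
  assumes "continuous_on UNIV f" "\<And>x. 1 \<le> norm x \<Longrightarrow> f x = 0" "w \<noteq> 0"
  shows "set_integrable lborel {1..} (\<lambda>\<alpha>. f (z + \<alpha> *\<^sub>R w) * \<alpha> ^ k)"
  using assms(3) by (intro ray_int_finite(1)[OF assms(1,2), of _ "norm z" "norm w" _ "(1 + norm z) / norm w"]) auto

text \<open>With L = (1 + |z|)/|w| the integrand is at most S L^k on an interval shorter than
  L.\<close>

lemma ray_int_bound:
  fixes f :: "'a::euclidean_space \<Rightarrow> real"
  assumes cf: "continuous_on UNIV f" and supp: "\<And>x. 1 \<le> norm x \<Longrightarrow> f x = 0" and w: "w \<noteq> 0"
    and S: "\<And>x. \<bar>f x\<bar> \<le> S"
  shows "\<bar>ray_int k f z w\<bar> \<le> S * ((1 + norm z) / norm w) ^ Suc k"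
proof -
  define L where "L = (1 + norm z) / norm w"
  have S0: "S \<ge> 0" using S[of 0] by linarith
  have L0: "L > 0" using w by (simp add: L_def add_pos_nonneg)
  have eq: "ray_int k f z w = integral {1..L} (\<lambda>\<alpha>. f (z + \<alpha> *\<^sub>R w) * \<alpha> ^ k)"
    using w by (intro ray_int_finite[OF cf supp, where M="norm z" and m="norm w"]) (auto simp: L_def)
  show ?thesis
  proof (cases "1 \<le> L")
    \<comment> \<open>The interval from 1 to \<open>L\<close> is empty and the integral is
      0.\<close>
    case False
    then show ?thesis using S0 L0 eq by (simp add: L_def[symmetric])
  next
    case True
    have "norm (integral {1..L} (\<lambda>\<alpha>. f (z + \<alpha> *\<^sub>R w) * \<alpha> ^ k)) \<le> (S * L ^ k) * (L - 1)"
    proof (rule integral_bound[OF True])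
      show "continuous_on {1..L} (\<lambda>\<alpha>. f (z + \<alpha> *\<^sub>R w) * \<alpha> ^ k)"
        by (intro continuous_intros continuous_on_compose2[OF cf]) auto
      show "norm (f (z + t *\<^sub>R w) * t ^ k) \<le> S * L ^ k" if "t \<in> {1..L}" for t
        unfolding norm_mult using that S S0 by (intro mult_mono) (auto simp: power_mono)
    qed
    also have "\<dots> \<le> (S * L ^ k) * L" using S0 L0 by (intro mult_left_mono) auto
    finally show ?thesis using eq by (simp add: L_def[symmetric] algebra_simps)
  qed
qed

lemma continuous_on_ray_int:
  fixes f :: "'a::euclidean_space \<Rightarrow> real"
  assumes cf: "continuous_on UNIV f" and supp: "\<And>x. 1 \<le> norm x \<Longrightarrow> f x = 0"
  shows "continuous_on {p. snd p \<noteq> 0} (\<lambda>p. ray_int k f (fst p) (snd p))"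
proof -
  have o: "open {p::'a \<times> 'a. snd p \<noteq> 0}"
    by (intro open_Collect_neq continuous_intros)
  have "isCont (\<lambda>p. ray_int k f (fst p) (snd p)) p0" if "snd p0 \<noteq> 0" for p0
  proof -
    \<comment> \<open>Half of |w| and |z| + 1 leave an open neighbourhood of the point on which one
      \<open>L\<close> serves.\<close>
    define m where "m = norm (snd p0) / 2"
    define M where "M = norm (fst p0) + 1"
    define L where "L = (1 + M) / m"
    define U where "U = {p::'a \<times> 'a. norm (fst p) < M} \<inter> {p. m < norm (snd p)}"
    have m: "m > 0" using that by (simp add: m_def)
    have U: "open U" "p0 \<in> U"
      using that by (auto simp: U_def M_def m_def intro!: open_Collect_less continuous_intros)
    have "continuous_on U (\<lambda>p. integral (cbox 1 L) (\<lambda>\<alpha>. f (fst p + \<alpha> *\<^sub>R snd p) * \<alpha> ^ k))"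
      by (intro integral_continuous_on_param)
        (auto simp: split_beta intro!: continuous_intros continuous_on_compose2[OF cf])
    then have "continuous_on U (\<lambda>p. ray_int k f (fst p) (snd p))"
    proof (rule continuous_on_eq)
      fix p assume "p \<in> U"
      then show "integral (cbox 1 L) (\<lambda>\<alpha>. f (fst p + \<alpha> *\<^sub>R snd p) * \<alpha> ^ k) = ray_int k f (fst p) (snd p)"
        using m by (intro ray_int_finite(2)[OF cf supp, where M=M and m=m, symmetric, unfolded cbox_interval[symmetric]])
          (auto simp: U_def L_def)
    qed
    then show ?thesis using U continuous_on_eq_continuous_at by blast
  qed
  then show ?thesis using o continuous_on_eq_continuous_at by blast
qed

text \<open>Base point and direction move simultaneously, at speeds \<open>s\<close> and
  \<open>r\<close>, since changing y in the kernel moves both. The point z + \<alpha> w then moves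
  at speed s + r \<alpha>, which accounts for the two exponents.\<close>

lemma ray_int_derivative:
  fixes f :: "real^'n \<Rightarrow> real"
  assumes cf: "continuous_on UNIV f" and supp: "\<And>x. 1 \<le> norm x \<Longrightarrow> f x = 0"
    and cf': "continuous_on UNIV f'" and supp': "\<And>x. 1 \<le> norm x \<Longrightarrow> f' x = 0"
    and der: "\<And>x. has_partial_deriv j f (f' x) x" and w: "w \<noteq> 0"
  shows "((\<lambda>t. ray_int k f (z + (t * s) *\<^sub>R axis j 1) (w + (t * r) *\<^sub>R axis j 1)) has_real_derivative
      s * ray_int k f' z w + r * ray_int (Suc k) f' z w) (at 0)"
proof -
  let ?e = "axis j 1 :: real^'n"
  \<comment> \<open>This keeps the displacement of the direction below |w|/2; the added 1 covers
    \<open>r = 0\<close>.\<close>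
  define d where "d = norm w / (2 * (\<bar>r\<bar> + 1))"
  define m where "m = norm w / 2"
  define M where "M = norm z + d * \<bar>s\<bar>"
  define L where "L = (1 + M) / m"
  have d: "d > 0" and m: "m > 0" using w by (auto simp: d_def m_def)
  have bz: "norm (z + (t * s) *\<^sub>R ?e) \<le> M" if "t \<in> ball 0 d" for t
  proof -
    have "norm (z + (t * s) *\<^sub>R ?e) \<le> norm z + \<bar>t\<bar> * \<bar>s\<bar>"
      using norm_triangle_ineq[of z "(t * s) *\<^sub>R ?e"] by (simp add: abs_mult)
    also have "\<bar>t\<bar> * \<bar>s\<bar> \<le> d * \<bar>s\<bar>" using that by (intro mult_right_mono) auto
    finally show ?thesis by (simp add: M_def)
  qed
  have bw: "m \<le> norm (w + (t * r) *\<^sub>R ?e)" if "t \<in> ball 0 d" for t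
  proof -
    have "\<bar>t\<bar> * \<bar>r\<bar> \<le> d * (\<bar>r\<bar> + 1)" using that by (intro mult_mono) auto
    also have "\<dots> = norm w / 2" by (simp add: d_def field_simps)
    finally have "\<bar>t * r\<bar> \<le> norm w / 2" by (simp add: abs_mult)
    then show ?thesis using norm_triangle_ineq4[of "w + (t * r) *\<^sub>R ?e" "(t * r) *\<^sub>R ?e"] by (simp add: m_def)
  qed
  have fin: "ray_int k f (z + (t * s) *\<^sub>R ?e) (w + (t * r) *\<^sub>R ?e) =
      integral (cbox 1 L) (\<lambda>\<alpha>. f (z + (t * s) *\<^sub>R ?e + \<alpha> *\<^sub>R (w + (t * r) *\<^sub>R ?e)) * \<alpha> ^ k)" if "t \<in> ball 0 d" for t
    unfolding cbox_interval
    by (rule ray_int_finite(2)[OF cf supp bz[OF that] bw[OF that] m]) (use m in \<open>auto simp: L_def\<close>)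
  have fin': "ray_int k f' z w = integral {1..L} (\<lambda>\<alpha>. f' (z + \<alpha> *\<^sub>R w) * \<alpha> ^ k)" for k
    by (rule ray_int_finite(2)[OF cf' supp', where M=M and m=m]) (use m d bz[of 0] bw[of 0] in \<open>auto simp: L_def\<close>)
  have "((\<lambda>t. integral (cbox 1 L) (\<lambda>\<alpha>. f (z + (t * s) *\<^sub>R ?e + \<alpha> *\<^sub>R (w + (t * r) *\<^sub>R ?e)) * \<alpha> ^ k)) has_field_derivative
      integral (cbox 1 L) (\<lambda>\<alpha>. (s + r * \<alpha>) * f' (z + (0 * s) *\<^sub>R ?e + \<alpha> *\<^sub>R (w + (0 * r) *\<^sub>R ?e)) * \<alpha> ^ k)) (at 0 within ball 0 d)"
  proof (rule leibniz_rule_field_derivative[where U="ball 0 d"])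
    fix t \<alpha> :: real
    have "((\<lambda>t. f (z + \<alpha> *\<^sub>R w + t *\<^sub>R ?e)) has_real_derivative f' (z + \<alpha> *\<^sub>R w + ((s + r * \<alpha>) * t) *\<^sub>R ?e)) (at ((s + r * \<alpha>) * t))"
      by (intro has_partial_deriv_shift der)
    from DERIV_chain2[OF this DERIV_cmult_Id, of UNIV]
    have "((\<lambda>t. f (z + \<alpha> *\<^sub>R w + ((s + r * \<alpha>) * t) *\<^sub>R ?e)) has_real_derivative
        f' (z + \<alpha> *\<^sub>R w + ((s + r * \<alpha>) * t) *\<^sub>R ?e) * (s + r * \<alpha>)) (at t)" by simp
    moreover have "z + \<alpha> *\<^sub>R w + ((s + r * \<alpha>) * t) *\<^sub>R ?e = z + (t * s) *\<^sub>R ?e + \<alpha> *\<^sub>R (w + (t * r) *\<^sub>R ?e)" for t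
      by (simp add: algebra_simps)
    ultimately have "((\<lambda>t. f (z + (t * s) *\<^sub>R ?e + \<alpha> *\<^sub>R (w + (t * r) *\<^sub>R ?e))) has_real_derivative
        f' (z + (t * s) *\<^sub>R ?e + \<alpha> *\<^sub>R (w + (t * r) *\<^sub>R ?e)) * (s + r * \<alpha>)) (at t)" by simp
    from DERIV_cmult_right[OF this, of "\<alpha> ^ k"]
    show "((\<lambda>t. f (z + (t * s) *\<^sub>R ?e + \<alpha> *\<^sub>R (w + (t * r) *\<^sub>R ?e)) * \<alpha> ^ k) has_real_derivative
        (s + r * \<alpha>) * f' (z + (t * s) *\<^sub>R ?e + \<alpha> *\<^sub>R (w + (t * r) *\<^sub>R ?e)) * \<alpha> ^ k) (at t within ball 0 d)"
      by - (rule has_field_derivative_at_within, simp add: mult_ac)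
  next
    fix t :: real
    show "(\<lambda>\<alpha>. f (z + (t * s) *\<^sub>R ?e + \<alpha> *\<^sub>R (w + (t * r) *\<^sub>R ?e)) * \<alpha> ^ k) integrable_on cbox 1 L"
      by (intro integrable_continuous continuous_intros continuous_on_compose2[OF cf]) auto
  next
    show "continuous_on (ball 0 d \<times> cbox 1 L) (\<lambda>(t, \<alpha>). (s + r * \<alpha>) * f' (z + (t * s) *\<^sub>R ?e + \<alpha> *\<^sub>R (w + (t * r) *\<^sub>R ?e)) * \<alpha> ^ k)"
      by (auto simp: split_beta intro!: continuous_intros continuous_on_compose2[OF cf'])
  qed (use d in auto)
  moreover have "integral (cbox 1 L) (\<lambda>\<alpha>. (s + r * \<alpha>) * f' (z + (0 * s) *\<^sub>R ?e + \<alpha> *\<^sub>R (w + (0 * r) *\<^sub>R ?e)) * \<alpha> ^ k) =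
      s * ray_int k f' z w + r * ray_int (Suc k) f' z w"
  proof -
    have i: "(\<lambda>\<alpha>. f' (z + \<alpha> *\<^sub>R w) * \<alpha> ^ k) integrable_on {1..L}" for k
      by (intro integrable_continuous_interval continuous_intros continuous_on_compose2[OF cf']) auto
    have "((\<lambda>\<alpha>. s * (f' (z + \<alpha> *\<^sub>R w) * \<alpha> ^ k) + r * (f' (z + \<alpha> *\<^sub>R w) * \<alpha> ^ Suc k)) has_integral
        s * ray_int k f' z w + r * ray_int (Suc k) f' z w) {1..L}"
      unfolding fin'
      by (rule has_integral_add[OF has_integral_mult_right[OF integrable_integral[OF i]] has_integral_mult_right[OF integrable_integral[OF i]]])
    then show ?thesis by (intro integral_unique) (simp add: algebra_simps)
  qed
  ultimately have "((\<lambda>t. integral (cbox 1 L) (\<lambda>\<alpha>. f (z + (t * s) *\<^sub>R ?e + \<alpha> *\<^sub>R (w + (t * r) *\<^sub>R ?e)) * \<alpha> ^ k))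
      has_real_derivative s * ray_int k f' z w + r * ray_int (Suc k) f' z w) (at 0)"
    using d by (simp add: at_within_open[of 0 "ball 0 d"])
  then show ?thesis
    by (rule has_field_derivative_transform_within_open[of _ _ _ "ball 0 d"]) (use d fin in auto)
qed

section \<open>The kernel and its regularization\<close>

lemma kernN_ray_int: "kernN \<psi> i x y = (x - y)$i * ray_int (CARD('n) - 1) \<psi> y (x - y)"
  for \<psi> :: "real^'n \<Rightarrow> real"
  by (simp add: kernN_def ray_int_def)

locale cutoff_kernel =
  fixes \<psi> \<psi>' :: "real^'n \<Rightarrow> real" and i j :: 'n and \<eta> :: "real \<Rightarrow> real"
  assumes cont: "continuous_on UNIV \<psi>" "continuous_on UNIV \<psi>'"
    and supp: "\<And>x. 1 \<le> norm x \<Longrightarrow> \<psi> x = 0" "\<And>x. 1 \<le> norm x \<Longrightarrow> \<psi>' x = 0"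
    and der: "\<And>x. has_partial_deriv j \<psi> (\<psi>' x) x"
    and eta_deriv: "\<And>t. 0 < t \<Longrightarrow> (\<eta> has_real_derivative deriv \<eta> t) (at t)"
    and eta_cont: "continuous_on {0<..} (deriv \<eta>)"
    and eta_low: "\<And>t. 0 \<le> t \<Longrightarrow> t \<le> 1 \<Longrightarrow> \<eta> t = 0"
    and eta_high: "\<And>t. 2 \<le> t \<Longrightarrow> \<eta> t = 1"
    and eta_deriv_bound: "\<And>t. 0 < t \<Longrightarrow> \<bar>deriv \<eta> t\<bar> \<le> 2"
begin

abbreviation N :: "real^'n \<Rightarrow> real^'n \<Rightarrow> real" where
  "N \<equiv> kernN \<psi> i"

text \<open>The product rule for the x_j-derivative off the diagonal: the first factor gives the
  Kronecker delta, the ray integral gives exponent n in place of n - 1.\<close>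

definition DN :: "real^'n \<Rightarrow> real^'n \<Rightarrow> real" where
  "DN x y = axis j 1 $ i * ray_int (CARD('n) - 1) \<psi> y (x - y) + (x - y)$i * ray_int CARD('n) \<psi>' y (x - y)"

text \<open>The sum of the \<open>j\<close>-th partial derivatives of \<open>N\<close> in its two arguments; it is less singular than either of them.\<close>

definition K :: "real^'n \<Rightarrow> real^'n \<Rightarrow> real" where
  "K x y = (x - y)$i * ray_int (CARD('n) - 1) \<psi>' y (x - y)"

text \<open>Speeds (a, s) = (1, 0) give the derivative in x, and (0, 1) the one in y, namely
  \<open>K - DN\<close>. The difference x - y moves at speed a - s, so \<open>DN\<close> carries
  this factor and only the direct dependence on y leaves \<open>K\<close>.\<close>

lemma N_deriv:
  assumes "x \<noteq> y"
  shows "((\<lambda>t. N (x + (t * a) *\<^sub>R axis j 1) (y + (t * s) *\<^sub>R axis j 1)) has_real_derivative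
    (a - s) * DN x y + s * K x y) (at 0)"
proof -
  let ?e = "axis j 1 :: real^'n"
  let ?J = "\<lambda>t. ray_int (CARD('n) - 1) \<psi> (y + (t * s) *\<^sub>R ?e) (x - y + (t * (a - s)) *\<^sub>R ?e)"
  have J: "(?J has_real_derivative s * ray_int (CARD('n) - 1) \<psi>' y (x - y)
      + (a - s) * ray_int (Suc (CARD('n) - 1)) \<psi>' y (x - y)) (at 0)"
    using assms by (intro ray_int_derivative cont supp der) auto
  have "((\<lambda>t. (x - y + (t * (a - s)) *\<^sub>R ?e)$i) has_real_derivative (a - s) * ?e$i) (at 0)"
    by (auto intro!: derivative_eq_intros)
  from DERIV_mult'[OF this J]
  have "((\<lambda>t. (x - y + (t * (a - s)) *\<^sub>R ?e)$i * ?J t) has_real_derivative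
      (a - s) * DN x y + s * K x y) (at 0)"
    by (rule DERIV_cong) (simp add: DN_def K_def algebra_simps)
  moreover have "(\<lambda>t. (x - y + (t * (a - s)) *\<^sub>R ?e)$i * ?J t) =
      (\<lambda>t. N (x + (t * a) *\<^sub>R axis j 1) (y + (t * s) *\<^sub>R axis j 1))"
  proof
    fix t
    have "x + (t * a) *\<^sub>R ?e - (y + (t * s) *\<^sub>R ?e) = x - y + (t * (a - s)) *\<^sub>R ?e"
      by (simp add: algebra_simps)
    then show "(x - y + (t * (a - s)) *\<^sub>R ?e)$i * ?J t = N (x + (t * a) *\<^sub>R ?e) (y + (t * s) *\<^sub>R ?e)"
      unfolding kernN_ray_int by (simp only:)
  qed
  ultimately show ?thesis by simp
qed

lemma N_has_partial_deriv:
  assumes "x \<noteq> y" shows "has_partial_deriv j (\<lambda>z. N z y) (DN x y) x"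
  using N_deriv[OF assms, where a=1 and s=0] by (simp add: has_partial_deriv_def)

lemma partial_N: "x \<noteq> y \<Longrightarrow> partial j (\<lambda>z. N z y) x = DN x y"
  using N_has_partial_deriv unfolding has_partial_deriv_def partial_def by (blast intro: DERIV_imp_deriv)

lemma continuous_on_kernels:
  "continuous_on {p. fst p \<noteq> snd p} (\<lambda>p. N (fst p) (snd p))"
  "continuous_on {p. fst p \<noteq> snd p} (\<lambda>p. DN (fst p) (snd p))"
  "continuous_on {p. fst p \<noteq> snd p} (\<lambda>p. K (fst p) (snd p))"
proof -
  have J: "continuous_on {p. fst p \<noteq> snd p} (\<lambda>p. ray_int k f (snd p) (fst p - snd p))"
    if "continuous_on UNIV f" "\<And>x. 1 \<le> norm x \<Longrightarrow> f x = 0" for f :: "real^'n \<Rightarrow> real" and k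
  proof -
    have "continuous_on {p. fst p \<noteq> snd p} ((\<lambda>p. ray_int k f (fst p) (snd p)) \<circ> (\<lambda>p::(real^'n) \<times> (real^'n). (snd p, fst p - snd p)))"
      by (rule continuous_on_compose)
        (auto intro!: continuous_intros continuous_on_subset[OF continuous_on_ray_int[OF that]])
    then show ?thesis by (simp add: o_def)
  qed
  note J = J[OF cont(1) supp(1)] J[OF cont(2) supp(2)]
  show "continuous_on {p. fst p \<noteq> snd p} (\<lambda>p. N (fst p) (snd p))"
    unfolding kernN_ray_int by (intro continuous_intros J)
  show "continuous_on {p. fst p \<noteq> snd p} (\<lambda>p. DN (fst p) (snd p))"
    unfolding DN_def by (intro continuous_intros J)
  show "continuous_on {p. fst p \<noteq> snd p} (\<lambda>p. K (fst p) (snd p))"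
    unfolding K_def by (intro continuous_intros J)
qed

lemma continuous_on_section:
  assumes "continuous_on {p. fst p \<noteq> snd p} (\<lambda>p. f (fst p) (snd p))"
  shows "continuous_on (- {x}) (f x :: real^'n \<Rightarrow> real)"
proof -
  have "continuous_on (- {x}) ((\<lambda>p. f (fst p) (snd p)) \<circ> (\<lambda>y. (x, y)))"
    by (rule continuous_on_compose) (auto intro!: continuous_intros continuous_on_subset[OF assms])
  then show ?thesis by (simp add: o_def)
qed

lemma borel_measurable_kernels [measurable]:
  "N x \<in> borel_measurable borel" "DN x \<in> borel_measurable borel" "K x \<in> borel_measurable borel"
  by (rule borel_measurable_continuous_countable_exceptions[of "{x}"]; 
      simp add: continuous_on_section continuous_on_kernels)+

text \<open>A ray integral of exponent k costs |x-y|^(-k-1), and the factor x_i - y_i gains one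
  power. The bound on y controls the numerator 1 + |y|. In the last estimate one factor |x-y| is
  kept apart, to be cancelled later by the modulus of continuity.\<close>

lemma kernel_bounds:
  obtains C where "C \<ge> 0"
    "\<And>x y. norm y \<le> M \<Longrightarrow> x \<noteq> y \<Longrightarrow> \<bar>N x y\<bar> \<le> C / norm (x - y) ^ (CARD('n) - 1)"
    "\<And>x y. norm y \<le> M \<Longrightarrow> x \<noteq> y \<Longrightarrow> \<bar>K x y\<bar> \<le> C / norm (x - y) ^ (CARD('n) - 1)"
    "\<And>x y. norm y \<le> M \<Longrightarrow> x \<noteq> y \<Longrightarrow> \<bar>DN x y\<bar> \<le> C / (norm (x - y) * norm (x - y) ^ (CARD('n) - 1))"
proof -
  let ?n = "CARD('n)"
  have "\<exists>S. \<forall>x. \<bar>f x\<bar> \<le> S"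
    if "continuous_on UNIV f" "\<And>x. 1 \<le> norm x \<Longrightarrow> f x = 0" for f :: "real^'n \<Rightarrow> real"
  proof -
    have "bounded (f ` cball 0 1)"
      by (intro compact_imp_bounded compact_continuous_image continuous_on_subset[OF that(1)]) auto
    then obtain S where S: "\<forall>x\<in>cball 0 1. \<bar>f x\<bar> \<le> S" by (auto simp: bounded_iff)
    have "\<bar>f x\<bar> \<le> \<bar>S\<bar>" for x
    proof (cases "norm x \<le> 1")
      case True
      then have "\<bar>f x\<bar> \<le> S" using S by simp
      then show ?thesis by simp
    next
      case False
      then show ?thesis using that(2)[of x] by simp
    qed
    then show ?thesis by blast
  qed
  from this[OF cont(1) supp(1)] this[OF cont(2) supp(2)]
  obtain S1 S2 where "\<And>x. \<bar>\<psi> x\<bar> \<le> S1" "\<And>x. \<bar>\<psi>' x\<bar> \<le> S2" by blast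
  then obtain S where S: "\<And>x. \<bar>\<psi> x\<bar> \<le> S" "\<And>x. \<bar>\<psi>' x\<bar> \<le> S"
    by (metis le_max_iff_disj)
  have S0: "S \<ge> 0" using S(1)[of 0] by linarith
  define m where "m = 1 + \<bar>M\<bar>"
  have m: "m \<ge> 1" by (simp add: m_def)
  \<comment> \<open>Half of \<open>C\<close> bounds each of the two summands of \<open>DN\<close>;
    since \<open>m \<ge> 1\<close>, the larger exponent n + 1 also covers n.\<close>
  define C where "C = 2 * S * m ^ Suc ?n"
  have C: "S * m ^ ?n \<le> C / 2" "S * m ^ Suc ?n \<le> C / 2"
    using S0 m by (auto simp: C_def mult_left_mono)
  have C0: "C \<ge> 0" using S0 m by (simp add: C_def)
  have n: "Suc (?n - 1) = ?n" by simp
  have cancel: "r * (b / r ^ Suc k) = b / r ^ k" if "r \<noteq> 0" for r b :: real and k using that by simp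
  have J: "\<bar>ray_int k f y (x - y)\<bar> \<le> S * m ^ Suc k / norm (x - y) ^ Suc k"
    if "continuous_on UNIV f" "\<And>x. 1 \<le> norm x \<Longrightarrow> f x = 0" "\<And>x. \<bar>f x\<bar> \<le> S" "norm y \<le> M" "x \<noteq> y"
    for f :: "real^'n \<Rightarrow> real" and k x y
  proof -
    have "\<bar>ray_int k f y (x - y)\<bar> \<le> S * ((1 + norm y) / norm (x - y)) ^ Suc k"
      using that by (intro ray_int_bound) auto
    also have "\<dots> \<le> S * (m / norm (x - y)) ^ Suc k"
      using S0 that by (intro mult_left_mono power_mono divide_right_mono) (auto simp: m_def)
    finally show ?thesis by (simp add: power_divide)
  qed
  have comp: "\<bar>(x - y)$i\<bar> \<le> norm (x - y)" for x y :: "real^'n" by (rule component_le_norm_cart)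
  have J1: "\<bar>(x - y)$i * ray_int (?n - 1) f y (x - y)\<bar> \<le> C / norm (x - y) ^ (?n - 1)"
    if "continuous_on UNIV f" "\<And>x. 1 \<le> norm x \<Longrightarrow> f x = 0" "\<And>x. \<bar>f x\<bar> \<le> S" "norm y \<le> M" "x \<noteq> y"
    for f :: "real^'n \<Rightarrow> real" and x y
  proof -
    have "\<bar>(x - y)$i * ray_int (?n - 1) f y (x - y)\<bar> \<le> norm (x - y) * (S * m ^ Suc (?n - 1) / norm (x - y) ^ Suc (?n - 1))"
      unfolding abs_mult by (intro mult_mono comp J[OF that]) auto
    also have "\<dots> = S * m ^ Suc (?n - 1) / norm (x - y) ^ (?n - 1)" using that(5) by (intro cancel) simp
    also have "\<dots> \<le> C / norm (x - y) ^ (?n - 1)" unfolding n using C(1) C0 by (intro divide_right_mono) auto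
    finally show ?thesis .
  qed
  show ?thesis
  proof (rule that[OF C0])
    fix x y :: "real^'n" assume xy: "norm y \<le> M" "x \<noteq> y"
    show "\<bar>N x y\<bar> \<le> C / norm (x - y) ^ (?n - 1)"
      unfolding kernN_ray_int by (rule J1[OF cont(1) supp(1) S(1) xy])
    show "\<bar>K x y\<bar> \<le> C / norm (x - y) ^ (?n - 1)"
      unfolding K_def by (rule J1[OF cont(2) supp(2) S(2) xy])
    let ?r = "norm (x - y)"
    have "\<bar>axis j 1 $ i * ray_int (?n - 1) \<psi> y (x - y)\<bar> \<le> 1 * (S * m ^ Suc (?n - 1) / ?r ^ Suc (?n - 1))"
      unfolding abs_mult by (intro mult_mono J[OF cont(1) supp(1) S(1) xy]) (auto simp: axis_def)
    also have "\<dots> \<le> (C / 2) / ?r ^ ?n" using C(1) unfolding n mult_1 by (intro divide_right_mono) auto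
    finally have 1: "\<bar>axis j 1 $ i * ray_int (?n - 1) \<psi> y (x - y)\<bar> \<le> (C / 2) / ?r ^ ?n" .
    have "\<bar>(x - y)$i * ray_int ?n \<psi>' y (x - y)\<bar> \<le> ?r * (S * m ^ Suc ?n / ?r ^ Suc ?n)"
      unfolding abs_mult by (intro mult_mono comp J[OF cont(2) supp(2) S(2) xy]) auto
    also have "\<dots> = S * m ^ Suc ?n / ?r ^ ?n" using xy(2) by (intro cancel) simp
    also have "\<dots> \<le> (C / 2) / ?r ^ ?n" using C(2) by (intro divide_right_mono) auto
    finally have "\<bar>DN x y\<bar> \<le> (C / 2) / ?r ^ ?n + (C / 2) / ?r ^ ?n"
      unfolding DN_def using 1 by linarith
    also have "\<dots> = C / ?r ^ Suc (?n - 1)" unfolding n by (simp add: field_simps)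
    finally show "\<bar>DN x y\<bar> \<le> C / (?r * ?r ^ (?n - 1))" unfolding power_Suc .
  qed
qed

lemma kernels_diag: "N x x = 0" "K x x = 0"
  by (simp_all add: kernN_ray_int K_def)

section \<open>The cut-off kernel and estimates uniform in the cut-off scale\<close>

lemma deriv_eta_eq_0:
  assumes "0 < t" "t < 1 \<or> 2 < t" shows "deriv \<eta> t = 0"
proof -
  have "((\<lambda>_. if t < 1 then 0 else 1) has_real_derivative 0) (at t)" by simp
  then have "(\<eta> has_real_derivative 0) (at t)"
    by (rule has_field_derivative_transform_within_open[of _ _ _ "if t < 1 then {0<..<1} else {2<..}"])
      (use assms eta_low eta_high in \<open>auto split: if_splits\<close>)
  then show ?thesis by (rule DERIV_imp_deriv)
qed

text \<open>Between 1 and 2 the mean value theorem gives |\<eta>(t)| \<le> 2 (t - 1) \<le> 2, whence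
  3; no sign or monotonicity of \<eta> is assumed.\<close>

lemma eta_bound: "0 \<le> t \<Longrightarrow> \<bar>\<eta> t - 1\<bar> \<le> 3"
proof -
  assume "0 \<le> t"
  consider "t \<le> 1" | "1 < t" "t < 2" | "2 \<le> t" by linarith
  then show ?thesis
  proof cases
    case 2
    have "norm (\<eta> t - \<eta> 1) \<le> 2 * norm (t - 1)"
      by (rule field_differentiable_bound[where S="{1..t}" and f'="deriv \<eta>"])
        (use 2 eta_deriv eta_deriv_bound in \<open>auto intro: has_field_derivative_at_within\<close>)
    then show ?thesis using 2 eta_low[of 1] by simp
  qed (use \<open>0 \<le> t\<close> eta_low eta_high in auto)
qed

definition G :: "real \<Rightarrow> real^'n \<Rightarrow> real^'n \<Rightarrow> real" where
  "G \<epsilon> x y = N x y * \<eta> (norm (x - y) / \<epsilon>)"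

definition DG :: "real \<Rightarrow> real^'n \<Rightarrow> real^'n \<Rightarrow> real" where
  "DG \<epsilon> x y = DN x y * \<eta> (norm (x - y) / \<epsilon>)
     + N x y * (deriv \<eta> (norm (x - y) / \<epsilon>) * ((x - y)$j / norm (x - y) / \<epsilon>))"

text \<open>The cut-off depends on x - y alone, so its derivative carries the factor a - s and joins
  \<open>DG\<close>. On the diagonal neither \<open>N\<close> nor \<eta>(|x-y|/\<epsilon>) need be
  differentiable, but \<open>G\<close> vanishes identically while |x-y| < \<epsilon>.\<close>

lemma G_deriv:
  assumes \<epsilon>: "\<epsilon> > 0"
  shows "((\<lambda>t. G \<epsilon> (x + (t * a) *\<^sub>R axis j 1) (y + (t * s) *\<^sub>R axis j 1)) has_real_derivative
    (a - s) * DG \<epsilon> x y + s * (K x y * \<eta> (norm (x - y) / \<epsilon>))) (at 0)"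
proof (cases "x = y")
  case True
  let ?S = "{t. norm (x + (t * a) *\<^sub>R axis j 1 - (y + (t * s) *\<^sub>R axis j 1) :: real^'n) < \<epsilon>}"
  have "((\<lambda>t. G \<epsilon> (x + (t * a) *\<^sub>R axis j 1) (y + (t * s) *\<^sub>R axis j 1)) has_real_derivative 0) (at 0)"
  proof (rule has_field_derivative_transform_within_open[of "\<lambda>_. 0" _ _ ?S])
    show "open ?S" by (intro open_Collect_less continuous_intros)
    fix t assume "t \<in> ?S"
    then show "0 = G \<epsilon> (x + (t * a) *\<^sub>R axis j 1) (y + (t * s) *\<^sub>R axis j 1)"
      unfolding G_def using \<epsilon> by (subst eta_low) auto
  qed (use True \<epsilon> in auto)
  then show ?thesis using True eta_low[of 0] by (simp add: DG_def kernels_diag)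
next
  case False
  let ?e = "axis j 1 :: real^'n"
  let ?r = "norm (x - y)"
  have r: "?r > 0" using False by simp
  have d: "((\<lambda>t. norm (x - y + t *\<^sub>R ((a - s) *\<^sub>R ?e))) has_real_derivative (a - s) * (x - y)$j / ?r) (at 0)"
    using False by (intro has_real_derivative_norm_axis) auto
  have eq: "x - y + t *\<^sub>R ((a - s) *\<^sub>R ?e) = x + (t * a) *\<^sub>R ?e - (y + (t * s) *\<^sub>R ?e)" for t
    by (simp add: algebra_simps)
  have d2: "((\<lambda>t. norm (x + (t * a) *\<^sub>R ?e - (y + (t * s) *\<^sub>R ?e)) / \<epsilon>) has_real_derivative
      (a - s) * (x - y)$j / ?r / \<epsilon>) (at 0)"
    using d unfolding eq by (rule DERIV_cdivide)
  have d3: "(\<eta> has_real_derivative deriv \<eta> (?r / \<epsilon>)) (at (norm (x + (0 * a) *\<^sub>R ?e - (y + (0 * s) *\<^sub>R ?e)) / \<epsilon>))"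
    using eta_deriv[of "?r / \<epsilon>"] r \<epsilon> by simp
  have "((\<lambda>t. \<eta> (norm (x + (t * a) *\<^sub>R ?e - (y + (t * s) *\<^sub>R ?e)) / \<epsilon>)) has_real_derivative
      deriv \<eta> (?r / \<epsilon>) * ((a - s) * (x - y)$j / ?r / \<epsilon>)) (at 0)"
    by (rule DERIV_chain2[where f=\<eta> and g="\<lambda>t. norm (x + (t * a) *\<^sub>R ?e - (y + (t * s) *\<^sub>R ?e)) / \<epsilon>", OF d3 d2])
  from DERIV_mult'[OF N_deriv[OF False] this]
  show ?thesis
    unfolding G_def by (rule DERIV_cong) (simp add: DG_def algebra_simps)
qed

lemma G_has_partial_deriv:
  assumes "\<epsilon> > 0"
  shows "has_partial_deriv j (\<lambda>z. G \<epsilon> z y) (DG \<epsilon> x y) x"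
    and "has_partial_deriv j (G \<epsilon> x) (K x y * \<eta> (norm (x - y) / \<epsilon>) - DG \<epsilon> x y) y"
  using G_deriv[OF assms, where a=1 and s=0] G_deriv[OF assms, where a=0 and s=1]
  by (simp_all add: has_partial_deriv_def)

text \<open>Two open sets cover the product space: the complement of the diagonal, where all
  ingredients are continuous, and the \<epsilon>-neighbourhood of the diagonal, where the functions
  are 0. Joint continuity then gives bounds on compact sets.\<close>

lemma continuous_on_G:
  assumes \<epsilon>: "\<epsilon> > 0"
  shows "continuous_on UNIV (\<lambda>p. G \<epsilon> (fst p) (snd p))"
    and "continuous_on UNIV (\<lambda>p. DG \<epsilon> (fst p) (snd p))"
    and "continuous_on UNIV (\<lambda>p. K (fst p) (snd p) * \<eta> (norm (fst p - snd p) / \<epsilon>))"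
proof -
  let ?D = "{p::(real^'n) \<times> (real^'n). fst p \<noteq> snd p}"
  let ?Z = "{p::(real^'n) \<times> (real^'n). norm (fst p - snd p) < \<epsilon>}"
  have glue: "continuous_on UNIV f" if "continuous_on ?D f" "\<And>p. p \<in> ?Z \<Longrightarrow> f p = 0" for f :: "(real^'n) \<times> (real^'n) \<Rightarrow> real"
  proof -
    have "continuous_on ?Z f" by (rule continuous_on_eq[OF continuous_on_const[of _ 0]]) (simp add: that(2))
    moreover have "open ?D" "open ?Z"
      by (intro open_Collect_neq open_Collect_less continuous_intros)+
    ultimately have "continuous_on (?D \<union> ?Z) f" using that(1) by (intro continuous_on_open_Un)
    moreover have "?D \<union> ?Z = UNIV" using \<epsilon> by auto
    ultimately show ?thesis by simp
  qed
  have "continuous_on {0<..} \<eta>"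
    by (rule DERIV_continuous_on, rule has_field_derivative_at_within, rule eta_deriv) simp
  then have e: "continuous_on ?D (\<lambda>p. \<eta> (norm (fst p - snd p) / \<epsilon>))"
    using \<epsilon> by (rule_tac continuous_on_compose2[of "{0<..}" \<eta>]) (auto intro!: continuous_intros)
  have e': "continuous_on ?D (\<lambda>p. deriv \<eta> (norm (fst p - snd p) / \<epsilon>))"
    using \<epsilon> by (rule_tac continuous_on_compose2[OF eta_cont]) (auto intro!: continuous_intros)
  have z: "\<eta> (norm (fst p - snd p) / \<epsilon>) = 0" if "p \<in> ?Z" for p
    using that \<epsilon> by (intro eta_low) auto
  show "continuous_on UNIV (\<lambda>p. G \<epsilon> (fst p) (snd p))"
    unfolding G_def by (rule glue) (auto simp: z intro!: continuous_intros continuous_on_kernels e)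
  show "continuous_on UNIV (\<lambda>p. K (fst p) (snd p) * \<eta> (norm (fst p - snd p) / \<epsilon>))"
    by (rule glue) (auto simp: z intro!: continuous_intros continuous_on_kernels e)
  show "continuous_on UNIV (\<lambda>p. DG \<epsilon> (fst p) (snd p))"
    unfolding DG_def
  proof (rule glue)
    show "continuous_on ?D (\<lambda>p. DN (fst p) (snd p) * \<eta> (norm (fst p - snd p) / \<epsilon>) +
        N (fst p) (snd p) * (deriv \<eta> (norm (fst p - snd p) / \<epsilon>) * ((fst p - snd p)$j / norm (fst p - snd p) / \<epsilon>)))"
      using \<epsilon> by (intro continuous_intros continuous_on_kernels e e') auto
    fix p assume p: "p \<in> ?Z"
    show "DN (fst p) (snd p) * \<eta> (norm (fst p - snd p) / \<epsilon>) +
        N (fst p) (snd p) * (deriv \<eta> (norm (fst p - snd p) / \<epsilon>) * ((fst p - snd p)$j / norm (fst p - snd p) / \<epsilon>)) = 0"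
    \<comment> \<open>On the diagonal nothing is known about \<open>deriv \<eta> 0\<close>, but its
      factor \<open>N\<close> is 0 there.\<close>
    proof (cases "fst p = snd p")
      case True
      then show ?thesis using z[OF p] by (simp add: kernels_diag)
    next
      case False
      then have "deriv \<eta> (norm (fst p - snd p) / \<epsilon>) = 0"
        using p \<epsilon> by (intro deriv_eta_eq_0) auto
      then show ?thesis using z[OF p] by simp
    qed
  qed
qed

lemma DG_eq_DN:
  assumes "\<epsilon> > 0" "norm (x - y) > 2 * \<epsilon>"
  shows "DG \<epsilon> x y = DN x y" "\<eta> (norm (x - y) / \<epsilon>) = 1"
proof -
  have "norm (x - y) / \<epsilon> > 2" using assms by (simp add: pos_less_divide_eq)
  then show "DG \<epsilon> x y = DN x y" "\<eta> (norm (x - y) / \<epsilon>) = 1"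
    using eta_high[of "norm (x - y) / \<epsilon>"] deriv_eta_eq_0[of "norm (x - y) / \<epsilon>"] by (auto simp: DG_def)
qed

text \<open>Here 7 = 3 + 4: the 3 bounds |\<eta> - 1|. For the 4, the derivative of the cut-off is
  at most 2/\<epsilon> and is nonzero only for |x-y| \<le> 2\<epsilon>, where 1/\<epsilon> \<le>
  2/|x-y|; so \<epsilon> disappears from the bound.\<close>

lemma DG_diff_bound:
  assumes \<epsilon>: "\<epsilon> > 0" and "x \<noteq> y"
    and N: "\<bar>N x y\<bar> \<le> C / norm (x - y) ^ m"
    and DN: "\<bar>DN x y\<bar> \<le> C / (norm (x - y) * norm (x - y) ^ m)"
  shows "\<bar>DG \<epsilon> x y - DN x y\<bar> \<le> 7 * C / (norm (x - y) * norm (x - y) ^ m)"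
proof -
  let ?r = "norm (x - y)"
  have r: "?r > 0" "?r / \<epsilon> > 0" using assms by auto
  have "\<bar>deriv \<eta> (?r / \<epsilon>)\<bar> / \<epsilon> \<le> 4 / ?r"
  proof (cases "?r / \<epsilon> > 2")
    case True
    then show ?thesis using deriv_eta_eq_0[OF r(2)] by simp
  next
    case False
    then have "1 / \<epsilon> \<le> 2 / ?r" using r \<epsilon> by (simp add: field_simps)
    then have "\<bar>deriv \<eta> (?r / \<epsilon>)\<bar> * (1 / \<epsilon>) \<le> 2 * (2 / ?r)"
      using eta_deriv_bound[OF r(2)] \<epsilon> by (intro mult_mono) auto
    then show ?thesis by simp
  qed
  then have "\<bar>deriv \<eta> (?r / \<epsilon>)\<bar> / \<epsilon> * \<bar>(x - y)$j / ?r\<bar> \<le> 4 / ?r * 1"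
    using component_le_norm_cart[of "x - y" j] r by (intro mult_mono) (auto simp: divide_le_eq_1)
  then have "\<bar>deriv \<eta> (?r / \<epsilon>) * ((x - y)$j / ?r / \<epsilon>)\<bar> \<le> 4 / ?r"
    using \<epsilon> by (simp add: abs_mult mult_ac)
  then have "\<bar>N x y\<bar> * \<bar>deriv \<eta> (?r / \<epsilon>) * ((x - y)$j / ?r / \<epsilon>)\<bar> \<le> (C / ?r ^ m) * (4 / ?r)"
    using N by (intro mult_mono) (auto intro: order_trans[OF abs_ge_zero])
  moreover have "\<bar>DN x y\<bar> * \<bar>\<eta> (?r / \<epsilon>) - 1\<bar> \<le> (C / (?r * ?r ^ m)) * 3"
    using DN eta_bound[of "?r / \<epsilon>"] r by (intro mult_mono) (auto intro: order_trans[OF abs_ge_zero])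
  moreover have "DG \<epsilon> x y - DN x y = DN x y * (\<eta> (?r / \<epsilon>) - 1) + N x y * (deriv \<eta> (?r / \<epsilon>) * ((x - y)$j / ?r / \<epsilon>))"
    by (simp add: DG_def right_diff_distrib)
  ultimately have "\<bar>DG \<epsilon> x y - DN x y\<bar> \<le> (C / (?r * ?r ^ m)) * 3 + (C / ?r ^ m) * (4 / ?r)"
    unfolding abs_mult[symmetric] using abs_triangle_ineq[of "DN x y * (\<eta> (?r / \<epsilon>) - 1)"] by (smt (verit))
  also have "\<dots> = 7 * C / (?r * ?r ^ m)" by (simp add: field_simps)
  finally show ?thesis .
qed

end

section \<open>Dini continuity\<close>

lemma dini_modulus_bound:
  assumes "bdd_above {\<bar>F x - F y\<bar> | x y. x \<in> \<Omega> \<and> y \<in> \<Omega> \<and> dist x y < \<rho>}"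
    and "x \<in> \<Omega>" "y \<in> \<Omega>" "dist x y < \<rho>"
  shows "\<bar>F x - F y\<bar> \<le> modulus F \<Omega> \<rho>"
  unfolding modulus_def using assms by (intro cSup_upper) auto

text \<open>If the modulus stayed above some e > 0 near 0, the Dini integrand would dominate
  e/\<rho>, whose integral diverges logarithmically. Boundedness and measurability of
  \<open>F\<close> are drawn from this.\<close>

lemma dini_imp_uniformly_continuous:
  assumes "dini_continuous F \<Omega>"
  shows "uniformly_continuous_on \<Omega> F"
proof -
  obtain \<delta> where \<delta>: "\<delta> > 0"
    and bdd: "\<And>\<rho>. 0 < \<rho> \<Longrightarrow> \<rho> < \<delta> \<Longrightarrow> bdd_above {\<bar>F x - F y\<bar> | x y. x \<in> \<Omega> \<and> y \<in> \<Omega> \<and> dist x y < \<rho>}"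
    and int: "integrable lborel (\<lambda>\<rho>. indicator {0<..<\<delta>} \<rho> *\<^sub>R (modulus F \<Omega> \<rho> / \<rho>))"
    using assms unfolding dini_continuous_def set_integrable_def by auto
  define I where "I = (\<integral>\<rho>. \<bar>indicator {0<..<\<delta>} \<rho> *\<^sub>R (modulus F \<Omega> \<rho> / \<rho>)\<bar> \<partial>lborel)"
  have "\<exists>\<rho>. 0 < \<rho> \<and> \<rho> < \<delta> \<and> modulus F \<Omega> \<rho> < e" if e: "e > 0" for e
  proof (rule ccontr)
    assume "\<not> ?thesis"
    then have ge: "e \<le> modulus F \<Omega> \<rho>" if "0 < \<rho>" "\<rho> < \<delta>" for \<rho> using that by force
    have le: "e * (ln (\<delta> / 2) - ln a) \<le> I" if a: "0 < a" "a \<le> \<delta> / 2" for a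
    proof -
      have "has_bochner_integral lborel (\<lambda>x. (e / x) * indicator {a..\<delta> / 2} x) (e * ln (\<delta> / 2) - e * ln a)"
      proof (rule has_bochner_integral_FTC_Icc_nonneg)
        fix x assume "x \<in> {a..\<delta> / 2}"
        then show "((\<lambda>x. e * ln x) has_real_derivative e / x) (at x)" "0 \<le> e / x"
          using a e by (auto intro!: derivative_eq_intros)
      qed (use a in auto)
      then have 1: "integrable lborel (\<lambda>x. (e / x) * indicator {a..\<delta> / 2} x)"
        "(\<integral>x. (e / x) * indicator {a..\<delta> / 2} x \<partial>lborel) = e * ln (\<delta> / 2) - e * ln a"
        by (auto simp: has_bochner_integral_iff)
      have "(\<integral>x. (e / x) * indicator {a..\<delta> / 2} x \<partial>lborel) \<le> I"
        unfolding I_def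
      proof (rule integral_mono[OF 1(1) integrable_abs[OF int]])
        fix x
        show "(e / x) * indicator {a..\<delta> / 2} x \<le> \<bar>indicator {0<..<\<delta>} x *\<^sub>R (modulus F \<Omega> x / x)\<bar>"
        proof (cases "a \<le> x \<and> x \<le> \<delta> / 2")
          case True
          then have "0 < x" "x < \<delta>" using a \<delta> by auto
          then have "e / x \<le> modulus F \<Omega> x / x" using ge by (intro divide_right_mono) auto
          then have "e / x \<le> \<bar>modulus F \<Omega> x / x\<bar>" by linarith
          then show ?thesis using True \<open>0 < x\<close> \<open>x < \<delta>\<close> by (simp del: abs_divide)
        qed (auto simp: indicator_def)
      qed
      then show ?thesis using 1(2) by (simp add: right_diff_distrib)
    qed
    \<comment> \<open>Starting the integral at (\<delta>/2) exp(-b) makes the logarithmic term equal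
      to e b = |I| + 1, more than \<open>I\<close> allows.\<close>
    define b where "b = (\<bar>I\<bar> + 1) / e"
    have "b > 0" using e by (simp add: b_def add_nonneg_pos)
    then have "e * (ln (\<delta> / 2) - ln (\<delta> / 2 * exp (- b))) \<le> I"
      using \<delta> by (intro le) (auto simp: mult_le_cancel_left1)
    moreover have "ln (\<delta> / 2 * exp (- b)) = ln (\<delta> / 2) - b"
      using \<delta> by (subst ln_mult_pos) auto
    ultimately have "e * b \<le> I" by simp
    then show False using e by (simp add: b_def)
  qed
  then show ?thesis
    unfolding uniformly_continuous_on_def
  proof (intro allI impI)
    fix e :: real assume "e > 0"
    then obtain \<rho> where \<rho>: "0 < \<rho>" "\<rho> < \<delta>" "modulus F \<Omega> \<rho> < e"
      using \<open>\<And>e. e > 0 \<Longrightarrow> \<exists>\<rho>. 0 < \<rho> \<and> \<rho> < \<delta> \<and> modulus F \<Omega> \<rho> < e\<close> by blast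
    show "\<exists>d>0. \<forall>x\<in>\<Omega>. \<forall>x'\<in>\<Omega>. dist x' x < d \<longrightarrow> dist (F x') (F x) < e"
    proof (intro exI[of _ \<rho>] conjI ballI impI \<rho>)
      fix x x' assume "x \<in> \<Omega>" "x' \<in> \<Omega>" "dist x' x < \<rho>"
      then show "dist (F x') (F x) < e"
        using dini_modulus_bound[OF bdd[OF \<rho>(1,2)], of x' x] \<rho>(3) by (simp add: dist_real_def)
    qed
  qed
qed

text \<open>The modulus at \<rho> only sees pairs at distance strictly below \<rho>, so a pair at
  distance r is measured at 2r. With \<omega> the modulus, g(r) is \<omega>(2r)/r for small r, the
  rescaled Dini integrand, and the admissible distance is halved; the absolute value makes
  \<open>g\<close> nonnegative everywhere.\<close>

lemma dini_gauge:
  fixes F :: "'a::real_normed_vector \<Rightarrow> real"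
  assumes "dini_continuous F \<Omega>"
  obtains \<delta> g where "\<delta> > 0" "integrable lborel g" "\<And>r. 0 \<le> g r"
    "\<And>x y. x \<in> \<Omega> \<Longrightarrow> y \<in> \<Omega> \<Longrightarrow> x \<noteq> y \<Longrightarrow> norm (x - y) < \<delta> \<Longrightarrow> \<bar>F x - F y\<bar> \<le> norm (x - y) * g (norm (x - y))"
proof -
  obtain \<delta> where \<delta>: "\<delta> > 0"
    and bdd: "\<And>\<rho>. 0 < \<rho> \<Longrightarrow> \<rho> < \<delta> \<Longrightarrow> bdd_above {\<bar>F x - F y\<bar> | x y. x \<in> \<Omega> \<and> y \<in> \<Omega> \<and> dist x y < \<rho>}"
    and int: "integrable lborel (\<lambda>\<rho>. indicator {0<..<\<delta>} \<rho> *\<^sub>R (modulus F \<Omega> \<rho> / \<rho>))"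
    using assms unfolding dini_continuous_def set_integrable_def by auto
  define g0 where "g0 \<rho> = indicator {0<..<\<delta>} \<rho> *\<^sub>R (modulus F \<Omega> \<rho> / \<rho>)" for \<rho>
  define g where "g r = 2 * \<bar>g0 (0 + 2 * r)\<bar>" for r
  show ?thesis
  proof (rule that[of "\<delta> / 2" g])
    show "integrable lborel g"
      unfolding g_def by (intro integrable_mult_right integrable_abs lborel_integrable_real_affine) (use int in \<open>auto simp: g0_def\<close>)
    fix x y assume xy: "x \<in> \<Omega>" "y \<in> \<Omega>" "x \<noteq> y" "norm (x - y) < \<delta> / 2"
    have r: "0 < norm (x - y)" using xy by simp
    have "\<bar>F x - F y\<bar> \<le> modulus F \<Omega> (2 * norm (x - y))"
      using xy by (intro dini_modulus_bound bdd) (auto simp: dist_norm)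
    also have "\<dots> \<le> norm (x - y) * g (norm (x - y))"
      using r xy(4) by (simp add: g_def g0_def abs_divide)
    finally show "\<bar>F x - F y\<bar> \<le> norm (x - y) * g (norm (x - y))" .
  qed (use \<delta> in \<open>auto simp: g_def\<close>)
qed

section \<open>Integrals over a sphere\<close>

lemma sphere_integral_cong:
  fixes f g :: "real^'n \<Rightarrow> real"
  assumes R: "R > 0" and eq: "\<And>y. norm (y - c) = R \<Longrightarrow> f y = g y"
  shows "sphere_integral c R f = sphere_integral c R g"
proof -
  have "(LINT x : ball c R | lborel. f (c + (R / norm (x - c)) *\<^sub>R (x - c))) =
      (LINT x : ball c R | lborel. g (c + (R / norm (x - c)) *\<^sub>R (x - c)))"
    unfolding set_lebesgue_integral_def
  \<comment> \<open>At the centre division by zero sends the radial projection to \<open>c\<close>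
    itself, off the sphere; this single point is null.\<close>
  proof (rule integral_discrete_difference[of "{c}"])
    fix x assume "x \<notin> {c}"
    then have "f (c + (R / norm (x - c)) *\<^sub>R (x - c)) = g (c + (R / norm (x - c)) *\<^sub>R (x - c))"
      using R by (intro eq) simp
    then show "indicator (ball c R) x *\<^sub>R f (c + (R / norm (x - c)) *\<^sub>R (x - c)) =
        indicator (ball c R) x *\<^sub>R g (c + (R / norm (x - c)) *\<^sub>R (x - c))" by simp
  qed auto
  then show ?thesis by (simp add: sphere_integral_def)
qed

lemma sphere_integrable_continuous:
  fixes g :: "real^'n \<Rightarrow> real"
  assumes R: "R > 0" and g: "continuous_on (sphere c R) g"
  shows "sphere_integrable c R g"
proof -
  let ?\<phi> = "\<lambda>x. c + (R / norm (x - c)) *\<^sub>R (x - c)"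
  have \<phi>: "?\<phi> x \<in> sphere c R" if "x \<noteq> c" for x using R that by (simp add: dist_norm)
  have "continuous_on (- {c}) (\<lambda>x. g (?\<phi> x))"
  proof (rule continuous_on_compose2[OF g])
    show "continuous_on (- {c}) ?\<phi>" by (intro continuous_intros) auto
    show "?\<phi> ` (- {c}) \<subseteq> sphere c R" using \<phi> by blast
  qed
  then have [measurable]: "(\<lambda>x. g (?\<phi> x)) \<in> borel_measurable borel"
    by (intro borel_measurable_continuous_countable_exceptions[of "{c}"]) auto
  have "bounded (g ` sphere c R)"
    using g by (intro compact_imp_bounded compact_continuous_image) auto
  then obtain B where B: "\<forall>x\<in>sphere c R. \<bar>g x\<bar> \<le> B" by (auto simp: bounded_iff)
  \<comment> \<open>The term \<open>\<bar>g c\<bar>\<close> covers the default value at the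
    centre.\<close>
  have bd: "\<bar>g (?\<phi> x)\<bar> \<le> max B \<bar>g c\<bar>" for x
  proof (cases "x = c")
    case False
    then have "\<bar>g (?\<phi> x)\<bar> \<le> B" using B \<phi>[OF False] by blast
    then show ?thesis by linarith
  qed simp
  have "integrable lborel (\<lambda>x. indicator (ball c R) x *\<^sub>R g (?\<phi> x))"
  proof (rule integrable_bounded_support[of _ "ball c R"])
    show "(\<lambda>x. indicator (ball c R) x *\<^sub>R g (?\<phi> x)) \<in> borel_measurable borel" by measurable
    show "\<bar>indicator (ball c R) x *\<^sub>R g (?\<phi> x)\<bar> \<le> max B \<bar>g c\<bar>" if "x \<in> ball c R" for x
      using bd[of x] that by simp
  qed auto
  then show ?thesis by (simp add: sphere_integrable_def set_integrable_def)
qed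

section \<open>The regularized potentials\<close>

locale dini_potential = cutoff_kernel \<psi> \<psi>' i j \<eta>
  for \<psi> \<psi>' :: "real^'n \<Rightarrow> real" and i j :: 'n and \<eta> :: "real \<Rightarrow> real" +
  fixes \<Omega> :: "(real^'n) set" and F :: "real^'n \<Rightarrow> real" and c :: "real^'n" and R :: real
    and B \<delta> :: real and g :: "real \<Rightarrow> real"
  assumes open_\<Omega>: "open \<Omega>" and R: "R > 0" and \<Omega>_ball: "\<Omega> \<subseteq> ball c R"
    and F_meas [measurable]: "F \<in> borel_measurable borel"
    and F_bound: "\<And>x. \<bar>F x\<bar> \<le> B"
    and F_ext: "\<And>x. x \<notin> \<Omega> \<Longrightarrow> F x = 0"
    and \<delta>: "\<delta> > 0" and g_int: "integrable lborel g" and g_nonneg: "\<And>r. 0 \<le> g r"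
    and gauge: "\<And>x y. x \<in> \<Omega> \<Longrightarrow> y \<in> \<Omega> \<Longrightarrow> x \<noteq> y \<Longrightarrow> norm (x - y) < \<delta> \<Longrightarrow>
      \<bar>F x - F y\<bar> \<le> norm (x - y) * g (norm (x - y))"
begin

definition v :: "real^'n \<Rightarrow> real" where
  "v x = (LINT y : \<Omega> | lborel. F y * N x y)"

definition veps :: "real \<Rightarrow> real^'n \<Rightarrow> real" where
  "veps \<epsilon> x = (LINT y : \<Omega> | lborel. F y * N x y * \<eta> (norm (x - y) / \<epsilon>))"

definition Dveps :: "real \<Rightarrow> real^'n \<Rightarrow> real" where
  "Dveps \<epsilon> x = (LINT y : \<Omega> | lborel. F y * DG \<epsilon> x y)"

definition u :: "real^'n \<Rightarrow> real" where
  "u x = (LINT y : ball c R | lborel. (F y - F x) * partial j (\<lambda>z. N z y) x)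
    + F x * (LINT y : ball c R | lborel. (x$i - y$i) *
        (LINT \<alpha> : {1..} | lborel. \<psi>' (y + \<alpha> *\<^sub>R (x - y)) * \<alpha> ^ (CARD('n) - 1)))
    - F x * sphere_integral c R (\<lambda>y. N x y * ((y - c)$j / R))"

text \<open>An integrable majorant: the first summand dominates \<open>\<bar>F y - F x\<bar> / norm (x - y) ^ n\<close> close to the diagonal,
  the second one \<open>1 / norm (x - y) ^ (n - 1)\<close> on the whole ball.\<close>

definition H :: "real^'n \<Rightarrow> real" where
  "H w = (g (norm w) + indicator {0..2 * R} (norm w)) / norm w ^ (CARD('n) - 1)"

text \<open>The common error bound. The cut-off equals 1 beyond distance 2\<epsilon>, and by
  translation invariance the integral of \<open>H (x - y)\<close> over that ball is the same for all
  x, which yields uniformity.\<close>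

definition \<Theta> :: "real \<Rightarrow> real" where
  "\<Theta> \<epsilon> = (\<integral>w. indicator (cball 0 (2 * \<epsilon>)) w * H w \<partial>lborel)"

text \<open>Chosen once, so that all later estimates share a constant depending neither on x nor on
  \<epsilon>.\<close>

definition C :: real where
  "C = (SOME C. C \<ge> 0 \<and> (\<forall>x. \<forall>y\<in>ball c R. x \<noteq> y \<longrightarrow>
    \<bar>N x y\<bar> \<le> C / norm (x - y) ^ (CARD('n) - 1) \<and>
    \<bar>K x y\<bar> \<le> C / norm (x - y) ^ (CARD('n) - 1) \<and>
    \<bar>DN x y\<bar> \<le> C / (norm (x - y) * norm (x - y) ^ (CARD('n) - 1))))"

lemma C_bounds:
  "C \<ge> 0"
  "y \<in> ball c R \<Longrightarrow> x \<noteq> y \<Longrightarrow> \<bar>N x y\<bar> \<le> C / norm (x - y) ^ (CARD('n) - 1)"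
  "y \<in> ball c R \<Longrightarrow> x \<noteq> y \<Longrightarrow> \<bar>K x y\<bar> \<le> C / norm (x - y) ^ (CARD('n) - 1)"
  "y \<in> ball c R \<Longrightarrow> x \<noteq> y \<Longrightarrow> \<bar>DN x y\<bar> \<le> C / (norm (x - y) * norm (x - y) ^ (CARD('n) - 1))"
proof -
  have M: "norm y \<le> norm c + R" if "y \<in> ball c R" for y
    using that norm_triangle_sub[of y c] by (simp add: dist_norm norm_minus_commute)
  obtain C' where C': "C' \<ge> 0"
    "\<And>x y. norm y \<le> norm c + R \<Longrightarrow> x \<noteq> y \<Longrightarrow> \<bar>N x y\<bar> \<le> C' / norm (x - y) ^ (CARD('n) - 1)"
    "\<And>x y. norm y \<le> norm c + R \<Longrightarrow> x \<noteq> y \<Longrightarrow> \<bar>K x y\<bar> \<le> C' / norm (x - y) ^ (CARD('n) - 1)"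
    "\<And>x y. norm y \<le> norm c + R \<Longrightarrow> x \<noteq> y \<Longrightarrow> \<bar>DN x y\<bar> \<le> C' / (norm (x - y) * norm (x - y) ^ (CARD('n) - 1))"
    using kernel_bounds[of "norm c + R"] by blast
  have "C \<ge> 0 \<and> (\<forall>x. \<forall>y\<in>ball c R. x \<noteq> y \<longrightarrow>
    \<bar>N x y\<bar> \<le> C / norm (x - y) ^ (CARD('n) - 1) \<and>
    \<bar>K x y\<bar> \<le> C / norm (x - y) ^ (CARD('n) - 1) \<and>
    \<bar>DN x y\<bar> \<le> C / (norm (x - y) * norm (x - y) ^ (CARD('n) - 1)))"
    unfolding C_def by (rule someI[of _ C']) (use C' M in blast)
  then show "C \<ge> 0"
    "y \<in> ball c R \<Longrightarrow> x \<noteq> y \<Longrightarrow> \<bar>N x y\<bar> \<le> C / norm (x - y) ^ (CARD('n) - 1)"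
    "y \<in> ball c R \<Longrightarrow> x \<noteq> y \<Longrightarrow> \<bar>K x y\<bar> \<le> C / norm (x - y) ^ (CARD('n) - 1)"
    "y \<in> ball c R \<Longrightarrow> x \<noteq> y \<Longrightarrow> \<bar>DN x y\<bar> \<le> C / (norm (x - y) * norm (x - y) ^ (CARD('n) - 1))"
    by blast+
qed

section \<open>The integrable majorant and absolute convergence\<close>

lemma B_nonneg: "B \<ge> 0"
  using F_bound[of 0] by linarith

lemma \<Omega>_sets [measurable]: "\<Omega> \<in> sets borel"
  using open_\<Omega> by simp

lemma H_nonneg: "H w \<ge> 0"
  using g_nonneg by (simp add: H_def)

lemma integrable_H: "integrable lborel H"
proof -
  have "integrable lborel (\<lambda>r. g r + indicator {0..2 * R} r)"
    using g_int R by (intro Bochner_Integration.integrable_add integrable_real_indicator) auto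
  from integrable_radial[OF this, where 'a="real^'n"] show ?thesis
    by (simp add: H_def[abs_def])
qed

lemma H_measurable [measurable]: "H \<in> borel_measurable borel"
  using integrable_H by auto

lemma H_commute: "H (x - y) = H (- x + y)"
proof -
  have "norm (- x + y) = norm (x - y)" by (simp add: norm_minus_commute)
  then show ?thesis by (simp add: H_def)
qed

lemma integrable_H_shift: "integrable lborel (\<lambda>y. H (x - y))"
proof -
  have "integrable (distr lborel borel ((+) (- x))) H" using integrable_H by (simp add: lborel_distr_plus)
  then show ?thesis unfolding H_commute by (subst (asm) integrable_distr_eq) auto
qed

lemma integral_H_near: "(\<integral>y. indicator (cball x (2 * \<epsilon>)) y * H (x - y) \<partial>lborel) = \<Theta> \<epsilon>"
proof -
  have "indicator (cball x (2 * \<epsilon>)) y = (indicator (cball 0 (2 * \<epsilon>)) (- x + y) :: real)" for y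
    by (simp add: indicator_def dist_norm norm_minus_commute)
  then have "(\<integral>y. indicator (cball x (2 * \<epsilon>)) y * H (x - y) \<partial>lborel) =
      (\<integral>y. indicator (cball 0 (2 * \<epsilon>)) (- x + y) * H (- x + y) \<partial>lborel)"
    unfolding H_commute by simp
  also have "\<dots> = \<Theta> \<epsilon>" unfolding \<Theta>_def by (intro lborel_integral_translate) measurable
  finally show ?thesis .
qed

lemma integrable_H_near: "integrable lborel (\<lambda>y. indicator (cball x (2 * \<epsilon>)) y * H (x - y))"
  using integrable_mult_indicator[OF _ integrable_H_shift, of "cball x (2 * \<epsilon>)" x] by simp

text \<open>The balls shrink to the origin, a null set, so dominated convergence applies along
  1/(m+1); monotonicity in \<epsilon> passes from this sequence to the one-sided limit.\<close>

lemma \<Theta>_tendsto: "(\<Theta> \<longlongrightarrow> 0) (at_right 0)"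
proof -
  have int: "integrable lborel (\<lambda>w. indicator (cball 0 r) w * H w)" for r
    using integrable_mult_indicator[OF _ integrable_H, of "cball 0 r"] by simp
  have mono: "\<Theta> \<epsilon> \<le> \<Theta> \<epsilon>'" if "\<epsilon> \<le> \<epsilon>'" for \<epsilon> \<epsilon>'
    unfolding \<Theta>_def using that H_nonneg by (intro integral_mono int) (auto split: split_indicator)
  have nonneg: "0 \<le> \<Theta> \<epsilon>" for \<epsilon>
    unfolding \<Theta>_def using H_nonneg by simp
  have "(\<lambda>m. \<Theta> (1 / real (Suc m))) \<longlonglongrightarrow> (\<integral>w. 0 \<partial>(lborel :: (real^'n) measure))"
    unfolding \<Theta>_def
  proof (rule integral_dominated_convergence[where w=H])
    show "AE w in lborel. (\<lambda>m. indicator (cball 0 (2 * (1 / real (Suc m)))) w * H w) \<longlonglongrightarrow> 0"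
      using AE_norm_neq[of 0]
    proof eventually_elim
      case (elim w)
      then have "norm w > 0" by simp
      moreover have "(\<lambda>m. 2 * (1 / real (Suc m))) \<longlonglongrightarrow> 2 * 0"
        by (intro tendsto_mult_left LIMSEQ_Suc[OF lim_1_over_n])
      ultimately have "\<forall>\<^sub>F m in sequentially. 2 * (1 / real (Suc m)) < norm w"
        by (intro order_tendstoD(2)) auto
      then have "\<forall>\<^sub>F m in sequentially. 0 = indicator (cball 0 (2 * (1 / real (Suc m)))) w * H w"
        by eventually_elim simp
      then show ?case by (rule Lim_transform_eventually[OF tendsto_const])
    qed
    show "AE w in lborel. norm (indicator (cball 0 (2 * (1 / real (Suc m)))) w * H w) \<le> H w" for m
      using H_nonneg by (intro AE_I2) (simp add: indicator_def)
  qed (use integrable_H int in \<open>auto dest: borel_measurable_integrable\<close>)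
  then have lim: "(\<lambda>m. \<Theta> (1 / real (Suc m))) \<longlonglongrightarrow> 0" by simp
  show ?thesis
  proof (rule tendstoI)
    fix e :: real assume "e > 0"
    from eventually_happens[OF order_tendstoD(2)[OF lim this]]
    obtain m where m: "\<Theta> (1 / real (Suc m)) < e" by auto
    have "\<forall>\<^sub>F \<epsilon> in at_right 0. \<epsilon> \<in> {0<..<1 / real (Suc m)}"
      by (intro eventually_at_right_real) simp
    then show "\<forall>\<^sub>F \<epsilon> in at_right 0. dist (\<Theta> \<epsilon>) 0 < e"
    proof eventually_elim
      case (elim \<epsilon>)
      then show ?case using mono[of \<epsilon> "1 / real (Suc m)"] nonneg[of \<epsilon>] m by simp
    qed
  qed
qed

lemma inverse_power_le_H:
  assumes "x \<in> ball c R" "y \<in> ball c R"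
  shows "1 / norm (x - y) ^ (CARD('n) - 1) \<le> H (x - y)"
proof -
  have "norm (x - y) \<le> 2 * R"
    using assms dist_triangle2[of x y c] by (simp add: dist_norm norm_minus_commute)
  then show ?thesis unfolding H_def using g_nonneg by (intro divide_right_mono) auto
qed

lemma NK_bound:
  assumes "x \<in> ball c R" "y \<in> ball c R"
  shows "\<bar>N x y\<bar> \<le> C * H (x - y)" "\<bar>K x y\<bar> \<le> C * H (x - y)"
proof -
  have *: "C / norm (x - y) ^ (CARD('n) - 1) \<le> C * H (x - y)"
    using mult_left_mono[OF inverse_power_le_H[OF assms] C_bounds(1)] by simp
  show "\<bar>N x y\<bar> \<le> C * H (x - y)" "\<bar>K x y\<bar> \<le> C * H (x - y)"
    using * C_bounds(2,3)[OF assms(2), of x] C_bounds(1) H_nonneg[of 0]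
    by (cases "x = y"; fastforce simp: kernels_diag)+
qed

text \<open>The decisive gain: the gauge contributes r g(r), and r g(r)/r^n = g(r)/r^(n-1) is
  integrable on R^n because \<open>g\<close> is integrable on the line.\<close>

lemma F_diff_bound:
  assumes "x \<in> \<Omega>" "y \<in> \<Omega>" "x \<noteq> y" "norm (x - y) < \<delta>" "b \<ge> 0"
  shows "\<bar>F y - F x\<bar> * (b / (norm (x - y) * norm (x - y) ^ (CARD('n) - 1))) \<le> b * H (x - y)"
proof -
  let ?r = "norm (x - y)" and ?m = "CARD('n) - 1"
  have r: "?r > 0" using assms by simp
  have "\<bar>F y - F x\<bar> * (b / (?r * ?r ^ ?m)) \<le> (?r * g ?r) * (b / (?r * ?r ^ ?m))"
    using gauge[OF assms(1-4)] assms(5) by (intro mult_right_mono) (auto simp: abs_minus_commute)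
  also have "\<dots> = b * (g ?r / ?r ^ ?m)" using r by (simp add: field_simps)
  also have "\<dots> \<le> b * H (x - y)"
    unfolding H_def using assms(5) by (intro mult_left_mono divide_right_mono) auto
  finally show ?thesis .
qed

lemma set_integrable_dominated:
  assumes [measurable]: "f \<in> borel_measurable borel" "A \<in> sets borel"
    and b: "\<And>y. y \<in> A \<Longrightarrow> \<bar>f y\<bar> \<le> b * H (x - y)"
  shows "set_integrable lborel A f"
  unfolding set_integrable_def
proof (rule Bochner_Integration.integrable_bound)
  show "integrable lborel (\<lambda>y. \<bar>b\<bar> * H (x - y))" using integrable_H_shift by simp
  show "(\<lambda>y. indicator A y *\<^sub>R f y) \<in> borel_measurable lborel"
    by measurable
  show "AE y in lborel. norm (indicator A y *\<^sub>R f y) \<le> norm (\<bar>b\<bar> * H (x - y))"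
  proof (rule AE_I2)
    fix y
    have "b * H (x - y) \<le> \<bar>b\<bar> * H (x - y)" by (intro mult_right_mono H_nonneg) simp
    then show "norm (indicator A y *\<^sub>R f y) \<le> norm (\<bar>b\<bar> * H (x - y))"
      using b[of y] H_nonneg[of "x - y"] by (cases "y \<in> A") (auto simp: abs_mult)
  qed
qed

lemma \<Omega>_nhd:
  assumes "x \<in> \<Omega>" obtains d where "d > 0" "ball x d \<subseteq> \<Omega>"
  using open_\<Omega> assms open_contains_ball by blast

lemma set_integrable_K: "x \<in> ball c R \<Longrightarrow> set_integrable lborel (ball c R) (K x)"
  by (rule set_integrable_dominated[of _ _ C x]) (auto simp: NK_bound)

text \<open>Near x the gauge applies. Away from x, where y may lie outside \<Omega> and F(y) - F(x)
  is merely bounded by 2B, one factor 1/|x-y| is at most 1/d' and the rest is dominated by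
  \<open>H\<close>.\<close>

lemma set_integrable_DN:
  assumes x: "x \<in> \<Omega>"
  shows "set_integrable lborel (ball c R) (\<lambda>y. (F y - F x) * DN x y)"
proof -
  obtain d where d: "d > 0" "ball x d \<subseteq> \<Omega>" using \<Omega>_nhd[OF x] .
  \<comment> \<open>Closer than \<open>d\<close> the point y is in \<Omega>, closer than
    \<open>\<delta>\<close> the gauge holds; both are required.\<close>
  define d' where "d' = min d \<delta>"
  have d': "d' > 0" using d \<delta> by (simp add: d'_def)
  show ?thesis
  proof (rule set_integrable_dominated)
    fix y assume y: "y \<in> ball c R"
    let ?r = "norm (x - y)" and ?m = "CARD('n) - 1"
    let ?b = "C + 2 * B * (C / d')"
    have b: "C \<le> ?b" "2 * B * (C / d') \<le> ?b" using C_bounds(1) B_nonneg d' by auto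
    show "\<bar>(F y - F x) * DN x y\<bar> \<le> ?b * H (x - y)"
    proof (cases "x = y")
      case True
      then show ?thesis using b C_bounds(1) H_nonneg by simp
    next
      case False
      then have r: "?r > 0" by simp
      have "\<bar>(F y - F x) * DN x y\<bar> \<le> \<bar>F y - F x\<bar> * (C / (?r * ?r ^ ?m))"
        unfolding abs_mult using C_bounds(4)[OF y False] by (intro mult_left_mono) auto
      also have "\<dots> \<le> ?b * H (x - y)"
      proof (cases "?r < d'")
        case True
        then have "y \<in> \<Omega>" using d by (auto simp: d'_def dist_norm)
        then have "\<bar>F y - F x\<bar> * (C / (?r * ?r ^ ?m)) \<le> C * H (x - y)"
          using True False x C_bounds(1) by (intro F_diff_bound) (auto simp: d'_def)
        also have "\<dots> \<le> ?b * H (x - y)" using b H_nonneg by (intro mult_right_mono) auto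
        finally show ?thesis .
      next
        case far: False
        have "\<bar>F y - F x\<bar> \<le> 2 * B" using F_bound[of x] F_bound[of y] by linarith
        moreover have "C / (?r * ?r ^ ?m) \<le> C / (d' * ?r ^ ?m)"
          using far d' C_bounds(1) r by (intro divide_left_mono mult_right_mono mult_pos_pos) auto
        ultimately have "\<bar>F y - F x\<bar> * (C / (?r * ?r ^ ?m)) \<le> (2 * B) * (C / (d' * ?r ^ ?m))"
          using B_nonneg C_bounds(1) by (intro mult_mono) auto
        also have "\<dots> = (2 * B * (C / d')) * (1 / ?r ^ ?m)" by simp
        also have "\<dots> \<le> (2 * B * (C / d')) * H (x - y)"
          using B_nonneg C_bounds(1) d' x \<Omega>_ball y by (intro mult_left_mono inverse_power_le_H) auto
        also have "\<dots> \<le> ?b * H (x - y)" using b H_nonneg by (intro mult_right_mono) auto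
        finally show ?thesis .
      qed
      finally show ?thesis .
    qed
  qed auto
qed

section \<open>The regularized potential for a fixed cut-off scale\<close>

lemma G_measurable:
  assumes "\<epsilon> > 0"
  shows "G \<epsilon> x \<in> borel_measurable borel" "DG \<epsilon> x \<in> borel_measurable borel"
    "(\<lambda>y. K x y * \<eta> (norm (x - y) / \<epsilon>)) \<in> borel_measurable borel"
    and "continuous_on UNIV (G \<epsilon> x)" "continuous_on UNIV (DG \<epsilon> x)"
    "continuous_on UNIV (\<lambda>y. K x y * \<eta> (norm (x - y) / \<epsilon>))"
proof -
  have *: "continuous_on UNIV (\<lambda>y. f (x, y))" if "continuous_on UNIV f" for f :: "(real^'n) \<times> (real^'n) \<Rightarrow> real"
    by (rule continuous_on_compose2[OF that]) (auto intro!: continuous_intros)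
  show "continuous_on UNIV (G \<epsilon> x)" "continuous_on UNIV (DG \<epsilon> x)"
    "continuous_on UNIV (\<lambda>y. K x y * \<eta> (norm (x - y) / \<epsilon>))"
    using *[OF continuous_on_G(1)[OF assms]] *[OF continuous_on_G(2)[OF assms]] *[OF continuous_on_G(3)[OF assms]]
    by simp_all
  then show "G \<epsilon> x \<in> borel_measurable borel" "DG \<epsilon> x \<in> borel_measurable borel"
    "(\<lambda>y. K x y * \<eta> (norm (x - y) / \<epsilon>)) \<in> borel_measurable borel"
    by (auto intro: borel_measurable_continuous_onI)
qed

text \<open>Compactness of a product of closed balls; the unit ball about x leaves room to vary the
  first argument in difference quotients and limits.\<close>

lemma G_bounded:
  assumes "\<epsilon> > 0"
  obtains b where "b \<ge> 0" "\<And>z y. z \<in> cball x 1 \<Longrightarrow> y \<in> ball c R \<Longrightarrow> \<bar>G \<epsilon> z y\<bar> \<le> b"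
    "\<And>z y. z \<in> cball x 1 \<Longrightarrow> y \<in> ball c R \<Longrightarrow> \<bar>DG \<epsilon> z y\<bar> \<le> b"
    "\<And>z y. z \<in> cball x 1 \<Longrightarrow> y \<in> ball c R \<Longrightarrow> \<bar>K z y * \<eta> (norm (z - y) / \<epsilon>)\<bar> \<le> b"
proof -
  have "\<exists>b. \<forall>p\<in>cball x 1 \<times> cball c R. \<bar>f p\<bar> \<le> b" if "continuous_on UNIV f" for f :: "(real^'n) \<times> (real^'n) \<Rightarrow> real"
  proof -
    have "bounded (f ` (cball x 1 \<times> cball c R))"
      by (intro compact_imp_bounded compact_continuous_image continuous_on_subset[OF that] compact_Times) auto
    then show ?thesis by (auto simp: bounded_iff)
  qed
  from this[OF continuous_on_G(1)[OF assms]] this[OF continuous_on_G(2)[OF assms]] this[OF continuous_on_G(3)[OF assms]]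
  obtain b1 b2 b3 where b: "\<forall>p\<in>cball x 1 \<times> cball c R. \<bar>G \<epsilon> (fst p) (snd p)\<bar> \<le> b1"
    "\<forall>p\<in>cball x 1 \<times> cball c R. \<bar>DG \<epsilon> (fst p) (snd p)\<bar> \<le> b2"
    "\<forall>p\<in>cball x 1 \<times> cball c R. \<bar>K (fst p) (snd p) * \<eta> (norm (fst p - snd p) / \<epsilon>)\<bar> \<le> b3" by blast
  show ?thesis
  proof (rule that[of "\<bar>b1\<bar> + \<bar>b2\<bar> + \<bar>b3\<bar>"])
    fix z y assume "z \<in> cball x 1" "y \<in> ball c R"
    then have p: "(z, y) \<in> cball x 1 \<times> cball c R" by auto
    show "\<bar>G \<epsilon> z y\<bar> \<le> \<bar>b1\<bar> + \<bar>b2\<bar> + \<bar>b3\<bar>" using bspec[OF b(1) p] by simp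
    show "\<bar>DG \<epsilon> z y\<bar> \<le> \<bar>b1\<bar> + \<bar>b2\<bar> + \<bar>b3\<bar>" using bspec[OF b(2) p] by simp
    show "\<bar>K z y * \<eta> (norm (z - y) / \<epsilon>)\<bar> \<le> \<bar>b1\<bar> + \<bar>b2\<bar> + \<bar>b3\<bar>" using bspec[OF b(3) p] by simp
  qed simp
qed

lemma set_integrable_bounded:
  assumes [measurable]: "f \<in> borel_measurable borel" "A \<in> sets borel" and "bounded A" "\<And>y. y \<in> A \<Longrightarrow> \<bar>f y\<bar> \<le> b"
  shows "set_integrable lborel A (f :: real^'n \<Rightarrow> real)"
  unfolding set_integrable_def
proof (rule integrable_bounded_support[of _ A b])
  show "(\<lambda>y. indicator A y *\<^sub>R f y) \<in> borel_measurable borel"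
    by measurable
qed (use assms in auto)

lemma veps_has_partial_deriv:
  assumes \<epsilon>: "\<epsilon> > 0"
  shows "has_partial_deriv j (veps \<epsilon>) (Dveps \<epsilon> x) x"
proof -
  let ?e = "axis j 1 :: real^'n"
  obtain b where b: "b \<ge> 0" "\<And>z y. z \<in> cball x 1 \<Longrightarrow> y \<in> ball c R \<Longrightarrow> \<bar>G \<epsilon> z y\<bar> \<le> b"
    "\<And>z y. z \<in> cball x 1 \<Longrightarrow> y \<in> ball c R \<Longrightarrow> \<bar>DG \<epsilon> z y\<bar> \<le> b"
    using G_bounded[OF \<epsilon>, of x] by metis
  note [measurable] = G_measurable(1,2)[OF \<epsilon>]
  have z: "x + t *\<^sub>R ?e \<in> cball x 1" if "\<bar>t\<bar> \<le> 1" for t using that by (simp add: dist_norm)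
  have FG: "\<bar>F y * f\<bar> \<le> B * b" if "\<bar>f\<bar> \<le> b" for f y
    unfolding abs_mult using that F_bound B_nonneg by (intro mult_mono) auto
  have "((\<lambda>t. \<integral>y. indicator \<Omega> y *\<^sub>R (F y * G \<epsilon> (x + t *\<^sub>R ?e) y) \<partial>lborel) has_real_derivative
      (\<integral>y. indicator \<Omega> y *\<^sub>R (F y * DG \<epsilon> x y) \<partial>lborel)) (at 0)"
  proof (rule has_real_derivative_integral[where d=1 and w="\<lambda>y. indicator \<Omega> y *\<^sub>R (B * b)"])
    show "integrable lborel (\<lambda>y. indicator \<Omega> y *\<^sub>R (F y * G \<epsilon> (x + t *\<^sub>R ?e) y))" if "\<bar>t\<bar> < 1" for t
      unfolding set_integrable_def[symmetric]
    proof (rule set_integrable_bounded[where b="B * b"])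
      show "\<bar>F y * G \<epsilon> (x + t *\<^sub>R ?e) y\<bar> \<le> B * b" if "y \<in> \<Omega>" for y
        using that \<Omega>_ball \<open>\<bar>t\<bar> < 1\<close> by (intro FG b z) auto
    qed (use bounded_subset[OF bounded_ball \<Omega>_ball] in auto)
    show "integrable lborel (\<lambda>y. indicator \<Omega> y *\<^sub>R (B * b))"
      unfolding set_integrable_def[symmetric]
      by (rule set_integrable_bounded[where b="\<bar>B * b\<bar>"]) (use bounded_subset[OF bounded_ball \<Omega>_ball] in auto)
    show "\<bar>indicator \<Omega> y *\<^sub>R (F y * G \<epsilon> (x + t *\<^sub>R ?e) y) - indicator \<Omega> y *\<^sub>R (F y * G \<epsilon> (x + 0 *\<^sub>R ?e) y)\<bar>
        \<le> \<bar>t\<bar> * indicator \<Omega> y *\<^sub>R (B * b)" if t: "\<bar>t\<bar> < 1" for t y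
    proof (cases "y \<in> \<Omega>")
      case True
      have "\<bar>G \<epsilon> (x + t *\<^sub>R ?e) y - G \<epsilon> x y\<bar> \<le> \<bar>t\<bar> * b"
      proof (rule has_partial_deriv_lipschitz[where G="\<lambda>z. G \<epsilon> z y" and G'="\<lambda>z. DG \<epsilon> z y"])
        show "\<bar>DG \<epsilon> (x + s *\<^sub>R ?e) y\<bar> \<le> b" if "\<bar>s\<bar> \<le> \<bar>t\<bar>" for s
          using True \<Omega>_ball t that by (intro b(3) z) auto
      qed (rule G_has_partial_deriv[OF \<epsilon>])
      then have "\<bar>F y\<bar> * \<bar>G \<epsilon> (x + t *\<^sub>R ?e) y - G \<epsilon> x y\<bar> \<le> B * (\<bar>t\<bar> * b)"
        using F_bound B_nonneg by (intro mult_mono) auto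
      then show ?thesis using True by (simp add: abs_mult[symmetric] right_diff_distrib mult_ac)
    qed simp
    show "AE y in lborel. ((\<lambda>t. indicator \<Omega> y *\<^sub>R (F y * G \<epsilon> (x + t *\<^sub>R ?e) y)) has_real_derivative
        indicator \<Omega> y *\<^sub>R (F y * DG \<epsilon> x y)) (at 0)"
      using G_has_partial_deriv(1)[OF \<epsilon>] unfolding has_partial_deriv_def
      by (intro AE_I2) (auto intro!: DERIV_cmult)
  qed auto
  then show ?thesis
    by (simp add: has_partial_deriv_def veps_def[abs_def] Dveps_def set_lebesgue_integral_def G_def mult.assoc)
qed

lemma continuous_on_Dveps:
  assumes \<epsilon>: "\<epsilon> > 0"
  shows "continuous_on UNIV (Dveps \<epsilon>)"
proof -
  note [measurable] = G_measurable(2)[OF \<epsilon>]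
  \<comment> \<open>The dominating bound is available only for arguments near \<open>x\<close>, so
    continuity is shown on unit balls and then read off at their centres.\<close>
  have cb: "continuous_on (cball x 1) (Dveps \<epsilon>)" for x
    unfolding continuous_on_sequentially
  proof (intro allI ballI impI)
    fix X a assume X: "(\<forall>n. X n \<in> cball x 1) \<and> X \<longlonglongrightarrow> a"
    obtain b where b: "b \<ge> 0" "\<And>z y. z \<in> cball x 1 \<Longrightarrow> y \<in> ball c R \<Longrightarrow> \<bar>DG \<epsilon> z y\<bar> \<le> b"
      using G_bounded[OF \<epsilon>, of x] by metis
    have "(\<lambda>n. \<integral>y. indicator \<Omega> y *\<^sub>R (F y * DG \<epsilon> (X n) y) \<partial>lborel) \<longlonglongrightarrow> (\<integral>y. indicator \<Omega> y *\<^sub>R (F y * DG \<epsilon> a y) \<partial>lborel)"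
    proof (rule integral_dominated_convergence[where w="\<lambda>y. indicator \<Omega> y *\<^sub>R (B * b)"])
      show "integrable lborel (\<lambda>y. indicator \<Omega> y *\<^sub>R (B * b))"
        unfolding set_integrable_def[symmetric]
        by (rule set_integrable_bounded[where b="\<bar>B * b\<bar>"]) (use bounded_subset[OF bounded_ball \<Omega>_ball] in auto)
      show "AE y in lborel. (\<lambda>n. indicator \<Omega> y *\<^sub>R (F y * DG \<epsilon> (X n) y)) \<longlonglongrightarrow> indicator \<Omega> y *\<^sub>R (F y * DG \<epsilon> a y)"
      proof (intro AE_I2 tendsto_scaleR tendsto_mult tendsto_const)
        fix y
        have "continuous_on UNIV (\<lambda>z. DG \<epsilon> z y)"
          using continuous_on_compose2[OF continuous_on_G(2)[OF \<epsilon>], of UNIV "\<lambda>z. (z, y)"]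
          by (simp add: continuous_on_Pair)
        then show "(\<lambda>n. DG \<epsilon> (X n) y) \<longlonglongrightarrow> DG \<epsilon> a y"
          using X by (auto simp: continuous_on_sequentially o_def)
      qed
      show "AE y in lborel. norm (indicator \<Omega> y *\<^sub>R (F y * DG \<epsilon> (X n) y)) \<le> indicator \<Omega> y *\<^sub>R (B * b)" for n
      proof (rule AE_I2)
        fix y
        have "\<bar>F y\<bar> * \<bar>DG \<epsilon> (X n) y\<bar> \<le> B * b" if "y \<in> \<Omega>"
          using that X \<Omega>_ball F_bound B_nonneg by (intro mult_mono b) auto
        then show "norm (indicator \<Omega> y *\<^sub>R (F y * DG \<epsilon> (X n) y)) \<le> indicator \<Omega> y *\<^sub>R (B * b)"
          by (cases "y \<in> \<Omega>") (auto simp: abs_mult)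
      qed
    qed measurable
    then show "(Dveps \<epsilon> \<circ> X) \<longlonglongrightarrow> Dveps \<epsilon> a"
      by (simp add: Dveps_def set_lebesgue_integral_def o_def)
  qed
  have "isCont (Dveps \<epsilon>) x" for x
    by (rule continuous_on_interior[OF cb[of x]]) simp
  then show ?thesis by (simp add: continuous_on_eq_continuous_at)
qed

section \<open>Comparison of the regularized derivative with its limit\<close>

lemma u_kernels:
  "u x = (LINT y : ball c R | lborel. (F y - F x) * DN x y) + F x * (LINT y : ball c R | lborel. K x y)
    - F x * sphere_integral c R (\<lambda>y. N x y * ((y - c)$j / R))"
proof -
  have "(LINT y : ball c R | lborel. (F y - F x) * partial j (\<lambda>z. N z y) x) = (LINT y : ball c R | lborel. (F y - F x) * DN x y)"
    unfolding set_lebesgue_integral_def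
    \<comment> \<open>At y = x the value of \<open>partial\<close> need not be a derivative; one
      point does not affect the integral.\<close>
    by (rule integral_discrete_difference[of "{x}"]) (auto simp: partial_N)
  then show ?thesis by (simp add: u_def K_def ray_int_def)
qed

lemma set_integrable_partial_N:
  assumes "x \<in> \<Omega>"
  shows "set_integrable lborel (ball c R) (\<lambda>y. (F y - F x) * partial j (\<lambda>z. N z y) x)"
  using set_integrable_DN[OF assms] unfolding set_integrable_def
  by (rule integrable_discrete_difference[of "{x}", THEN iffD1, rotated 4]) (auto simp: partial_N)

lemma sphere_integrable_N:
  assumes "x \<in> \<Omega>"
  shows "sphere_integrable c R (\<lambda>y. N x y * ((y - c)$j / R))"
proof (rule sphere_integrable_continuous[OF R])
  have "continuous_on (sphere c R) (N x)"
    using assms \<Omega>_ball by (intro continuous_on_subset[OF continuous_on_section[OF continuous_on_kernels(1)]]) auto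
  then show "continuous_on (sphere c R) (\<lambda>y. N x y * ((y - c)$j / R))"
    using R by (intro continuous_intros) auto
qed

lemma set_integrable_regularized:
  assumes \<epsilon>: "\<epsilon> > 0"
  shows "set_integrable lborel (ball c R) (DG \<epsilon> x)"
    and "set_integrable lborel (ball c R) (\<lambda>y. (F y - F x) * DG \<epsilon> x y)"
    and "set_integrable lborel (ball c R) (\<lambda>y. K x y * \<eta> (norm (x - y) / \<epsilon>))"
proof -
  obtain b where b: "b \<ge> 0" "\<And>y. y \<in> ball c R \<Longrightarrow> \<bar>DG \<epsilon> x y\<bar> \<le> b"
    "\<And>y. y \<in> ball c R \<Longrightarrow> \<bar>K x y * \<eta> (norm (x - y) / \<epsilon>)\<bar> \<le> b"
    using G_bounded[OF \<epsilon>, of x] by (metis centre_in_cball zero_le_one)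
  note [measurable] = G_measurable(2,3)[OF \<epsilon>]
  show "set_integrable lborel (ball c R) (DG \<epsilon> x)"
    by (rule set_integrable_bounded[where b=b]) (use b in auto)
  show "set_integrable lborel (ball c R) (\<lambda>y. K x y * \<eta> (norm (x - y) / \<epsilon>))"
    by (rule set_integrable_bounded[where b=b]) (use b in auto)
  show "set_integrable lborel (ball c R) (\<lambda>y. (F y - F x) * DG \<epsilon> x y)"
  proof (rule set_integrable_bounded[where b="(2 * B) * b"])
    show "\<bar>(F y - F x) * DG \<epsilon> x y\<bar> \<le> 2 * B * b" if "y \<in> ball c R" for y
      unfolding abs_mult using F_bound[of x] F_bound[of y] B_nonneg b(2)[OF that] by (intro mult_mono) auto
  qed auto
qed

text \<open>The constant F(x) is never integrated against \<open>DN\<close>, for which no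
  integrability is available. For the regular kernel \<open>DG\<close> the divergence theorem trades
  that term for \<open>K\<close> and a boundary term independent of \<epsilon>, and the latter
  cancels with \<open>u\<close>.\<close>

lemma Dveps_minus_u:
  assumes x: "x \<in> \<Omega>" and d: "ball x d \<subseteq> \<Omega>" and \<epsilon>: "0 < \<epsilon>" "2 * \<epsilon> < d"
  shows "Dveps \<epsilon> x - u x = (LINT y : ball c R | lborel. (F y - F x) * (DG \<epsilon> x y - DN x y))
    + F x * (LINT y : ball c R | lborel. K x y * (\<eta> (norm (x - y) / \<epsilon>) - 1))"
proof -
  let ?e = "\<lambda>y. \<eta> (norm (x - y) / \<epsilon>)"
  let ?S = "ball c R"
  have xc: "x \<in> ?S" using x \<Omega>_ball by auto
  note iDG = set_integrable_regularized(1)[OF \<epsilon>(1), of x]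
  note iFDG = set_integrable_regularized(2)[OF \<epsilon>(1), of x]
  note iK = set_integrable_regularized(3)[OF \<epsilon>(1), of x]
  \<comment> \<open>Outside \<Omega> the two summands cancel because F(y) = 0, so the domain may be
    enlarged to the ball.\<close>
  have "Dveps \<epsilon> x = (LINT y : ?S | lborel. (F y - F x) * DG \<epsilon> x y + F x * DG \<epsilon> x y)"
    unfolding Dveps_def set_lebesgue_integral_def
    using F_ext \<Omega>_ball by (intro Bochner_Integration.integral_cong) (auto simp: indicator_def algebra_simps)
  also have "\<dots> = (LINT y : ?S | lborel. (F y - F x) * DG \<epsilon> x y) + F x * (LINT y : ?S | lborel. DG \<epsilon> x y)"
    using iFDG iDG by (simp add: set_integral_add)
  finally have 1: "Dveps \<epsilon> x = (LINT y : ?S | lborel. (F y - F x) * DG \<epsilon> x y) + F x * (LINT y : ?S | lborel. DG \<epsilon> x y)" .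
  have "(LINT y : ?S | lborel. K x y * ?e y - DG \<epsilon> x y) = sphere_integral c R (\<lambda>y. G \<epsilon> x y * ((y - c)$j / R))"
    by (rule divergence_ball[OF R _ _ G_has_partial_deriv(2)[OF \<epsilon>(1)]])
      (intro continuous_intros G_measurable \<epsilon>)+
  also have "\<dots> = sphere_integral c R (\<lambda>y. N x y * ((y - c)$j / R))"
  proof (rule sphere_integral_cong[OF R])
    fix y assume y: "norm (y - c) = R"
    then have "y \<notin> ball c R" by (simp add: dist_norm norm_minus_commute)
    \<comment> \<open>Points of the sphere lie outside \<Omega>, hence at distance at least d >
      2\<epsilon> from x.\<close>
    then have "y \<notin> ball x d" using d \<Omega>_ball by blast
    then have "?e y = 1" using \<epsilon> by (intro DG_eq_DN) (auto simp: dist_norm)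
    then show "G \<epsilon> x y * ((y - c)$j / R) = N x y * ((y - c)$j / R)" by (simp add: G_def)
  qed
  finally have 2: "(LINT y : ?S | lborel. DG \<epsilon> x y) =
      (LINT y : ?S | lborel. K x y * ?e y) - sphere_integral c R (\<lambda>y. N x y * ((y - c)$j / R))"
    using iDG iK by (simp add: set_integral_diff)
  have 3: "(LINT y : ?S | lborel. (F y - F x) * (DG \<epsilon> x y - DN x y)) =
      (LINT y : ?S | lborel. (F y - F x) * DG \<epsilon> x y) - (LINT y : ?S | lborel. (F y - F x) * DN x y)"
    unfolding right_diff_distrib using iFDG set_integrable_DN[OF x] by (intro set_integral_diff)
  have 4: "(LINT y : ?S | lborel. K x y * (?e y - 1)) = (LINT y : ?S | lborel. K x y * ?e y) - (LINT y : ?S | lborel. K x y)"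
    unfolding right_diff_distrib mult_1_right using iK set_integrable_K[OF xc] by (intro set_integral_diff)
  show ?thesis unfolding u_kernels 1 2 3 4 by (simp add: algebra_simps)
qed

lemma set_integral_near_bound:
  assumes f: "\<And>y. y \<in> A \<Longrightarrow> y \<notin> cball x (2 * \<epsilon>) \<Longrightarrow> f y = 0"
    and b: "\<And>y. y \<in> A \<Longrightarrow> y \<in> cball x (2 * \<epsilon>) \<Longrightarrow> \<bar>f y\<bar> \<le> b * H (x - y)" and "b \<ge> 0"
    and int: "set_integrable lborel A f"
  shows "\<bar>LINT y : A | lborel. f y\<bar> \<le> b * \<Theta> \<epsilon>"
proof -
  have "\<bar>LINT y : A | lborel. f y\<bar> \<le> (\<integral>y. b * (indicator (cball x (2 * \<epsilon>)) y * H (x - y)) \<partial>lborel)"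
    unfolding set_lebesgue_integral_def
  proof (rule integral_abs_bound_integral)
    show "integrable lborel (\<lambda>y. indicator A y *\<^sub>R f y)" using int by (simp add: set_integrable_def)
    show "integrable lborel (\<lambda>y. b * (indicator (cball x (2 * \<epsilon>)) y * H (x - y)))"
      using integrable_H_near by simp
    show "\<bar>indicator A y *\<^sub>R f y\<bar> \<le> b * (indicator (cball x (2 * \<epsilon>)) y * H (x - y))" for y
      using f[of y] b[of y] H_nonneg[of "x - y"] \<open>b \<ge> 0\<close>
      by (cases "y \<in> A"; cases "y \<in> cball x (2 * \<epsilon>)") auto
  qed
  then show ?thesis by (simp add: integral_H_near)
qed

text \<open>The 7C comes from \<open>DG_diff_bound\<close> combined with the gauge, which is usable
  because the ball of radius 2\<epsilon> about x lies in \<Omega>; the second part multiplies |F|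
  \<le> B, |K| \<le> C H and |\<eta> - 1| \<le> 3.\<close>

lemma Dveps_u_bound:
  assumes x: "x \<in> \<Omega>" and d: "ball x d \<subseteq> \<Omega>" and \<epsilon>: "0 < \<epsilon>" "2 * \<epsilon> < d" "2 * \<epsilon> < \<delta>"
  shows "\<bar>Dveps \<epsilon> x - u x\<bar> \<le> (7 * C + B * (3 * C)) * \<Theta> \<epsilon>"
proof -
  let ?e = "\<lambda>y. \<eta> (norm (x - y) / \<epsilon>)"
  let ?S = "ball c R"
  have xc: "x \<in> ?S" using x \<Omega>_ball by auto
  note iFDG = set_integrable_regularized(2)[OF \<epsilon>(1), of x]
  note iK = set_integrable_regularized(3)[OF \<epsilon>(1), of x]
  have far: "2 * \<epsilon> < norm (x - y)" if "y \<notin> cball x (2 * \<epsilon>)" for y using that by (simp add: dist_norm)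
  have b1: "\<bar>(F y - F x) * (DG \<epsilon> x y - DN x y)\<bar> \<le> 7 * C * H (x - y)" if y: "y \<in> ?S" "y \<in> cball x (2 * \<epsilon>)" for y
  proof (cases "x = y")
    case True
    then show ?thesis using C_bounds(1) H_nonneg by simp
  next
    case False
    have y': "y \<in> \<Omega>" "norm (x - y) < \<delta>" using y \<epsilon> d by (auto simp: dist_norm)
    have "\<bar>(F y - F x) * (DG \<epsilon> x y - DN x y)\<bar> \<le> \<bar>F y - F x\<bar> * (7 * C / (norm (x - y) * norm (x - y) ^ (CARD('n) - 1)))"
      unfolding abs_mult
      by (intro mult_left_mono DG_diff_bound[OF \<epsilon>(1) False C_bounds(2)[OF y(1) False] C_bounds(4)[OF y(1) False]]) simp
    also have "\<dots> \<le> 7 * C * H (x - y)"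
      using C_bounds(1) by (intro F_diff_bound[OF x y'(1) False y'(2)]) simp
    finally show ?thesis .
  qed
  have b2: "\<bar>K x y * (?e y - 1)\<bar> \<le> 3 * C * H (x - y)" if "y \<in> ?S" for y
  proof -
    have "\<bar>K x y * (?e y - 1)\<bar> \<le> (C * H (x - y)) * 3"
      unfolding abs_mult using NK_bound(2)[OF xc that] eta_bound[of "norm (x - y) / \<epsilon>"] \<epsilon> C_bounds(1) H_nonneg
      by (intro mult_mono) auto
    then show ?thesis by simp
  qed
  have 1: "\<bar>LINT y : ?S | lborel. (F y - F x) * (DG \<epsilon> x y - DN x y)\<bar> \<le> 7 * C * \<Theta> \<epsilon>"
  proof (rule set_integral_near_bound)
    show "set_integrable lborel ?S (\<lambda>y. (F y - F x) * (DG \<epsilon> x y - DN x y))"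
      unfolding right_diff_distrib using iFDG set_integrable_DN[OF x] by (rule set_integral_diff(1))
  qed (use b1 C_bounds(1) DG_eq_DN(1)[OF \<epsilon>(1) far] in auto)
  have 2: "\<bar>LINT y : ?S | lborel. K x y * (?e y - 1)\<bar> \<le> 3 * C * \<Theta> \<epsilon>"
  proof (rule set_integral_near_bound)
    show "set_integrable lborel ?S (\<lambda>y. K x y * (?e y - 1))"
      unfolding right_diff_distrib mult_1_right using iK set_integrable_K[OF xc] by (rule set_integral_diff(1))
  qed (use b2 C_bounds(1) DG_eq_DN(2)[OF \<epsilon>(1) far] in auto)
  have "\<bar>Dveps \<epsilon> x - u x\<bar> \<le> \<bar>LINT y : ?S | lborel. (F y - F x) * (DG \<epsilon> x y - DN x y)\<bar>
      + \<bar>F x\<bar> * \<bar>LINT y : ?S | lborel. K x y * (?e y - 1)\<bar>"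
    unfolding Dveps_minus_u[OF x d \<epsilon>(1,2)] abs_mult[symmetric] by (rule abs_triangle_ineq)
  also have "\<dots> \<le> 7 * C * \<Theta> \<epsilon> + B * (3 * C * \<Theta> \<epsilon>)"
    using B_nonneg F_bound by (intro add_mono mult_mono 1 2) auto
  finally show ?thesis by (simp add: algebra_simps)
qed

text \<open>\<open>N\<close> itself is dominated by \<open>H\<close>, so no oscillation of F enters
  and the distance of x to the boundary is irrelevant.\<close>

lemma veps_v_bound:
  assumes x: "x \<in> \<Omega>" and \<epsilon>: "0 < \<epsilon>"
  shows "\<bar>veps \<epsilon> x - v x\<bar> \<le> B * (3 * C) * \<Theta> \<epsilon>"
proof -
  let ?e = "\<lambda>y. \<eta> (norm (x - y) / \<epsilon>)"
  have xc: "x \<in> ball c R" using x \<Omega>_ball by auto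
  note [measurable] = G_measurable(1)[OF \<epsilon>]
  obtain b where b: "b \<ge> 0" "\<And>y. y \<in> ball c R \<Longrightarrow> \<bar>G \<epsilon> x y\<bar> \<le> b"
    using G_bounded[OF \<epsilon>, of x] by (metis centre_in_cball zero_le_one)
  have i1: "set_integrable lborel \<Omega> (\<lambda>y. F y * G \<epsilon> x y)"
  proof (rule set_integrable_bounded[where b="B * b"])
    show "\<bar>F y * G \<epsilon> x y\<bar> \<le> B * b" if "y \<in> \<Omega>" for y
      unfolding abs_mult using F_bound B_nonneg b that \<Omega>_ball by (intro mult_mono) auto
  qed (use bounded_subset[OF bounded_ball \<Omega>_ball] in auto)
  have i2: "set_integrable lborel \<Omega> (\<lambda>y. F y * N x y)"
  proof (rule set_integrable_dominated)
    show "\<bar>F y * N x y\<bar> \<le> B * C * H (x - y)" if "y \<in> \<Omega>" for y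
      unfolding abs_mult mult.assoc using that F_bound B_nonneg NK_bound(1)[OF xc] \<Omega>_ball
      by (intro mult_mono) auto
  qed auto
  have "veps \<epsilon> x - v x = (LINT y : \<Omega> | lborel. F y * G \<epsilon> x y - F y * N x y)"
    unfolding veps_def v_def mult.assoc G_def[symmetric] using i1 i2 by (intro set_integral_diff(2)[symmetric])
  also have "\<bar>\<dots>\<bar> \<le> B * (3 * C) * \<Theta> \<epsilon>"
  proof (rule set_integral_near_bound[OF _ _ _ set_integral_diff(1)[OF i1 i2]])
    fix y assume "y \<in> \<Omega>" "y \<notin> cball x (2 * \<epsilon>)"
    then show "F y * G \<epsilon> x y - F y * N x y = 0"
      using DG_eq_DN(2)[OF \<epsilon>, of x y] by (simp add: G_def dist_norm)
  next
    fix y assume y: "y \<in> \<Omega>"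
    have "\<bar>F y\<bar> * (\<bar>N x y\<bar> * \<bar>?e y - 1\<bar>) \<le> B * ((C * H (x - y)) * 3)"
      using F_bound B_nonneg NK_bound(1)[OF xc] y \<Omega>_ball C_bounds(1) H_nonneg \<epsilon> eta_bound[of "norm (x - y) / \<epsilon>"]
      by (intro mult_mono) auto
    moreover have "F y * G \<epsilon> x y - F y * N x y = F y * (N x y * (?e y - 1))"
      by (simp add: G_def right_diff_distrib)
    ultimately show "\<bar>F y * G \<epsilon> x y - F y * N x y\<bar> \<le> B * (3 * C) * H (x - y)"
      by (simp add: abs_mult mult_ac)
  qed (use B_nonneg C_bounds(1) in auto)
  finally show ?thesis .
qed

section \<open>Removing the cut-off\<close>

lemma uniform_limit_Dveps:
  assumes "d > 0" "\<And>x. x \<in> S \<Longrightarrow> ball x d \<subseteq> \<Omega>"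
  shows "uniform_limit S Dveps u (at_right 0)"
proof (rule uniform_limitI)
  fix e :: real assume e: "e > 0"
  let ?k = "7 * C + B * (3 * C)"
  have "((\<lambda>\<epsilon>. ?k * \<Theta> \<epsilon>) \<longlongrightarrow> ?k * 0) (at_right 0)" by (intro tendsto_intros \<Theta>_tendsto)
  then have 1: "\<forall>\<^sub>F \<epsilon> in at_right 0. ?k * \<Theta> \<epsilon> < e" using e by (intro order_tendstoD(2)) auto
  have 2: "\<forall>\<^sub>F \<epsilon> in at_right 0. \<epsilon> \<in> {0<..<min d \<delta> / 2}"
    using assms(1) \<delta> by (intro eventually_at_right_real) simp
  from 1 2 show "\<forall>\<^sub>F \<epsilon> in at_right 0. \<forall>x\<in>S. dist (Dveps \<epsilon> x) (u x) < e"
  proof eventually_elim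
    case (elim \<epsilon>)
    show ?case
    proof
      fix x assume x: "x \<in> S"
      have "x \<in> \<Omega>" using assms(2)[OF x] assms(1) by auto
      then have "\<bar>Dveps \<epsilon> x - u x\<bar> \<le> ?k * \<Theta> \<epsilon>"
        using elim assms(2)[OF x] by (intro Dveps_u_bound) auto
      then show "dist (Dveps \<epsilon> x) (u x) < e" using elim by (simp add: dist_real_def)
    qed
  qed
qed

text \<open>Halving the radius gives all points near \<open>x\<close> the same distance to spare
  inside \<Omega>, as uniform convergence on a neighbourhood demands.\<close>

lemma \<Omega>_cball_nhd:
  assumes "x \<in> \<Omega>" obtains d where "d > 0" "\<And>z. z \<in> ball x d \<Longrightarrow> ball z d \<subseteq> \<Omega>"
proof -
  obtain d where d: "d > 0" "ball x d \<subseteq> \<Omega>" using \<Omega>_nhd[OF assms] .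
  have "ball z (d / 2) \<subseteq> \<Omega>" if "z \<in> ball x (d / 2)" for z
  proof -
    have "ball z (d / 2) \<subseteq> ball x d"
    proof
      fix w assume "w \<in> ball z (d / 2)"
      then show "w \<in> ball x d" using that dist_triangle[of x w z] by simp
    qed
    then show ?thesis using d(2) by blast
  qed
  then show ?thesis using that[of "d / 2"] d(1) by simp
qed

lemma continuous_on_u: "continuous_on \<Omega> u"
proof -
  have "isCont u x" if x: "x \<in> \<Omega>" for x
  proof -
    obtain d where d: "d > 0" "\<And>z. z \<in> ball x d \<Longrightarrow> ball z d \<subseteq> \<Omega>" using \<Omega>_cball_nhd[OF x] by blast
    have "\<forall>\<^sub>F \<epsilon> in at_right 0. continuous_on (ball x d) (Dveps \<epsilon>)"
      using eventually_at_right_less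
      by eventually_elim (rule continuous_on_subset[OF continuous_on_Dveps], auto)
    then have "continuous_on (ball x d) u"
      by (rule uniform_limit_theorem[OF _ uniform_limit_Dveps[OF d]]) auto
    then show ?thesis using d(1) by (simp add: continuous_on_eq_continuous_at)
  qed
  then show ?thesis by (intro continuous_at_imp_continuous_on) auto
qed

text \<open>Restricted to the line through \<open>x\<close> in direction j, the regularized
  potentials converge pointwise and their derivatives uniformly, so limit and derivative may be
  interchanged.\<close>

lemma v_has_partial_deriv:
  assumes x: "x \<in> \<Omega>"
  shows "has_partial_deriv j v (u x) x"
proof -
  let ?e = "axis j 1 :: real^'n"
  obtain d where d: "d > 0" "\<And>z. z \<in> ball x d \<Longrightarrow> ball z d \<subseteq> \<Omega>" using \<Omega>_cball_nhd[OF x] by blast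
  define \<epsilon> where "\<epsilon> m = 1 / real (Suc m)" for m
  have \<epsilon>: "\<epsilon> m > 0" for m by (simp add: \<epsilon>_def)
  have \<epsilon>_lim: "filterlim \<epsilon> (at_right 0) sequentially"
  proof (rule tendsto_imp_filterlim_at_right)
    show "\<epsilon> \<longlonglongrightarrow> 0" unfolding \<epsilon>_def by (rule LIMSEQ_Suc[OF lim_1_over_n])
  qed (simp add: \<epsilon>)
  have z: "x + t *\<^sub>R ?e \<in> ball x d" if "t \<in> ball 0 d" for t using that by (simp add: dist_norm)
  have z\<Omega>: "x + t *\<^sub>R ?e \<in> \<Omega>" if "t \<in> ball 0 d" for t using d(2)[OF z[OF that]] d(1) by auto
  have conv: "(\<lambda>m. veps (\<epsilon> m) (x + t *\<^sub>R ?e)) \<longlonglongrightarrow> v (x + t *\<^sub>R ?e)" if "t \<in> ball 0 d" for t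
  proof -
    have "(\<lambda>m. veps (\<epsilon> m) (x + t *\<^sub>R ?e) - v (x + t *\<^sub>R ?e)) \<longlonglongrightarrow> 0"
    proof (rule Lim_null_comparison)
      show "\<forall>\<^sub>F m in sequentially. norm (veps (\<epsilon> m) (x + t *\<^sub>R ?e) - v (x + t *\<^sub>R ?e)) \<le> B * (3 * C) * \<Theta> (\<epsilon> m)"
        using veps_v_bound[OF z\<Omega>[OF that] \<epsilon>] by (intro always_eventually allI) simp
      have "(\<lambda>m. B * (3 * C) * \<Theta> (\<epsilon> m)) \<longlonglongrightarrow> B * (3 * C) * 0"
        by (intro tendsto_mult_left filterlim_compose[OF \<Theta>_tendsto \<epsilon>_lim])
      then show "(\<lambda>m. B * (3 * C) * \<Theta> (\<epsilon> m)) \<longlonglongrightarrow> 0" by simp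
    qed
    then show ?thesis by (simp add: LIM_zero_iff)
  qed
  \<comment> \<open>The interchange theorem only asserts that some limit function exists; uniqueness
    of limits later identifies it with \<open>v\<close> along the line.\<close>
  have "\<exists>w. \<forall>t\<in>ball 0 d. (\<lambda>m. veps (\<epsilon> m) (x + t *\<^sub>R ?e)) \<longlonglongrightarrow> w t \<and>
      (w has_derivative (\<lambda>h. h * u (x + t *\<^sub>R ?e))) (at t within ball 0 d)"
  proof (rule has_derivative_sequence[where f'="\<lambda>m t h. h * Dveps (\<epsilon> m) (x + t *\<^sub>R ?e)"])
    show "((\<lambda>t. veps (\<epsilon> m) (x + t *\<^sub>R ?e)) has_derivative (\<lambda>h. h * Dveps (\<epsilon> m) (x + t *\<^sub>R ?e))) (at t within ball 0 d)" for m t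
    proof (rule has_derivative_at_withinI)
      have "(\<lambda>h. h * Dveps (\<epsilon> m) (x + t *\<^sub>R ?e)) = (*) (Dveps (\<epsilon> m) (x + t *\<^sub>R ?e))" by (simp add: fun_eq_iff)
      then show "((\<lambda>t. veps (\<epsilon> m) (x + t *\<^sub>R ?e)) has_derivative (\<lambda>h. h * Dveps (\<epsilon> m) (x + t *\<^sub>R ?e))) (at t)"
        using has_partial_deriv_shift[OF veps_has_partial_deriv[OF \<epsilon>]] unfolding has_field_derivative_def by simp
    qed
    show "\<forall>\<^sub>F m in sequentially. \<forall>t\<in>ball 0 d. \<forall>h. norm (h * Dveps (\<epsilon> m) (x + t *\<^sub>R ?e) - h * u (x + t *\<^sub>R ?e)) \<le> e * norm h"
      if "e > 0" for e
    proof -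
      have "\<forall>\<^sub>F \<epsilon> in at_right 0. \<forall>z\<in>ball x d. dist (Dveps \<epsilon> z) (u z) < e"
        by (rule uniform_limitD[OF uniform_limit_Dveps[OF d] that])
      then have "\<forall>\<^sub>F m in sequentially. \<forall>z\<in>ball x d. dist (Dveps (\<epsilon> m) z) (u z) < e"
        using \<epsilon>_lim by (rule eventually_compose_filterlim)
      then show ?thesis
      proof (rule eventually_mono, intro ballI allI)
        fix m and t h :: real assume m: "\<forall>z\<in>ball x d. dist (Dveps (\<epsilon> m) z) (u z) < e" and t: "t \<in> ball 0 d"
        have "\<bar>Dveps (\<epsilon> m) (x + t *\<^sub>R ?e) - u (x + t *\<^sub>R ?e)\<bar> \<le> e"
          using m z[OF t] by (auto simp: dist_real_def intro: less_imp_le)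
        from mult_left_mono[OF this, of "\<bar>h\<bar>"]
        show "norm (h * Dveps (\<epsilon> m) (x + t *\<^sub>R ?e) - h * u (x + t *\<^sub>R ?e)) \<le> e * norm h"
          by (simp add: right_diff_distrib[symmetric] abs_mult mult.commute)
      qed
    qed
    show "(\<lambda>m. veps (\<epsilon> m) (x + 0 *\<^sub>R ?e)) \<longlonglongrightarrow> v (x + 0 *\<^sub>R ?e)" using d(1) by (intro conv) simp
  qed (use d in auto)
  then obtain w where w: "\<forall>t\<in>ball 0 d. (\<lambda>m. veps (\<epsilon> m) (x + t *\<^sub>R ?e)) \<longlonglongrightarrow> w t \<and>
      (w has_derivative (\<lambda>h. h * u (x + t *\<^sub>R ?e))) (at t within ball 0 d)" by blast
  have w1: "(\<lambda>m. veps (\<epsilon> m) (x + t *\<^sub>R ?e)) \<longlonglongrightarrow> w t" if "t \<in> ball 0 d" for t :: real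
    using w that by blast
  have "(w has_derivative (\<lambda>h. h * u (x + 0 *\<^sub>R ?e))) (at 0 within ball 0 d)"
    by (rule conjunct2[OF bspec[OF w]]) (use d(1) in simp)
  moreover have "(\<lambda>h. h * u (x + 0 *\<^sub>R ?e)) = (*) (u x)" by (simp add: fun_eq_iff)
  ultimately have "(w has_real_derivative u x) (at 0)"
    using d(1) by (simp add: has_field_derivative_def at_within_open[of 0 "ball 0 d"])
  then have "((\<lambda>t. v (x + t *\<^sub>R ?e)) has_real_derivative u x) (at 0)"
    by (rule has_field_derivative_transform_within_open[of _ _ _ "ball 0 d"])
      (use d(1) LIMSEQ_unique[OF w1 conv] in auto)
  then show ?thesis by (simp add: has_partial_deriv_def)
qed

end

section \<open>From a fixed pair of indices to the vector field\<close>

theorem theorem13: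
  fixes \<psi> :: "real^'n \<Rightarrow> real"
    and \<Omega> :: "(real^'n) set"
    and F :: "real^'n \<Rightarrow> real"
    and c :: "real^'n" and R :: real
    and \<eta> :: "real \<Rightarrow> real"
    and v :: "'n \<Rightarrow> real^'n \<Rightarrow> real"
    and veps :: "real \<Rightarrow> 'n \<Rightarrow> real^'n \<Rightarrow> real"
    and u :: "'n \<Rightarrow> 'n \<Rightarrow> real^'n \<Rightarrow> real"
  assumes n2: "CARD('n) \<ge> 2"
    and psi_smooth: "smooth_Rn \<psi>"
    and psi_supp: "closure {x. \<psi> x \<noteq> 0} \<subseteq> ball 0 1"
    and psi_int: "(LINT x | lborel. \<psi> x) = 1"
    and Omega_open: "open \<Omega>" and Omega_bdd: "bounded \<Omega>"
    and Omega_star: "\<forall>p\<in>cball 0 1. p \<in> \<Omega> \<and> (\<forall>y\<in>\<Omega>. closed_segment p y \<subseteq> \<Omega>)"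
    and F_dini: "dini_continuous F \<Omega>"
    and F_ext: "\<forall>y. y \<notin> \<Omega> \<longrightarrow> F y = 0"
    and R_pos: "R > 0"
    and BR: "closure \<Omega> \<subseteq> ball c R"
    and eta_smooth: "smooth_real_on {0<..} \<eta>"
    and eta_0: "\<forall>t\<in>{0..1}. \<eta> t = 0"
    and eta_1: "\<forall>t\<ge>2. \<eta> t = 1"
    and eta_deriv: "\<forall>t>0. \<bar>deriv \<eta> t\<bar> \<le> 2"
    and v_def: "\<And>i x. v i x = (LINT y : \<Omega> | lborel. F y * kernN \<psi> i x y)"
    and veps_def: "\<And>\<epsilon> i x. veps \<epsilon> i x =
        (LINT y : \<Omega> | lborel. F y * kernN \<psi> i x y * \<eta> (norm (x - y) / \<epsilon>))"
    and u_def: "\<And>i j x. u i j x =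
        (LINT y : ball c R | lborel. (F y - F x) * partial j (\<lambda>z. kernN \<psi> i z y) x)
        + F x * (LINT y : ball c R | lborel. (x$i - y$i) *
              (LINT \<alpha> : {1..} | lborel. partial j \<psi> (y + \<alpha> *\<^sub>R (x - y)) * \<alpha> ^ (CARD('n) - 1)))
        - F x * sphere_integral c R (\<lambda>y. kernN \<psi> i x y * ((y - c)$j / R))"
  shows
    \<comment> \<open>(i) u i j x is well defined (all integrals involved exist) for x in Omega\<close>
    "(\<forall>i j. \<forall>x\<in>\<Omega>.
        (\<forall>y. y \<noteq> x \<longrightarrow>
           set_integrable lborel {1..} (\<lambda>\<alpha>. \<psi> (y + \<alpha> *\<^sub>R (x - y)) * \<alpha> ^ (CARD('n) - 1)) \<and>
           set_integrable lborel {1..} (\<lambda>\<alpha>. partial j \<psi> (y + \<alpha> *\<^sub>R (x - y)) * \<alpha> ^ (CARD('n) - 1)) \<and>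
           (\<exists>D. has_partial_deriv j (\<lambda>z. kernN \<psi> i z y) D x)) \<and>
        set_integrable lborel (ball c R) (\<lambda>y. (F y - F x) * partial j (\<lambda>z. kernN \<psi> i z y) x) \<and>
        set_integrable lborel (ball c R) (\<lambda>y. (x$i - y$i) *
              (LINT \<alpha> : {1..} | lborel. partial j \<psi> (y + \<alpha> *\<^sub>R (x - y)) * \<alpha> ^ (CARD('n) - 1))) \<and>
        sphere_integrable c R (\<lambda>y. kernN \<psi> i x y * ((y - c)$j / R)))
     \<and> \<comment> \<open>(ii) uniform convergence of the partial derivatives of v^eps on compactly contained open sets\<close>
     (\<forall>\<Omega>'. open \<Omega>' \<and> closure \<Omega>' \<subseteq> \<Omega> \<longrightarrow> (\<forall>i j.
        (\<forall>\<^sub>F \<epsilon> in at_right 0. \<forall>x\<in>\<Omega>'. \<exists>D. has_partial_deriv j (veps \<epsilon> i) D x) \<and>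
        uniform_limit \<Omega>' (\<lambda>\<epsilon> x. partial j (veps \<epsilon> i) x) (u i j) (at_right 0)))
     \<and> \<comment> \<open>(iii) the partial derivatives of v equal u\<close>
     (\<forall>i j. \<forall>x\<in>\<Omega>. has_partial_deriv j (v i) (u i j x) x)
     \<and> \<comment> \<open>(iv) v = (v_1,...,v_n) is C^1 on Omega\<close>
     (\<exists>D :: real^'n \<Rightarrow> ((real^'n) \<Rightarrow>\<^sub>L (real^'n)).
        (\<forall>x\<in>\<Omega>. ((\<lambda>z. \<chi> i. v i z) has_derivative blinfun_apply (D x)) (at x)) \<and>
        continuous_on \<Omega> D)"
proof -
  have \<Omega>R: "\<Omega> \<subseteq> ball c R" using BR closure_subset by blast
  \<comment> \<open>On the bounded set \<Omega> this makes \<open>F\<close> bounded; continuity on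
    the open set together with the extension by 0 makes it Borel on the whole space.\<close>
  have "uniformly_continuous_on \<Omega> F" by (rule dini_imp_uniformly_continuous[OF F_dini])
  then have F_cont: "continuous_on \<Omega> F" and "bounded (F ` \<Omega>)"
    using Omega_bdd by (auto intro: uniformly_continuous_imp_continuous bounded_uniformly_continuous_image)
  then obtain B where B: "\<forall>x\<in>\<Omega>. \<bar>F x\<bar> \<le> B" by (auto simp: bounded_iff)
  have FB: "\<bar>F x\<bar> \<le> \<bar>B\<bar>" for x
  proof (cases "x \<in> \<Omega>")
    case True
    then have "\<bar>F x\<bar> \<le> B" using B by blast
    then show ?thesis by linarith
  qed (use F_ext in simp)
  have "(\<lambda>x. indicator \<Omega> x *\<^sub>R F x) \<in> borel_measurable borel"
    using Omega_open F_cont by (intro borel_measurable_continuous_on_indicator) auto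
  moreover have "(\<lambda>x. indicator \<Omega> x *\<^sub>R F x) = F" using F_ext by (auto simp: indicator_def fun_eq_iff)
  ultimately have F_meas: "F \<in> borel_measurable borel" by simp
  obtain \<delta> g where g: "\<delta> > 0" "integrable lborel g" "\<And>r. 0 \<le> g r"
    "\<And>x y. x \<in> \<Omega> \<Longrightarrow> y \<in> \<Omega> \<Longrightarrow> x \<noteq> y \<Longrightarrow> norm (x - y) < \<delta> \<Longrightarrow> \<bar>F x - F y\<bar> \<le> norm (x - y) * g (norm (x - y))"
    using dini_gauge[OF F_dini] by blast
  have psi: "continuous_on UNIV \<psi>" "continuous_on UNIV (partial j \<psi>)" "has_partial_deriv j \<psi> (partial j \<psi> x) x" for j x
  proof -
    have iter: "continuous_on UNIV (iter_partial js \<psi>)" "\<exists>D. has_partial_deriv j (iter_partial js \<psi>) D x" for js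
      using psi_smooth unfolding smooth_Rn_def by blast+
    show "continuous_on UNIV \<psi>" "continuous_on UNIV (partial j \<psi>)"
      using iter(1)[of "[]"] iter(1)[of "[j]"] by simp_all
    show "has_partial_deriv j \<psi> (partial j \<psi> x) x"
      using iter(2)[of "[]"] unfolding has_partial_deriv_def partial_def by (auto dest: DERIV_imp_deriv)
  qed
  have supp: "\<psi> x = 0" "partial j \<psi> x = 0" if "1 \<le> norm x" for x j
  proof -
    \<comment> \<open>The support is closed and inside the open ball, so \<psi> vanishes in a
      neighbourhood of every such x, points of the unit sphere included; hence so does its
      derivative.\<close>
    have x: "x \<in> - closure {x. \<psi> x \<noteq> 0}" using psi_supp that by auto
    then show "\<psi> x = 0" using closure_subset[of "{x. \<psi> x \<noteq> 0}"] by auto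
    have "((\<lambda>t. \<psi> (x + t *\<^sub>R axis j 1)) has_real_derivative 0) (at 0)"
    proof (rule has_field_derivative_transform_within_open[OF DERIV_const])
      show "open ((\<lambda>t. x + t *\<^sub>R axis j 1) -` (- closure {x. \<psi> x \<noteq> 0}))"
        by (intro open_vimage continuous_intros) simp
      show "0 = \<psi> (x + t *\<^sub>R axis j 1)" if "t \<in> (\<lambda>t. x + t *\<^sub>R axis j 1) -` (- closure {x. \<psi> x \<noteq> 0})" for t
        using that closure_subset[of "{x. \<psi> x \<noteq> 0}"] by auto
    qed (use x in simp)
    then show "partial j \<psi> x = 0" unfolding partial_def by (rule DERIV_imp_deriv)
  qed
  have eta_der: "(deriv ^^ k) \<eta> field_differentiable (at t)" if "t > 0" for t k
    using eta_smooth that by (simp add: smooth_real_on_def)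
  have eta: "(\<eta> has_real_derivative deriv \<eta> t) (at t)" if "t > 0" for t
    using eta_der[OF that, of 0] by (simp add: field_differentiable_derivI)
  have eta': "continuous_on {0<..} (deriv \<eta>)"
    using eta_der[of _ 1] by (auto intro!: continuous_at_imp_continuous_on field_differentiable_imp_continuous_at)
  \<comment> \<open>The predicate has no argument for the component i, so one fact per j covers
    every component.\<close>
  have dp: "dini_potential \<psi> (partial j \<psi>) j \<eta> \<Omega> F c R \<bar>B\<bar> \<delta> g" for j
    using psi supp eta eta' eta_0 eta_1 eta_deriv Omega_open R_pos \<Omega>R F_meas FB F_ext g
    by unfold_locales auto
  have v_deriv: "has_partial_deriv j (v i) (u i j x) x" if "x \<in> \<Omega>" for i j x
  proof -
    interpret P: dini_potential \<psi> "partial j \<psi>" i j \<eta> \<Omega> F c R "\<bar>B\<bar>" \<delta> g by (rule dp)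
    have "P.v = v i" by (simp add: fun_eq_iff P.v_def v_def)
    moreover have "P.u x = u i j x" by (simp only: P.u_def u_def)
    ultimately show ?thesis using P.v_has_partial_deriv[OF that] by simp
  qed
  have u_cont: "continuous_on \<Omega> (u i j)" for i j
  proof -
    interpret P: dini_potential \<psi> "partial j \<psi>" i j \<eta> \<Omega> F c R "\<bar>B\<bar>" \<delta> g by (rule dp)
    have "P.u = u i j" by (intro ext) (simp only: P.u_def u_def)
    then show ?thesis using P.continuous_on_u by simp
  qed
  have veps: "(\<forall>\<^sub>F \<epsilon> in at_right 0. \<forall>x\<in>\<Omega>'. \<exists>D. has_partial_deriv j (veps \<epsilon> i) D x) \<and>
      uniform_limit \<Omega>' (\<lambda>\<epsilon> x. partial j (veps \<epsilon> i) x) (u i j) (at_right 0)"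
    if \<Omega>': "closure \<Omega>' \<subseteq> \<Omega>" for \<Omega>' i j
  proof -
    interpret P: dini_potential \<psi> "partial j \<psi>" i j \<eta> \<Omega> F c R "\<bar>B\<bar>" \<delta> g by (rule dp)
    have u: "P.u = u i j" by (intro ext) (simp only: P.u_def u_def)
    have v: "P.veps \<epsilon> = veps \<epsilon> i" for \<epsilon> by (simp add: fun_eq_iff P.veps_def veps_def)
    have der: "has_partial_deriv j (veps \<epsilon> i) (P.Dveps \<epsilon> x) x" if "\<epsilon> > 0" for \<epsilon> x
      using P.veps_has_partial_deriv[OF that] by (simp add: v)
    \<comment> \<open>Compactness provides one radius \<open>d\<close> for all points of \<Omega>',
      the form in which the uniform estimate takes its input.\<close>
    have "compact (closure \<Omega>')"
      using bounded_subset[OF Omega_bdd] closure_subset \<Omega>' by (intro compact_closure[THEN iffD2]) blast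
    from compact_subset_open_imp_ball_epsilon_subset[OF this Omega_open \<Omega>']
    obtain d where d: "d > 0" "(\<Union>x\<in>closure \<Omega>'. ball x d) \<subseteq> \<Omega>" by blast
    have "uniform_limit \<Omega>' P.Dveps P.u (at_right 0)"
    proof (rule P.uniform_limit_Dveps[OF d(1)])
      show "ball x d \<subseteq> \<Omega>" if "x \<in> \<Omega>'" for x using d(2) that closure_subset by blast
    qed
    moreover have "\<forall>\<^sub>F \<epsilon> in at_right 0. \<forall>x\<in>\<Omega>'. P.Dveps \<epsilon> x = partial j (veps \<epsilon> i) x"
      using eventually_at_right_less[of 0]
    proof eventually_elim
      case (elim \<epsilon>)
      then show ?case using der unfolding has_partial_deriv_def partial_def by (metis DERIV_imp_deriv)
    qed
    ultimately have "uniform_limit \<Omega>' (\<lambda>\<epsilon> x. partial j (veps \<epsilon> i) x) (u i j) (at_right 0)"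
      unfolding u by (rule uniform_limit_cong[THEN iffD1, rotated 2]) auto
    moreover have "\<forall>\<^sub>F \<epsilon> in at_right 0. \<forall>x\<in>\<Omega>'. \<exists>D. has_partial_deriv j (veps \<epsilon> i) D x"
      using eventually_at_right_less[of 0] by eventually_elim (use der in blast)
    ultimately show ?thesis by blast
  qed
  have well_def: "(\<forall>y. y \<noteq> x \<longrightarrow>
      set_integrable lborel {1..} (\<lambda>\<alpha>. \<psi> (y + \<alpha> *\<^sub>R (x - y)) * \<alpha> ^ (CARD('n) - 1)) \<and>
      set_integrable lborel {1..} (\<lambda>\<alpha>. partial j \<psi> (y + \<alpha> *\<^sub>R (x - y)) * \<alpha> ^ (CARD('n) - 1)) \<and>
      (\<exists>D. has_partial_deriv j (\<lambda>z. kernN \<psi> i z y) D x)) \<and>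
      set_integrable lborel (ball c R) (\<lambda>y. (F y - F x) * partial j (\<lambda>z. kernN \<psi> i z y) x) \<and>
      set_integrable lborel (ball c R) (\<lambda>y. (x$i - y$i) *
        (LINT \<alpha> : {1..} | lborel. partial j \<psi> (y + \<alpha> *\<^sub>R (x - y)) * \<alpha> ^ (CARD('n) - 1))) \<and>
      sphere_integrable c R (\<lambda>y. kernN \<psi> i x y * ((y - c)$j / R))" if x: "x \<in> \<Omega>" for i j x
  proof -
    interpret P: dini_potential \<psi> "partial j \<psi>" i j \<eta> \<Omega> F c R "\<bar>B\<bar>" \<delta> g by (rule dp)
    have "set_integrable lborel (ball c R) (P.K x)" using x \<Omega>R by (intro P.set_integrable_K) auto
    then have "set_integrable lborel (ball c R) (\<lambda>y. (x$i - y$i) *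
        (LINT \<alpha> : {1..} | lborel. partial j \<psi> (y + \<alpha> *\<^sub>R (x - y)) * \<alpha> ^ (CARD('n) - 1)))"
      by (simp add: P.K_def[abs_def] ray_int_def)
    moreover have "set_integrable lborel {1..} (\<lambda>\<alpha>. \<psi> (y + \<alpha> *\<^sub>R (x - y)) * \<alpha> ^ (CARD('n) - 1))"
      "set_integrable lborel {1..} (\<lambda>\<alpha>. partial j \<psi> (y + \<alpha> *\<^sub>R (x - y)) * \<alpha> ^ (CARD('n) - 1))"
      "\<exists>D. has_partial_deriv j (\<lambda>z. kernN \<psi> i z y) D x" if "y \<noteq> x" for y
    proof -
      have "x - y \<noteq> 0" using that by simp
      then show "set_integrable lborel {1..} (\<lambda>\<alpha>. \<psi> (y + \<alpha> *\<^sub>R (x - y)) * \<alpha> ^ (CARD('n) - 1))"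
        "set_integrable lborel {1..} (\<lambda>\<alpha>. partial j \<psi> (y + \<alpha> *\<^sub>R (x - y)) * \<alpha> ^ (CARD('n) - 1))"
        using set_integrable_ray_int[OF psi(1) supp(1)] set_integrable_ray_int[OF psi(2) supp(2)] by blast+
      show "\<exists>D. has_partial_deriv j (\<lambda>z. kernN \<psi> i z y) D x"
        using P.N_has_partial_deriv[of x y] that by blast
    qed
    ultimately show ?thesis
      by (intro conjI allI impI P.set_integrable_partial_N[OF x] P.sphere_integrable_N[OF x])
  qed
  have C1: "\<exists>D :: real^'n \<Rightarrow> ((real^'n) \<Rightarrow>\<^sub>L (real^'n)).
      (\<forall>x\<in>\<Omega>. ((\<lambda>z. \<chi> i. v i z) has_derivative blinfun_apply (D x)) (at x)) \<and> continuous_on \<Omega> D"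
  proof -
    \<comment> \<open>Matrix units as bounded linear maps: writing the derivative as a finite
      combination of them reduces its continuity in operator norm to that of the scalar coefficients
      \<open>u i j\<close>.\<close>
    define E :: "'n \<Rightarrow> 'n \<Rightarrow> (real^'n) \<Rightarrow>\<^sub>L (real^'n)" where "E i j = Blinfun (\<lambda>h. h$j *\<^sub>R axis i 1)" for i j
    have E: "blinfun_apply (E i j) h = h$j *\<^sub>R axis i 1" for i j h
      unfolding E_def
      by (subst bounded_linear_Blinfun_apply) (intro bounded_linear_scaleR_const bounded_linear_vec_nth, rule refl)
    define D where "D x = (\<Sum>i\<in>UNIV. \<Sum>j\<in>UNIV. u i j x *\<^sub>R E i j)" for x
    have "continuous_on \<Omega> D"
      unfolding D_def by (intro continuous_intros u_cont)
    moreover have "((\<lambda>z. \<chi> i. v i z) has_derivative blinfun_apply (D x)) (at x)" if x: "x \<in> \<Omega>" for x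
    proof -
      have "(v i has_derivative (\<lambda>h. \<Sum>j\<in>UNIV. u i j x * h$j)) (at x)" for i
        by (rule has_derivative_partials[OF Omega_open x v_deriv u_cont])
      then have "((\<lambda>z. \<Sum>i\<in>UNIV. v i z *\<^sub>R axis i (1::real)) has_derivative
          (\<lambda>h. \<Sum>i\<in>UNIV. (\<Sum>j\<in>UNIV. u i j x * h$j) *\<^sub>R axis i 1)) (at x)"
        by (intro has_derivative_sum has_derivative_scaleR_left)
      moreover have "(\<Sum>i\<in>UNIV. v i z *\<^sub>R axis i (1::real)) = (\<chi> i. v i z)" for z
        by (simp add: vec_eq_iff axis_def if_distrib[where f="\<lambda>a. _ * a"] cong: if_cong)
      moreover have "(\<lambda>h. \<Sum>i\<in>UNIV. (\<Sum>j\<in>UNIV. u i j x * h$j) *\<^sub>R axis i 1) = blinfun_apply (D x)"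
        by (simp add: fun_eq_iff D_def blinfun.sum_left blinfun.scaleR_left E scaleR_sum_left)
      ultimately show ?thesis by simp
    qed
    ultimately show ?thesis by blast
  qed
  show ?thesis using well_def veps v_deriv C1 by blast
qed

end
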